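(* There exists a universal constant $C_{\mathrm{en}}>0$ such that, for all integers $d,k,T\ge1$ and every deterministic algorithm $\mathsf d\in\mathcal A_{\mathrm{det}}^{(T)}$, the augmented posterior means satisfy $$\mathbb E_\Xi\left\|\mathbf m_T\right\|_2^2\le C_{\mathrm{en}}\,T\log(ek).$$ Consequently, $$\mathbb E_\Xi\left\|\mathbf m_T^{\mathrm{sc}}\right\|_2^2\le C_{\mathrm{en}}\,\frac{T\log(ek)}{d}.$$
   Context: $B_2^d=\{\mathbf x\in\mathbb R^d:\|\mathbf x\|_2\le1\}$, $[k]=\{1,\dots,k\}$. Deterministic algorithms. An element $\mathsf d\in\mathcal A_{\mathrm{det}}^{(T)}$ is a tuple $(\mathbf x_1,\pi_2,\dots,\pi_T,\pi_{\mathrm{out}})$ with $\mathbf x_1\in B_2^d$ and Borel maps $\pi_t:\mathbb R^{t-1}\to B_2^d$ ($t=2,\dots,T$), $\pi_{\mathrm{out}}:\mathbb R^T\to B_2^d$. Hard distribution. $\gamma_d^{\mathrm{tr}}$ is the law of $\mathbf g\sim N(\mathbf 0,\mathbf I_d)$ conditioned on $\|\mathbf g\|_2\le2\sqrt d$. $\Xi=(\breve{\mathbf b}_1,\dots,\breve{\mathbf b}_k)$ with $\breve{\mathbf b}_i$ i.i.d. $\sim\gamma_d^{\mathrm{tr}}$; $\mathbb P_\Xi,\mathbb E_\Xi$ are the corresponding probability and expectation. Put $\breve{\mathbf a}_i=\breve{\mathbf b}_i/\sqrt d$, $f_\Xi(\mathbf x)=\max_{1\le i\le k}\langle\breve{\mathbf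 a}_i,\mathbf x\rangle$ for $\mathbf x\in B_2^d$, $\breve{\mathbf s}=\sum_{i=1}^k\breve{\mathbf b}_i$ and $\breve{\mathbf s}^{\mathrm{sc}}=\sum_{i=1}^k\breve{\mathbf a}_i=\breve{\mathbf s}/\sqrt d$. Augmented transcript. Run $\mathsf d$ on $f_\Xi$: $\breve{\mathbf x}_1=\mathbf x_1$ and $\breve{\mathbf x}_t=\pi_t(f_\Xi(\breve{\mathbf x}_1),\dots,f_\Xi(\breve{\mathbf x}_{t-1}))$ for $t=2,\dots,T$. Set $\breve Y_t=\max_{1\le i\le k}\langle\breve{\mathbf b}_i,\breve{\mathbf x}_t\rangle$ $(=\sqrt d\,f_\Xi(\breve{\mathbf x}_t))$, and let $\breve I_t\in[k]$ be the smallest index $i$ with $\langle\breve{\mathbf b}_i,\breve{\mathbf x}_t\rangle=\breve Y_t$. The augmented transcript is $\mathsf T_T=((\breve I_s,\breve Y_s,\breve{\mathbf x}_s))_{s=1}^T$ and $\mathcal G_T=\sigma(\mathsf T_T)$. The augmented posterior means are $\mathbf m_T=\mathbb E_\Xi[\breve{\mathbf s}\mid\mathcal G_T]$ and $\mathbf m_T^{\mathrm{sc}}=\mathbb E_\Xi[\breve{\mathbf s}^{\mathrm{sc}}\mid\mathcal G_T]=\mathbf m_T/\sqrt d$. "Universal" means independent of $d,k,T,\mathsf d$. *)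

theory Defs
  imports "HOL-Probability.Probability"
begin

text \<open>
  The constant in the theorem has to be uniform in the dimension, so the dimension cannot be a
  type. A vector in the \<open>d\<close>-dimensional space is an extensional function on \<open>{1..d}\<close>, and the Borel
  structure is the product one.
\<close>

type_synonym vec = "nat \<Rightarrow> real"

definition Rn :: "nat \<Rightarrow> vec measure" where
  "Rn d = Pi\<^sub>M {1..d} (\<lambda>_. borel)"

definition ip :: "nat \<Rightarrow> vec \<Rightarrow> vec \<Rightarrow> real" where
  "ip d x y = (\<Sum>j\<in>{1..d}. x j * y j)"

definition B2 :: "nat \<Rightarrow> vec set" where
  "B2 d = {x \<in> space (Rn d). L2_set x {1..d} \<le> 1}"

record det_alg =
  init :: vec
  policy :: "nat \<Rightarrow> vec \<Rightarrow> vec"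
  outp :: "vec \<Rightarrow> vec"

text \<open>
  Measurability into the restricted space includes that the map takes values in the unit ball.
  The values of \<open>policy A\<close> outside \<open>{2..T}\<close> play no role.
\<close>

definition A_det :: "nat \<Rightarrow> nat \<Rightarrow> det_alg set" where
  "A_det d T = {A. init A \<in> B2 d
      \<and> (\<forall>t\<in>{2..T}. policy A t \<in> Rn (t - 1) \<rightarrow>\<^sub>M restrict_space (Rn d) (B2 d))
      \<and> outp A \<in> Rn T \<rightarrow>\<^sub>M restrict_space (Rn d) (B2 d)}"

lemma restrict_fundef_cong [fundef_cong]:
  "I = J \<Longrightarrow> (\<And>i. i \<in> J \<Longrightarrow> f i = g i) \<Longrightarrow> restrict f I = restrict g J"
  by (auto simp: restrict_def)

text \<open>Query points are indexed from 1; the value at index 0 is not used.\<close>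

function query :: "det_alg \<Rightarrow> (vec \<Rightarrow> real) \<Rightarrow> nat \<Rightarrow> vec" where
  "query A f t = (if t \<le> 1 then init A
                  else policy A t (restrict (\<lambda>s. f (query A f s)) {1..t - 1}))"
  by auto
termination
  by (relation "Wellfounded.measure (\<lambda>(A, f, t). t)") auto

declare query.simps [simp del]

definition std_gaussian :: "nat \<Rightarrow> vec measure" where
  "std_gaussian d = Pi\<^sub>M {1..d} (\<lambda>_. density lborel (\<lambda>x. ennreal (std_normal_density x)))"

definition gamma_tr :: "nat \<Rightarrow> vec measure" where
  "gamma_tr d = uniform_measure (std_gaussian d)
     {g \<in> space (Rn d). L2_set g {1..d} \<le> 2 * sqrt (real d)}"

text \<open>A sample point \<open>b\<close> is the family of the vectors \<open>b 1, \<dots>, b k\<close>.\<close>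

definition Xi_law :: "nat \<Rightarrow> nat \<Rightarrow> (nat \<Rightarrow> vec) measure" where
  "Xi_law d k = Pi\<^sub>M {1..k} (\<lambda>_. gamma_tr d)"

definition a_vec :: "nat \<Rightarrow> (nat \<Rightarrow> vec) \<Rightarrow> nat \<Rightarrow> vec" where
  "a_vec d b i = (\<lambda>j. b i j / sqrt (real d))"

definition f_Xi :: "nat \<Rightarrow> nat \<Rightarrow> (nat \<Rightarrow> vec) \<Rightarrow> vec \<Rightarrow> real" where
  "f_Xi d k b x = Max ((\<lambda>i. ip d (a_vec d b i) x) ` {1..k})"

definition s_vec :: "nat \<Rightarrow> (nat \<Rightarrow> vec) \<Rightarrow> vec" where
  "s_vec k b = (\<lambda>j. \<Sum>i\<in>{1..k}. b i j)"

definition s_sc_vec :: "nat \<Rightarrow> nat \<Rightarrow> (nat \<Rightarrow> vec) \<Rightarrow> vec" where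
  "s_sc_vec d k b = (\<lambda>j. \<Sum>i\<in>{1..k}. a_vec d b i j)"

definition X_query :: "nat \<Rightarrow> nat \<Rightarrow> det_alg \<Rightarrow> (nat \<Rightarrow> vec) \<Rightarrow> nat \<Rightarrow> vec" where
  "X_query d k A b t = query A (f_Xi d k b) t"

definition Y_val :: "nat \<Rightarrow> nat \<Rightarrow> det_alg \<Rightarrow> (nat \<Rightarrow> vec) \<Rightarrow> nat \<Rightarrow> real" where
  "Y_val d k A b t = Max ((\<lambda>i. ip d (b i) (X_query d k A b t)) ` {1..k})"

definition I_idx :: "nat \<Rightarrow> nat \<Rightarrow> det_alg \<Rightarrow> (nat \<Rightarrow> vec) \<Rightarrow> nat \<Rightarrow> nat" where
  "I_idx d k A b t =
     (LEAST i. i \<in> {1..k} \<and> ip d (b i) (X_query d k A b t) = Y_val d k A b t)"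

definition transcript ::
  "nat \<Rightarrow> nat \<Rightarrow> nat \<Rightarrow> det_alg \<Rightarrow> (nat \<Rightarrow> vec) \<Rightarrow> nat \<Rightarrow> nat \<times> real \<times> vec" where
  "transcript d k T A b =
     restrict (\<lambda>s. (I_idx d k A b s, Y_val d k A b s, X_query d k A b s)) {1..T}"

definition transcript_space :: "nat \<Rightarrow> nat \<Rightarrow> (nat \<Rightarrow> nat \<times> real \<times> vec) measure" where
  "transcript_space d T =
     Pi\<^sub>M {1..T} (\<lambda>_. count_space UNIV \<Otimes>\<^sub>M (borel \<Otimes>\<^sub>M Rn d))"

definition G_sigma :: "nat \<Rightarrow> nat \<Rightarrow> nat \<Rightarrow> det_alg \<Rightarrow> (nat \<Rightarrow> vec) measure" where
  "G_sigma d k T A =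
     vimage_algebra (space (Xi_law d k)) (transcript d k T A) (transcript_space d T)"

text \<open>Conditional expectation of a random vector, taken coordinate by coordinate.\<close>

definition vec_cond_exp ::
  "'a measure \<Rightarrow> 'a measure \<Rightarrow> ('a \<Rightarrow> vec) \<Rightarrow> 'a \<Rightarrow> vec" where
  "vec_cond_exp M F V w = (\<lambda>j. real_cond_exp M F (\<lambda>w'. V w' j) w)"

definition post_mean :: "nat \<Rightarrow> nat \<Rightarrow> nat \<Rightarrow> det_alg \<Rightarrow> (nat \<Rightarrow> vec) \<Rightarrow> vec" where
  "post_mean d k T A = vec_cond_exp (Xi_law d k) (G_sigma d k T A) (s_vec k)"

definition post_mean_sc :: "nat \<Rightarrow> nat \<Rightarrow> nat \<Rightarrow> det_alg \<Rightarrow> (nat \<Rightarrow> vec) \<Rightarrow> vec" where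
  "post_mean_sc d k T A = vec_cond_exp (Xi_law d k) (G_sigma d k T A) (s_sc_vec d k)"

end

theory Submission
  imports Defs
begin

text \<open>
  Write \<open>m j\<close> for the posterior mean of the vector \<open>b j\<close>. Fix the sequence \<open>i\<close> of maximizing indices. The
  event that it occurs is an intersection of conditions each of which involves, besides the
  observations, a single vector; and for a prescribed \<open>i\<close> the observations are adaptive linear
  measurements of single vectors. Hence the vectors are conditionally independent given the
  transcript, the \<open>m j\<close> are uncorrelated, and the energy is \<open>\<Sum>j. E |m j|^2 = \<Sum>j. E \<langle>b j, m j\<rangle>\<close>.

  By Jensen's inequality, \<open>E Z \<le> ln (E (exp Z))\<close> for \<open>Z = \<Sum>j. \<langle>b j, m j / 2\<rangle> - |m j / 2|^2\<close>, and \<open>E Z\<close> is a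
  quarter of the energy. On the event of the sequence \<open>i\<close>, the vector \<open>m j\<close> is a function \<open>h j\<close> of the
  linear measurements; dropping the indicator of the event, \<open>E (exp Z)\<close> is at most the sum over the
  \<open>k^T\<close> sequences of the exponential moments for the linear measurements. Each of these is at most
  \<open>4^T\<close>: the vectors that are never measured are independent of \<open>h\<close> and subgaussian; for the at most \<open>T\<close>
  others, replacing the truncated law by the Gaussian one costs a factor \<open>2\<close>, and then one new
  Gaussian direction is revealed per step, at the cost of a factor \<open>E (exp (g^2 / 4)) = sqrt 2\<close>.
\<close>

text \<open>The obstacle: m j is a function of answers to which b j itself contributed, so it cannot
  be treated as a fixed vector inside an exponential moment. For a prescribed index sequence,
  conditioning on the linear observations freezes every h j and leaves an explicit law, a centre
  plus an orthogonal projection of fresh Gaussian noise. Since the dimension is a number, the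
  rotation invariance behind this is built up from the plane. The shape of Z: for h j = c m j the
  expected exponent is (c - c^2) times the energy, largest at c = 1/2. The penalty is |h|^2 for two
  reasons. The truncated law is only shown to satisfy E exp <b, h> <= exp (|h|^2). And completing
  the square then leaves |centre|^2 / 4; with the penalty |h|^2 / 2 it would leave |centre|^2 / 2,
  whose exponential moment is in general infinite. The truncation factor 2 must not be paid for all
  k vectors: 2^k would put a term of order k into the logarithm. Hence the separate treatment of
  vectors that are never measured. The number k^T of sequences is the only source of log k.\<close>

declare One_nat_def [simp del]

section \<open>Gaussian vectors\<close>

abbreviation N1 :: "real measure" where
  "N1 \<equiv> density lborel (\<lambda>x. ennreal (std_normal_density x))"

lemma nn_integral_N1:
  "f \<in> borel_measurable borel \<Longrightarrow> (\<integral>\<^sup>+ x. f x \<partial>N1) = (\<integral>\<^sup>+ x. ennreal (std_normal_density x) * f x \<partial>lborel)"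
  by (subst nn_integral_density) auto

text \<open>The map (p, q) to (\<alpha> p + \<beta> q, \<beta> p - \<alpha> q) is a reflection of
  the plane, and the product density depends only on p^2 + q^2.\<close>

lemma std_normal_density_orthogonal:
  assumes "\<alpha>\<^sup>2 + \<beta>\<^sup>2 = 1"
  shows "std_normal_density (\<alpha> * p + \<beta> * q) * std_normal_density (\<beta> * p - \<alpha> * q) =
    std_normal_density p * std_normal_density q"
proof -
  have "(\<alpha> * p + \<beta> * q)\<^sup>2 + (\<beta> * p - \<alpha> * q)\<^sup>2 = (\<alpha>\<^sup>2 + \<beta>\<^sup>2) * (p\<^sup>2 + q\<^sup>2)"
    by (simp add: power2_eq_square algebra_simps)
  also have "\<dots> = p\<^sup>2 + q\<^sup>2" using assms by simp
  finally have "(\<alpha> * p + \<beta> * q)\<^sup>2 / 2 + (\<beta> * p - \<alpha> * q)\<^sup>2 / 2 = p\<^sup>2 / 2 + q\<^sup>2 / 2" by simp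
  then have "exp (- (\<alpha> * p + \<beta> * q)\<^sup>2 / 2) * exp (- (\<beta> * p - \<alpha> * q)\<^sup>2 / 2) = exp (- p\<^sup>2 / 2) * exp (- q\<^sup>2 / 2)"
    by (simp flip: exp_add)
  then show ?thesis unfolding std_normal_density_def by (simp add: field_simps)
qed

text \<open>Invariance of the planar law comes from two affine substitutions on the line, whose
  Jacobians 1/\<alpha> and \<alpha> cancel, instead of a change of variables in the plane.\<close>

lemma nn_integral_N1_orthogonal:
  assumes "\<alpha>\<^sup>2 + \<beta>\<^sup>2 = 1" "\<alpha> > 0"
    and [measurable]: "case_prod F \<in> borel_measurable (borel \<Otimes>\<^sub>M borel)"
  shows "(\<integral>\<^sup>+ p. \<integral>\<^sup>+ q. F (\<alpha> * p + \<beta> * q) (\<beta> * p - \<alpha> * q) \<partial>N1 \<partial>N1) = (\<integral>\<^sup>+ p. \<integral>\<^sup>+ q. F p q \<partial>N1 \<partial>N1)"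
proof -
  define K where "K p q = ennreal (std_normal_density p) * ennreal (std_normal_density q) * F p q" for p q
  have [measurable]: "case_prod K \<in> borel_measurable (borel \<Otimes>\<^sub>M borel)"
    unfolding K_def by measurable
  have K: "ennreal (std_normal_density p) * ennreal (std_normal_density q) * F (\<alpha> * p + \<beta> * q) (\<beta> * p - \<alpha> * q)
      = K (\<alpha> * p + \<beta> * q) (\<beta> * p - \<alpha> * q)" for p q
    unfolding K_def by (simp add: ennreal_mult[symmetric] std_normal_density_orthogonal[OF assms(1)])
  have "(\<integral>\<^sup>+ p. \<integral>\<^sup>+ q. F (\<alpha> * p + \<beta> * q) (\<beta> * p - \<alpha> * q) \<partial>N1 \<partial>N1)
     = (\<integral>\<^sup>+ p. \<integral>\<^sup>+ q. K (\<alpha> * p + \<beta> * q) (\<beta> * p - \<alpha> * q) \<partial>lborel \<partial>lborel)"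
    by (simp add: nn_integral_N1 nn_integral_cmult[symmetric] mult.assoc[symmetric] K)
  also have "\<dots> = (\<integral>\<^sup>+ q. \<integral>\<^sup>+ p. K (\<alpha> * p + \<beta> * q) (\<beta> * p - \<alpha> * q) \<partial>lborel \<partial>lborel)"
    by (rule lborel_pair.Fubini') simp
  also have "\<dots> = (\<integral>\<^sup>+ q. ennreal (1 / \<alpha>) * (\<integral>\<^sup>+ x. K x ((\<beta> * x - q) / \<alpha>) \<partial>lborel) \<partial>lborel)"
  proof (rule nn_integral_cong)
    fix q :: real
    have 1: "\<alpha> * (- (\<beta> * q) / \<alpha> + 1 / \<alpha> * x) + \<beta> * q = x" for x
      using assms(2) by (simp add: field_simps)
    \<comment> \<open>The normalisation \<alpha>^2 + \<beta>^2 = 1 collapses the coefficient of q to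
      -1/\<alpha>.\<close>
    have 2: "\<beta> * (- (\<beta> * q) / \<alpha> + 1 / \<alpha> * x) - \<alpha> * q = (\<beta> * x - q) / \<alpha>" for x
    proof -
      have "(\<beta> * (- (\<beta> * q) / \<alpha> + 1 / \<alpha> * x) - \<alpha> * q) * \<alpha> = \<beta> * x - (\<alpha>\<^sup>2 + \<beta>\<^sup>2) * q"
        using assms(2) by (simp add: field_simps power2_eq_square)
      then show ?thesis unfolding assms(1) using assms(2) by (simp add: eq_divide_eq)
    qed
    show "(\<integral>\<^sup>+ p. K (\<alpha> * p + \<beta> * q) (\<beta> * p - \<alpha> * q) \<partial>lborel) =
      ennreal (1 / \<alpha>) * (\<integral>\<^sup>+ x. K x ((\<beta> * x - q) / \<alpha>) \<partial>lborel)"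
      using nn_integral_real_affine[where c = "1 / \<alpha>" and t = "- (\<beta> * q) / \<alpha>"
          and f = "\<lambda>p. K (\<alpha> * p + \<beta> * q) (\<beta> * p - \<alpha> * q)", unfolded 1 2] assms(2) by simp
  qed
  also have "\<dots> = ennreal (1 / \<alpha>) * (\<integral>\<^sup>+ x. \<integral>\<^sup>+ q. K x ((\<beta> * x - q) / \<alpha>) \<partial>lborel \<partial>lborel)"
    by (subst lborel_pair.Fubini') (simp_all add: nn_integral_cmult)
  also have "\<dots> = ennreal (1 / \<alpha>) * (\<integral>\<^sup>+ x. ennreal \<alpha> * (\<integral>\<^sup>+ t. K x t \<partial>lborel) \<partial>lborel)"
  proof (intro arg_cong2[where f = "(*)"] nn_integral_cong refl)
    fix x :: real
    show "(\<integral>\<^sup>+ q. K x ((\<beta> * x - q) / \<alpha>) \<partial>lborel) = ennreal \<alpha> * (\<integral>\<^sup>+ t. K x t \<partial>lborel)"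
      using assms(2) by (subst nn_integral_real_affine[where c = "- \<alpha>" and t = "\<beta> * x"]) auto
  qed
  also have "\<dots> = (\<integral>\<^sup>+ x. \<integral>\<^sup>+ t. K x t \<partial>lborel \<partial>lborel)"
    using assms(2) by (simp add: nn_integral_cmult mult.assoc[symmetric] ennreal_mult[symmetric])
  also have "\<dots> = (\<integral>\<^sup>+ p. \<integral>\<^sup>+ q. F p q \<partial>N1 \<partial>N1)"
    by (simp add: nn_integral_N1 nn_integral_cmult[symmetric] mult.assoc[symmetric] K_def)
  finally show ?thesis .
qed

lemma nn_integral_N1_uminus:
  assumes [measurable]: "f \<in> borel_measurable borel"
  shows "(\<integral>\<^sup>+ x. f (- x) \<partial>N1) = (\<integral>\<^sup>+ x. f x \<partial>N1)"
proof -
  have "(\<integral>\<^sup>+ x. f (- x) \<partial>N1) = (\<integral>\<^sup>+ x. ennreal (std_normal_density x) * f (- x) \<partial>lborel)"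
    by (simp add: nn_integral_N1)
  also have "\<dots> = (\<integral>\<^sup>+ x. ennreal (std_normal_density x) * f x \<partial>lborel)"
    by (subst nn_integral_real_affine[where c = "-1" and t = 0]) (auto simp: std_normal_density_def)
  finally show ?thesis by (simp add: nn_integral_N1)
qed

lemma nn_integral_normal_density:
  "\<sigma> > 0 \<Longrightarrow> (\<integral>\<^sup>+ x. ennreal (normal_density \<mu> \<sigma> x) \<partial>lborel) = 1"
  by (subst nn_integral_eq_integral) (auto simp: normal_density_nonneg)

lemma nn_integral_N1_exp: "(\<integral>\<^sup>+ x. ennreal (exp (h * x)) \<partial>N1) = ennreal (exp (h\<^sup>2 / 2))"
proof -
  have eq: "std_normal_density x * exp (h * x) = exp (h\<^sup>2 / 2) * normal_density h 1 x" for x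
  proof -
    have "- x\<^sup>2 / 2 + h * x = h\<^sup>2 / 2 + - (x - h)\<^sup>2 / 2" by (simp add: power2_eq_square field_simps)
    then have "exp (- x\<^sup>2 / 2) * exp (h * x) = exp (h\<^sup>2 / 2) * exp (- (x - h)\<^sup>2 / 2)" by (simp only: exp_add[symmetric])
    then show ?thesis by (simp add: normal_density_def)
  qed
  have "(\<integral>\<^sup>+ x. ennreal (exp (h * x)) \<partial>N1) = (\<integral>\<^sup>+ x. ennreal (exp (h\<^sup>2 / 2)) * ennreal (normal_density h 1 x) \<partial>lborel)"
    by (subst nn_integral_N1) (auto simp: ennreal_mult[symmetric] eq)
  also have "\<dots> = ennreal (exp (h\<^sup>2 / 2))"
    by (simp add: nn_integral_cmult nn_integral_normal_density)
  finally show ?thesis .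
qed

text \<open>The weight doubles the variance, and the normalising constants differ by sqrt 2. The
  weight exp (x^2 / 2) would already diverge.\<close>

lemma nn_integral_N1_exp_square: "(\<integral>\<^sup>+ x. ennreal (exp (x\<^sup>2 / 4)) \<partial>N1) = ennreal (sqrt 2)"
proof -
  have eq: "std_normal_density x * exp (x\<^sup>2 / 4) = sqrt 2 * normal_density 0 (sqrt 2) x" for x
  proof -
    have "- x\<^sup>2 / 2 + x\<^sup>2 / 4 = - x\<^sup>2 / 4" by simp
    then have "exp (- x\<^sup>2 / 2) * exp (x\<^sup>2 / 4) = exp (- x\<^sup>2 / 4)" by (simp only: exp_add[symmetric])
    moreover have "1 / sqrt 2 = sqrt 2 / 2" by (simp add: field_simps)
    ultimately show ?thesis by (simp add: normal_density_def real_sqrt_mult field_simps)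
  qed
  have "(\<integral>\<^sup>+ x. ennreal (exp (x\<^sup>2 / 4)) \<partial>N1) = (\<integral>\<^sup>+ x. ennreal (sqrt 2) * ennreal (normal_density 0 (sqrt 2) x) \<partial>lborel)"
    by (subst nn_integral_N1) (auto simp: ennreal_mult[symmetric] eq)
  also have "\<dots> = ennreal (sqrt 2)"
    by (simp add: nn_integral_cmult nn_integral_normal_density)
  finally show ?thesis .
qed

lemma nn_integral_N1_square: "(\<integral>\<^sup>+ x. ennreal (x\<^sup>2) \<partial>N1) = 1"
proof -
  have "has_bochner_integral lborel (\<lambda>x. std_normal_density x * x ^ (2 * 1)) 1"
    using std_normal_moment_even[of 1] by simp
  then have "(\<integral>\<^sup>+ x. ennreal (std_normal_density x * x\<^sup>2) \<partial>lborel) = ennreal 1"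
    by (subst nn_integral_eq_integral) (auto simp: has_bochner_integral_iff)
  then show ?thesis by (subst nn_integral_N1) (auto simp: ennreal_mult)
qed

lemma prob_space_N1: "prob_space N1"
  by (rule prob_space_normal_density) simp

interpretation N1: prob_space N1
  by (rule prob_space_N1)

lemma emeasure_N1_UNIV: "emeasure N1 UNIV = 1"
  using N1.emeasure_space_1 by simp

interpretation N1_PiM: product_sigma_finite "\<lambda>_ :: nat. N1"
  by unfold_locales

interpretation N1_N1: pair_sigma_finite N1 N1
  by unfold_locales

section \<open>The product Gaussian law, measurability and inner products of vectors\<close>

lemma sets_std_gaussian [simp, measurable_cong]: "sets (std_gaussian d) = sets (Rn d)"
  unfolding std_gaussian_def Rn_def by (rule sets_PiM_cong) auto

lemma space_std_gaussian [simp]: "space (std_gaussian d) = space (Rn d)"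
  by (rule sets_eq_imp_space_eq) simp

lemma prob_space_std_gaussian: "prob_space (std_gaussian d)"
  unfolding std_gaussian_def by (rule prob_space_PiM) (rule prob_space_N1)

interpretation std_gaussian: prob_space "std_gaussian d" for d
  by (rule prob_space_std_gaussian)

interpretation std_gaussian_N1: pair_sigma_finite N1 "std_gaussian d" for d
  by unfold_locales

text \<open>The condition does not depend on the argument, so each branch need only be measurable
  when it is the selected one; this handles coordinate and index distinctions.\<close>

lemma measurable_if_const:
  assumes "c \<Longrightarrow> f \<in> M \<rightarrow>\<^sub>M N" "\<not> c \<Longrightarrow> g \<in> M \<rightarrow>\<^sub>M N"
  shows "(\<lambda>x. if c then f x else g x) \<in> M \<rightarrow>\<^sub>M N"
  using assms by (cases c) auto

lemma measurable_restrict_Rn: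
  assumes "\<And>r. r \<in> {1..d} \<Longrightarrow> (\<lambda>x. f x r) \<in> borel_measurable M"
  shows "(\<lambda>x. restrict (f x) {1..d}) \<in> M \<rightarrow>\<^sub>M Rn d"
  unfolding Rn_def using assms by (intro measurable_restrict) auto

lemma measurable_Rn_component:
  assumes "f \<in> M \<rightarrow>\<^sub>M Rn d" "r \<in> {1..d}"
  shows "(\<lambda>x. f x r) \<in> borel_measurable M"
  using measurable_compose[OF assms(1)[unfolded Rn_def] measurable_component_singleton[OF assms(2)]] by simp

lemma borel_measurable_ip:
  assumes "\<And>r. r \<in> {1..d} \<Longrightarrow> (\<lambda>x. f x r) \<in> borel_measurable M"
    "\<And>r. r \<in> {1..d} \<Longrightarrow> (\<lambda>x. g x r) \<in> borel_measurable M"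
  shows "(\<lambda>x. ip d (f x) (g x)) \<in> borel_measurable M"
  unfolding ip_def using assms by (intro borel_measurable_sum borel_measurable_times) auto

lemma measurable_component_Rn [measurable]:
  "r \<in> {1..d} \<Longrightarrow> (\<lambda>b. b r) \<in> borel_measurable (Rn d)"
  by (rule measurable_Rn_component[OF measurable_ident_sets]) auto

lemma measurable_ip_const [measurable]:
  "(\<lambda>b. ip d b x) \<in> borel_measurable (Rn d)" "(\<lambda>b. ip d b b) \<in> borel_measurable (Rn d)"
  by (auto intro!: borel_measurable_ip)

lemma restrict_Rn [simp]: "b \<in> space (Rn d) \<Longrightarrow> restrict b {1..d} = b"
  unfolding Rn_def by (auto simp: space_PiM)

lemma ip_restrict [simp]: "ip d (restrict f {1..d}) x = ip d f x" "ip d x (restrict f {1..d}) = ip d x f"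
  unfolding ip_def by auto

lemma ip_commute: "ip d x y = ip d y x"
  unfolding ip_def by (simp add: mult.commute)

lemma ip_lin [simp]:
  "ip d (\<lambda>r. f r + g r) x = ip d f x + ip d g x"
  "ip d (\<lambda>r. f r - g r) x = ip d f x - ip d g x"
  "ip d (\<lambda>r. a * f r) x = a * ip d f x"
  "ip d (\<lambda>r. f r * a) x = ip d f x * a"
  "ip d (\<lambda>r. f r / a) x = ip d f x / a"
  "ip d (\<lambda>r. 0) x = 0"
  "ip d (\<lambda>r. - f r) x = - ip d f x"
  "ip d x (\<lambda>r. f r + g r) = ip d x f + ip d x g"
  "ip d x (\<lambda>r. f r - g r) = ip d x f - ip d x g"
  "ip d x (\<lambda>r. a * f r) = a * ip d x f"
  "ip d x (\<lambda>r. f r * a) = ip d x f * a"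
  "ip d x (\<lambda>r. f r / a) = ip d x f / a"
  "ip d x (\<lambda>r. 0) = 0"
  "ip d x (\<lambda>r. - f r) = - ip d x f"
  unfolding ip_def
  by (simp_all add: algebra_simps sum.distrib sum_subtractf sum_distrib_left sum_distrib_right sum_divide_distrib sum_negf)

lemma ip_nonneg: "0 \<le> ip d x x"
  unfolding ip_def by (intro sum_nonneg) auto

lemma ip_eq_0D: "ip d x x = 0 \<Longrightarrow> r \<in> {1..d} \<Longrightarrow> x r = 0"
  unfolding ip_def by (subst (asm) sum_nonneg_eq_0_iff) auto

lemma ip_cong: "(\<And>r. r \<in> {1..d} \<Longrightarrow> f r = f' r) \<Longrightarrow> (\<And>r. r \<in> {1..d} \<Longrightarrow> g r = g' r) \<Longrightarrow> ip d f g = ip d f' g'"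
  unfolding ip_def by (intro sum.cong) auto

section \<open>Rotation invariance of the Gaussian vector\<close>

lemma ip_Suc: "ip (Suc d) x y = ip d x y + x (Suc d) * y (Suc d)"
  unfolding ip_def by (simp add: atLeastAtMostSuc_conv add.commute)

text \<open>The extended vector is written with \<open>restrict\<close> instead of a function
  update, so that measurability reduces to single coordinates.\<close>

lemma nn_integral_std_gaussian_Suc:
  assumes [measurable]: "F \<in> borel_measurable (Rn (Suc d))"
  shows "(\<integral>\<^sup>+ b. F b \<partial>std_gaussian (Suc d)) = (\<integral>\<^sup>+ t. \<integral>\<^sup>+ b. F (\<lambda>r\<in>{1..Suc d}. if r = Suc d then t else b r) \<partial>std_gaussian d \<partial>N1)"
proof -
  have eq: "{1..Suc d} = insert (Suc d) {1..d}" by auto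
  have "F \<in> borel_measurable (std_gaussian (Suc d))" by measurable
  then have "(\<integral>\<^sup>+ b. F b \<partial>std_gaussian (Suc d)) = (\<integral>\<^sup>+ t. \<integral>\<^sup>+ b. F (b(Suc d := t)) \<partial>std_gaussian d \<partial>N1)"
    unfolding std_gaussian_def eq by (intro N1_PiM.product_nn_integral_insert_rev) auto
  also have "\<dots> = (\<integral>\<^sup>+ t. \<integral>\<^sup>+ b. F (\<lambda>r\<in>{1..Suc d}. if r = Suc d then t else b r) \<partial>std_gaussian d \<partial>N1)"
  proof (intro nn_integral_cong arg_cong[where f = F])
    fix t :: real and b assume "b \<in> space (std_gaussian d)"
    then have "b \<in> extensional {1..d}" by (auto simp: Rn_def space_PiM PiE_def)
    then show "b(Suc d := t) = (\<lambda>r\<in>{1..Suc d}. if r = Suc d then t else b r)"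
      by (auto simp: fun_eq_iff extensional_def)
  qed
  finally show ?thesis .
qed

lemma measurable_compose_restrict_Rn:
  assumes "F \<in> borel_measurable (Rn d)" "\<And>r. r \<in> {1..d} \<Longrightarrow> (\<lambda>x. f x r) \<in> borel_measurable M"
  shows "(\<lambda>x. F (restrict (f x) {1..d})) \<in> borel_measurable M"
  using measurable_compose[OF measurable_restrict_Rn[OF assms(2)] assms(1)] by simp

lemma measurable_compose_split_last:
  assumes "F \<in> borel_measurable (Rn (Suc d))" "h \<in> borel_measurable M" "g \<in> M \<rightarrow>\<^sub>M Rn d"
  shows "(\<lambda>x. F (\<lambda>r\<in>{1..Suc d}. if r = Suc d then h x else g x r)) \<in> borel_measurable M"
  using assms
  by (intro measurable_compose_restrict_Rn[OF assms(1)] measurable_if_const) (auto intro!: measurable_Rn_component[of g M d])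

text \<open>This is the second marginal of the reflected pair; it fuses two independent coordinates
  into one.\<close>

lemma nn_integral_N1_combination:
  assumes "\<alpha>\<^sup>2 + \<beta>\<^sup>2 = 1" "\<alpha> > 0" and [measurable]: "f \<in> borel_measurable borel"
  shows "(\<integral>\<^sup>+ t. \<integral>\<^sup>+ p. f (\<beta> * p - \<alpha> * t) \<partial>N1 \<partial>N1) = (\<integral>\<^sup>+ q. f q \<partial>N1)"
proof -
  have "(\<integral>\<^sup>+ t. \<integral>\<^sup>+ p. f (\<beta> * p - \<alpha> * t) \<partial>N1 \<partial>N1) = (\<integral>\<^sup>+ p. \<integral>\<^sup>+ t. f (\<beta> * p - \<alpha> * t) \<partial>N1 \<partial>N1)"
    by (rule N1_N1.Fubini') simp
  also have "\<dots> = (\<integral>\<^sup>+ p. \<integral>\<^sup>+ q. f q \<partial>N1 \<partial>N1)"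
    by (rule nn_integral_N1_orthogonal[OF assms(1,2), where F = "\<lambda>p q. f q"]) simp
  finally show ?thesis by (simp add: emeasure_N1_UNIV)
qed

text \<open>The induction on the dimension splits off the last coordinate and rotates
  in the plane spanned by it and the direction of the remaining part of \<open>e\<close>.\<close>

lemma nn_integral_std_gaussian_unit:
  assumes "ip d e e = 1" and "F \<in> borel_measurable (Rn d)"
  shows "(\<integral>\<^sup>+ b. F b \<partial>std_gaussian d) =
    (\<integral>\<^sup>+ g. \<integral>\<^sup>+ b. F (\<lambda>r\<in>{1..d}. g * e r + (b r - ip d b e * e r)) \<partial>std_gaussian d \<partial>N1)"
  using assms
proof (induction d arbitrary: F e)
  case 0
  then show ?case by (simp add: ip_def)
next
  case (Suc d)
  note F [measurable] = Suc.prems(2)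
  define \<beta> where "\<beta> = e (Suc d)"
  define \<alpha> where "\<alpha> = sqrt (ip d e e)"
  have \<alpha>2: "\<alpha>\<^sup>2 = ip d e e" unfolding \<alpha>_def using ip_nonneg by simp
  have \<alpha>\<beta>: "\<alpha>\<^sup>2 + \<beta>\<^sup>2 = 1"
    using Suc.prems(1) by (simp add: ip_Suc \<alpha>2 \<beta>_def flip: power2_eq_square)
  note mF = measurable_compose_restrict_Rn[OF F]
  \<comment> \<open>\<open>J g b t\<close> is the resampled point whose original has first
    coordinates b and last coordinate t; t * \<beta> is the share of t in the inner product with
    \<open>e\<close>.\<close>
  define J where "J g b t = (\<lambda>r\<in>{1..Suc d}. g * e r + ((if r = Suc d then t else b r) - (ip d b e + t * \<beta>) * e r))" for g t and b :: vec
  have mJ: "(\<lambda>x. F (J (h1 x) (h2 x) (h3 x))) \<in> borel_measurable M"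
    if "h1 \<in> borel_measurable M" "h2 \<in> M \<rightarrow>\<^sub>M Rn d" "h3 \<in> borel_measurable M" for M :: "'z measure" and h1 h2 h3
    unfolding J_def using that
    by (intro mF borel_measurable_add borel_measurable_diff borel_measurable_times borel_measurable_ip measurable_if_const)
       (auto intro!: measurable_Rn_component[of h2 M d])
  have rhs: "(\<integral>\<^sup>+ b. F (\<lambda>r\<in>{1..Suc d}. g * e r + (b r - ip (Suc d) b e * e r)) \<partial>std_gaussian (Suc d))
     = (\<integral>\<^sup>+ t. \<integral>\<^sup>+ b. F (J g b t) \<partial>std_gaussian d \<partial>N1)" for g
  proof (subst nn_integral_std_gaussian_Suc)
    show "(\<lambda>b. F (\<lambda>r\<in>{1..Suc d}. g * e r + (b r - ip (Suc d) b e * e r))) \<in> borel_measurable (Rn (Suc d))"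
      by (intro mF borel_measurable_add borel_measurable_diff borel_measurable_times borel_measurable_ip)
         (auto intro!: measurable_Rn_component)
    show "(\<integral>\<^sup>+ t. \<integral>\<^sup>+ b. F (\<lambda>r\<in>{1..Suc d}. g * e r +
        ((\<lambda>r\<in>{1..Suc d}. if r = Suc d then t else b r) r -
         ip (Suc d) (\<lambda>r\<in>{1..Suc d}. if r = Suc d then t else b r) e * e r)) \<partial>std_gaussian d \<partial>N1) =
      (\<integral>\<^sup>+ t. \<integral>\<^sup>+ b. F (J g b t) \<partial>std_gaussian d \<partial>N1)"
    proof (intro nn_integral_cong arg_cong[where f = F])
      fix t b
      have "ip d (\<lambda>r. if r = Suc d then t else b r) e = ip d b e" by (intro ip_cong) auto
      then have "ip (Suc d) (\<lambda>r\<in>{1..Suc d}. if r = Suc d then t else b r) e = ip d b e + t * \<beta>"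
        unfolding ip_restrict by (simp add: ip_Suc \<beta>_def)
      then show "(\<lambda>r\<in>{1..Suc d}. g * e r + ((\<lambda>r\<in>{1..Suc d}. if r = Suc d then t else b r) r -
         ip (Suc d) (\<lambda>r\<in>{1..Suc d}. if r = Suc d then t else b r) e * e r)) = J g b t"
        unfolding J_def by (auto simp: fun_eq_iff restrict_def)
    qed
  qed
  show ?case
  proof (cases "\<alpha> = 0")
    case True
    \<comment> \<open>Here \<open>e\<close> is plus or minus the last unit vector: only t is
      replaced, by g * \<beta>, and the sign is absorbed by symmetry.\<close>
    then have e0: "e r = 0" if "r \<in> {1..d}" for r using \<alpha>2 ip_eq_0D that by auto
    have \<beta>1: "\<beta>\<^sup>2 = 1" using True \<alpha>\<beta> by simp
    define f where "f t = (\<integral>\<^sup>+ b. F (\<lambda>r\<in>{1..Suc d}. if r = Suc d then t else b r) \<partial>std_gaussian d)" for t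
    have "(\<lambda>(t, b). F (\<lambda>r\<in>{1..Suc d}. if r = Suc d then t else b r)) \<in> borel_measurable (borel \<Otimes>\<^sub>M std_gaussian d)"
      unfolding split_beta' by (intro measurable_compose_split_last[OF F]) auto
    then have [measurable]: "f \<in> borel_measurable borel"
      unfolding f_def by (rule std_gaussian.borel_measurable_nn_integral)
    have J: "J g b t = (\<lambda>r\<in>{1..Suc d}. if r = Suc d then g * \<beta> else b r)" for g b t
    proof -
      have "ip d b e = 0" unfolding ip_def using e0 by simp
      then show ?thesis using \<beta>1 e0
        by (auto simp: J_def fun_eq_iff \<beta>_def power2_eq_square algebra_simps)
    qed
    have "(\<integral>\<^sup>+ g. \<integral>\<^sup>+ t. \<integral>\<^sup>+ b. F (J g b t) \<partial>std_gaussian d \<partial>N1 \<partial>N1) = (\<integral>\<^sup>+ g. f (g * \<beta>) \<partial>N1)"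
      by (simp add: J f_def emeasure_N1_UNIV)
    also have "\<dots> = (\<integral>\<^sup>+ g. f g \<partial>N1)"
    proof -
      from \<beta>1 consider "\<beta> = 1" | "\<beta> = -1" by (auto simp: power2_eq_1_iff)
      then show ?thesis by cases (auto simp: nn_integral_N1_uminus)
    qed
    also have "\<dots> = (\<integral>\<^sup>+ b. F b \<partial>std_gaussian (Suc d))"
      by (simp add: nn_integral_std_gaussian_Suc f_def)
    finally show ?thesis unfolding rhs by simp
  next
    case False
    then have \<alpha>0: "\<alpha> > 0" unfolding \<alpha>_def using ip_nonneg[of d e] by (simp add: less_le)
    define e' where "e' = (\<lambda>r. e r / \<alpha>)"
    have e'1: "ip d e' e' = 1" and ee': "e r = \<alpha> * e' r" for r
      unfolding e'_def using \<alpha>0 \<alpha>2 by (auto simp: power2_eq_square)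
    have ipe: "ip d b e = \<alpha> * ip d b e'" for b
      using ee' ip_lin(10)[of d b \<alpha> e'] by presburger
    define L where "L x b = (\<lambda>r\<in>{1..d}. x * e' r + (b r - ip d b e' * e' r))" for x and b :: vec
    define H where "H x y b = F (\<lambda>r\<in>{1..Suc d}. if r = Suc d then y else L x b r)" for x y and b :: vec
    have mH [measurable (raw)]: "(\<lambda>x. H (h1 x) (h2 x) (h3 x)) \<in> borel_measurable M"
      if "h1 \<in> borel_measurable M" "h2 \<in> borel_measurable M" "h3 \<in> M \<rightarrow>\<^sub>M Rn d" for M :: "'z measure" and h1 h2 h3
    proof -
      have "(\<lambda>x. h3 x r) \<in> borel_measurable M" if "r \<in> {1..d}" for r
        using measurable_Rn_component[OF \<open>h3 \<in> M \<rightarrow>\<^sub>M Rn d\<close> that] .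
      note [measurable] = this that(1,2) and [measurable (raw)] = borel_measurable_ip
      have "(\<lambda>x. L (h1 x) (h3 x) r) \<in> borel_measurable M" if "r \<in> {1..d}" for r
        using that unfolding L_def by simp
      then show ?thesis
        unfolding H_def using that by (intro mF measurable_if_const) auto
    qed
    define h where "h x y = (\<integral>\<^sup>+ b. H x y b \<partial>std_gaussian d)" for x y
    have [measurable]: "case_prod h \<in> borel_measurable (borel \<Otimes>\<^sub>M borel)"
      unfolding h_def split_beta' by (intro std_gaussian.borel_measurable_nn_integral) measurable
    have IH: "(\<integral>\<^sup>+ b. G b \<partial>std_gaussian d) = (\<integral>\<^sup>+ \<gamma>. \<integral>\<^sup>+ b. G (L \<gamma> b) \<partial>std_gaussian d \<partial>N1)"
      if "G \<in> borel_measurable (Rn d)" for G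
      unfolding L_def by (rule Suc.IH[OF e'1 that])
    \<comment> \<open>With \<gamma> the coordinate along \<open>e'\<close>, the pair (\<gamma>, t)
      enters only through q = \<beta> * \<gamma> - \<alpha> * t, the coordinate in the plane
      orthogonal to \<open>e\<close>. The new point has coordinate \<alpha> * g + \<beta> * q along
      \<open>e'\<close> and last coordinate \<beta> * g - \<alpha> * q, the reflected pair.\<close>
    have JL: "F (J g (L \<gamma> b) t) = H (\<alpha> * g + \<beta> * (\<beta> * \<gamma> - \<alpha> * t)) (\<beta> * g - \<alpha> * (\<beta> * \<gamma> - \<alpha> * t)) b" for g \<gamma> b t
      unfolding H_def J_def
    proof (intro arg_cong[where f = F] restrict_ext)
      fix r assume r: "r \<in> {1..Suc d}"
      have ipL: "ip d (L \<gamma> b) e' = \<gamma>" unfolding L_def using e'1 by simp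
      have \<beta>2: "\<beta> * (\<beta> * z) = z - \<alpha> * (\<alpha> * z)" for z
        using arg_cong[OF \<alpha>\<beta>, of "\<lambda>y. y * z"] by (simp add: power2_eq_square algebra_simps)
      show "g * e r + ((if r = Suc d then t else L \<gamma> b r) - (ip d (L \<gamma> b) e + t * \<beta>) * e r) = (if r = Suc d then \<beta> * g - \<alpha> * (\<beta> * \<gamma> - \<alpha> * t)
          else L (\<alpha> * g + \<beta> * (\<beta> * \<gamma> - \<alpha> * t)) b r)"
      proof (cases "r = Suc d")
        case True
        then show ?thesis
          using r \<beta>2[of t] unfolding ipe ipL by (simp flip: \<beta>_def add: algebra_simps)
      next
        case False
        then show ?thesis
          using r \<beta>2[of "\<gamma> * e' r"] unfolding ipe ipL by (simp add: ee' L_def algebra_simps)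
      qed
    qed
    have "(\<integral>\<^sup>+ g. \<integral>\<^sup>+ t. \<integral>\<^sup>+ b. F (J g b t) \<partial>std_gaussian d \<partial>N1 \<partial>N1)
       = (\<integral>\<^sup>+ g. \<integral>\<^sup>+ t. \<integral>\<^sup>+ \<gamma>. h (\<alpha> * g + \<beta> * (\<beta> * \<gamma> - \<alpha> * t)) (\<beta> * g - \<alpha> * (\<beta> * \<gamma> - \<alpha> * t)) \<partial>N1 \<partial>N1 \<partial>N1)"
      unfolding h_def JL[symmetric] by (intro nn_integral_cong IH mJ) auto
    also have "\<dots> = (\<integral>\<^sup>+ g. \<integral>\<^sup>+ q. h (\<alpha> * g + \<beta> * q) (\<beta> * g - \<alpha> * q) \<partial>N1 \<partial>N1)"
      by (intro nn_integral_cong nn_integral_N1_combination[OF \<alpha>\<beta> \<alpha>0]) measurable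
    also have "\<dots> = (\<integral>\<^sup>+ g. \<integral>\<^sup>+ t. h g t \<partial>N1 \<partial>N1)"
      by (rule nn_integral_N1_orthogonal[OF \<alpha>\<beta> \<alpha>0]) measurable
    also have "\<dots> = (\<integral>\<^sup>+ t. \<integral>\<^sup>+ g. h g t \<partial>N1 \<partial>N1)"
      by (rule N1_N1.Fubini') measurable
    also have "\<dots> = (\<integral>\<^sup>+ b. F b \<partial>std_gaussian (Suc d))"
    proof -
      have "(\<integral>\<^sup>+ b. F (\<lambda>r\<in>{1..Suc d}. if r = Suc d then t else b r) \<partial>std_gaussian d) = (\<integral>\<^sup>+ g. h g t \<partial>N1)" for t
        unfolding h_def H_def
        by (intro IH measurable_compose_split_last[OF F]) auto
      then show ?thesis by (simp add: nn_integral_std_gaussian_Suc)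
    qed
    finally show ?thesis unfolding rhs by simp
  qed
qed

text \<open>After resampling along \<open>e\<close>, the inner product with \<open>e\<close> is
  exactly the new coordinate g.\<close>

lemma nn_integral_std_gaussian_ip_unit:
  assumes e: "ip d e e = 1" and [measurable]: "f \<in> borel_measurable borel"
  shows "(\<integral>\<^sup>+ b. f (ip d b e) \<partial>std_gaussian d) = (\<integral>\<^sup>+ x. f x \<partial>N1)"
proof -
  have "(\<integral>\<^sup>+ b. f (ip d b e) \<partial>std_gaussian d) =
    (\<integral>\<^sup>+ g. \<integral>\<^sup>+ b. f (ip d (\<lambda>r\<in>{1..d}. g * e r + (b r - ip d b e * e r)) e) \<partial>std_gaussian d \<partial>N1)"
    by (intro nn_integral_std_gaussian_unit e) measurable
  also have "\<dots> = (\<integral>\<^sup>+ g. \<integral>\<^sup>+ b. f g \<partial>std_gaussian d \<partial>N1)"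
    using e by simp
  finally show ?thesis using std_gaussian.emeasure_space_1 by simp
qed

lemma measurable_compose_pair_restrict_Rn:
  assumes "case_prod F \<in> borel_measurable (N \<Otimes>\<^sub>M Rn d)" "g \<in> M \<rightarrow>\<^sub>M N"
    "\<And>r. r \<in> {1..d} \<Longrightarrow> (\<lambda>x. f x r) \<in> borel_measurable M"
  shows "(\<lambda>x. F (g x) (restrict (f x) {1..d})) \<in> borel_measurable M"
proof -
  have "(\<lambda>x. (g x, restrict (f x) {1..d})) \<in> M \<rightarrow>\<^sub>M N \<Otimes>\<^sub>M Rn d"
    using assms by (intro measurable_Pair measurable_restrict_Rn)
  from measurable_compose[OF this assms(1)] show ?thesis by simp
qed

text \<open>Here \<open>ip d x x\<close> may vanish; then \<open>ip d b x = 0\<close> and the correction term is \<open>0\<close>.\<close>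

lemma nn_integral_std_gaussian_resample:
  assumes F: "case_prod F \<in> borel_measurable (borel \<Otimes>\<^sub>M Rn d)"
  shows "(\<integral>\<^sup>+ b. F (ip d b x) b \<partial>std_gaussian d) =
    (\<integral>\<^sup>+ b'. \<integral>\<^sup>+ b. F (ip d b' x) (\<lambda>r\<in>{1..d}. b r + (ip d b' x - ip d b x) / ip d x x * x r)
      \<partial>std_gaussian d \<partial>std_gaussian d)"
proof (cases "ip d x x = 0")
  case True
  then have x0: "x r = 0" if "r \<in> {1..d}" for r using ip_eq_0D that by auto
  then have "ip d b x = 0" for b by (simp add: ip_def)
  then show ?thesis using True x0 std_gaussian.emeasure_space_1
    by (auto intro!: nn_integral_cong)
next
  case False
  define a where "a = sqrt (ip d x x)"
  have a: "a > 0" and a2: "ip d x x = a\<^sup>2" using False ip_nonneg[of d x] by (auto simp: a_def less_le)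
  define e where "e = (\<lambda>r. x r / a)"
  have xe: "x = (\<lambda>r. a * e r)" using a by (simp add: e_def)
  have e1: "ip d e e = 1" using a by (simp add: e_def a2 power2_eq_square)
  have mF: "(\<lambda>x. F (g x) (\<lambda>r\<in>{1..d}. f x r)) \<in> borel_measurable M"
    if "g \<in> borel_measurable M" "\<And>r. r \<in> {1..d} \<Longrightarrow> (\<lambda>x. f x r) \<in> borel_measurable M"
    for M :: "'z measure" and f g
    using measurable_compose_pair_restrict_Rn[OF F] that by auto
  define K where "K g = (\<integral>\<^sup>+ b. F (a * g) (\<lambda>r\<in>{1..d}. g * e r + (b r - ip d b e * e r)) \<partial>std_gaussian d)" for g
  have K: "K \<in> borel_measurable borel"
    unfolding K_def
  proof (intro std_gaussian.borel_measurable_nn_integral, unfold split_beta', intro mF)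
    fix r assume r: "r \<in> {1..d}"
    have [measurable]: "(\<lambda>x. ip d (snd x) e) \<in> borel_measurable (borel \<Otimes>\<^sub>M std_gaussian d)"
      by (intro borel_measurable_ip borel_measurable_const measurable_Rn_component[of snd _ d]) auto
    have [measurable]: "(\<lambda>x. snd x r) \<in> borel_measurable (borel \<Otimes>\<^sub>M std_gaussian d)"
      by (rule measurable_Rn_component[of snd _ d, OF _ r]) auto
    show "(\<lambda>x. fst x * e r + (snd x r - ip d (snd x) e * e r)) \<in> borel_measurable (borel \<Otimes>\<^sub>M std_gaussian d)"
      by measurable
  qed measurable
  have "(\<integral>\<^sup>+ b. F (ip d b x) b \<partial>std_gaussian d) = (\<integral>\<^sup>+ g. \<integral>\<^sup>+ b. F (ip d (\<lambda>r\<in>{1..d}. g * e r + (b r - ip d b e * e r)) x)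
       (\<lambda>r\<in>{1..d}. g * e r + (b r - ip d b e * e r)) \<partial>std_gaussian d \<partial>N1)"
    using measurable_compose[OF measurable_Pair[OF measurable_ip_const(1) measurable_ident] F]
    by (intro nn_integral_std_gaussian_unit e1) auto
  also have "\<dots> = (\<integral>\<^sup>+ g. K g \<partial>N1)"
    unfolding K_def xe using e1 by (simp add: algebra_simps)
  \<comment> \<open>The scalar g is realised as the coordinate of an independent Gaussian vector b',
    so that the final formula mentions no unit vector and also makes sense for a zero x.\<close>
  also have "\<dots> = (\<integral>\<^sup>+ b'. K (ip d b' e) \<partial>std_gaussian d)"
    by (rule nn_integral_std_gaussian_ip_unit[OF e1 K, symmetric])
  also have "\<dots> = (\<integral>\<^sup>+ b'. \<integral>\<^sup>+ b. F (ip d b' x) (\<lambda>r\<in>{1..d}. b r + (ip d b' x - ip d b x) / ip d x x * x r)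
      \<partial>std_gaussian d \<partial>std_gaussian d)"
    unfolding K_def
  proof (intro nn_integral_cong arg_cong2[where f = F] restrict_ext)
    fix b' b :: vec and r
    show "a * ip d b' e = ip d b' x" by (simp add: xe)
    show "ip d b' e * e r + (b r - ip d b e * e r) = b r + (ip d b' x - ip d b x) / ip d x x * x r"
      unfolding xe ip_lin e1 using a by (simp add: field_simps)
  qed
  finally show ?thesis .
qed

section \<open>Moments and symmetry of the Gaussian vector\<close>

lemma nn_integral_std_gaussian_exp:
  "(\<integral>\<^sup>+ b. ennreal (exp (ip d b h)) \<partial>std_gaussian d) = ennreal (exp (ip d h h / 2))"
proof -
  have "(\<integral>\<^sup>+ b. ennreal (exp (ip d b h)) \<partial>std_gaussian d) =
      (\<integral>\<^sup>+ b. (\<Prod>r\<in>{1..d}. ennreal (exp (h r * b r))) \<partial>std_gaussian d)"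
    by (simp add: ip_def exp_sum prod_ennreal mult.commute)
  also have "\<dots> = (\<Prod>r\<in>{1..d}. \<integral>\<^sup>+ x. ennreal (exp (h r * x)) \<partial>N1)"
    unfolding std_gaussian_def by (rule N1_PiM.product_nn_integral_prod) auto
  also have "\<dots> = ennreal (exp (ip d h h / 2))"
    by (simp add: nn_integral_N1_exp prod_ennreal exp_sum ip_def sum_divide_distrib power2_eq_square)
  finally show ?thesis .
qed

text \<open>The quotient is the square of a standard Gaussian, or 0 by the division convention if u
  vanishes on the coordinates. The value sqrt 2 is rounded up to 2 so that the costs of the steps
  multiply to powers of 2.\<close>

lemma nn_integral_std_gaussian_exp_square:
  "(\<integral>\<^sup>+ b. ennreal (exp ((ip d b u)\<^sup>2 / ip d u u / 4)) \<partial>std_gaussian d) \<le> 2"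
proof (cases "ip d u u = 0")
  case True
  then show ?thesis using std_gaussian.emeasure_space_1 by simp
next
  case False
  define a where "a = sqrt (ip d u u)"
  have a: "a > 0" and a2: "ip d u u = a\<^sup>2" using False ip_nonneg[of d u] by (auto simp: a_def less_le)
  define e where "e = (\<lambda>r. u r / a)"
  have e1: "ip d e e = 1" using a by (simp add: e_def a2 power2_eq_square)
  have ue: "(ip d b u)\<^sup>2 / ip d u u = (ip d b e)\<^sup>2" for b
    unfolding a2 e_def by (simp add: power_divide)
  have "(\<integral>\<^sup>+ b. ennreal (exp ((ip d b u)\<^sup>2 / ip d u u / 4)) \<partial>std_gaussian d) = (\<integral>\<^sup>+ x. ennreal (exp (x\<^sup>2 / 4)) \<partial>N1)"
    unfolding ue by (rule nn_integral_std_gaussian_ip_unit[OF e1]) measurable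
  also have "\<dots> \<le> ennreal 2"
    unfolding nn_integral_N1_exp_square by (intro ennreal_leI real_le_lsqrt) auto
  finally show ?thesis by simp
qed

lemma nn_integral_std_gaussian_norm: "(\<integral>\<^sup>+ b. ennreal (ip d b b) \<partial>std_gaussian d) = of_nat d"
proof -
  have comp: "(\<integral>\<^sup>+ b. ennreal ((b r)\<^sup>2) \<partial>std_gaussian d) = 1" if r: "r \<in> {1..d}" for r
  proof -
    define e :: vec where "e = (\<lambda>s. if s = r then 1 else 0)"
    have be: "ip d b e = b r" for b using r by (simp add: ip_def e_def if_distrib cong: if_cong)
    have "ip d e e = 1" unfolding be by (simp add: e_def)
    from nn_integral_std_gaussian_ip_unit[OF this, of "\<lambda>x. ennreal (x\<^sup>2)"]
    show ?thesis by (simp add: be nn_integral_N1_square)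
  qed
  have "(\<integral>\<^sup>+ b. ennreal (ip d b b) \<partial>std_gaussian d) = (\<integral>\<^sup>+ b. (\<Sum>r\<in>{1..d}. ennreal ((b r)\<^sup>2)) \<partial>std_gaussian d)"
    by (simp add: ip_def power2_eq_square)
  also have "\<dots> = (\<Sum>r\<in>{1..d}. \<integral>\<^sup>+ b. ennreal ((b r)\<^sup>2) \<partial>std_gaussian d)"
  proof (rule nn_integral_sum)
    fix r assume "r \<in> {1..d}"
    then have [measurable]: "(\<lambda>b. b r) \<in> borel_measurable (Rn d)" by (rule measurable_component_Rn)
    show "(\<lambda>b. ennreal ((b r)\<^sup>2)) \<in> borel_measurable (std_gaussian d)" by measurable
  qed
  finally show ?thesis by (simp add: comp)
qed

lemma nn_integral_std_gaussian_uminus: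
  assumes "F \<in> borel_measurable (Rn d)"
  shows "(\<integral>\<^sup>+ b. F (\<lambda>r\<in>{1..d}. - b r) \<partial>std_gaussian d) = (\<integral>\<^sup>+ b. F b \<partial>std_gaussian d)"
  using assms
proof (induction d arbitrary: F)
  case 0
  then show ?case
    by (intro nn_integral_cong arg_cong[where f = F]) (auto simp: Rn_def space_PiM)
next
  case (Suc d)
  note F [measurable] = Suc.prems
  note mF = measurable_compose_restrict_Rn[OF F]
  define h where "h t = (\<integral>\<^sup>+ b. F (\<lambda>r\<in>{1..Suc d}. if r = Suc d then t else b r) \<partial>std_gaussian d)" for t
  have "(\<lambda>(t, b). F (\<lambda>r\<in>{1..Suc d}. if r = Suc d then t else b r)) \<in> borel_measurable (borel \<Otimes>\<^sub>M std_gaussian d)"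
    unfolding split_beta' by (intro measurable_compose_split_last[OF F]) auto
  then have h: "h \<in> borel_measurable borel"
    unfolding h_def by (rule std_gaussian.borel_measurable_nn_integral)
  have "(\<integral>\<^sup>+ b. F (\<lambda>r\<in>{1..Suc d}. - b r) \<partial>std_gaussian (Suc d)) =
    (\<integral>\<^sup>+ t. \<integral>\<^sup>+ b. F (\<lambda>r\<in>{1..Suc d}. - (\<lambda>r\<in>{1..Suc d}. if r = Suc d then t else b r) r) \<partial>std_gaussian d \<partial>N1)"
    by (intro nn_integral_std_gaussian_Suc mF) measurable
  also have "\<dots> = (\<integral>\<^sup>+ t. \<integral>\<^sup>+ b. F (\<lambda>r\<in>{1..Suc d}. if r = Suc d then - t else (\<lambda>r\<in>{1..d}. - b r) r) \<partial>std_gaussian d \<partial>N1)"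
    by (intro nn_integral_cong arg_cong[where f = F]) (auto simp: fun_eq_iff)
  also have "\<dots> = (\<integral>\<^sup>+ t. h (- t) \<partial>N1)"
    unfolding h_def by (intro nn_integral_cong Suc.IH measurable_compose_split_last[OF F]) auto
  also have "\<dots> = (\<integral>\<^sup>+ t. h t \<partial>N1)"
    by (rule nn_integral_N1_uminus[OF h])
  also have "\<dots> = (\<integral>\<^sup>+ b. F b \<partial>std_gaussian (Suc d))"
    by (simp add: nn_integral_std_gaussian_Suc h_def)
  finally show ?case .
qed

section \<open>The truncated Gaussian law\<close>

definition tr_ball :: "nat \<Rightarrow> vec set" where
  "tr_ball d = {g \<in> space (Rn d). L2_set g {1..d} \<le> 2 * sqrt (real d)}"

definition tr_density :: "nat \<Rightarrow> vec \<Rightarrow> ennreal" where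
  "tr_density d b = indicator (tr_ball d) b / emeasure (std_gaussian d) (tr_ball d)"

lemma tr_ball_iff: "b \<in> tr_ball d \<longleftrightarrow> b \<in> space (Rn d) \<and> ip d b b \<le> 4 * real d"
proof -
  have "L2_set b {1..d} = sqrt (ip d b b)"
    by (simp add: L2_set_def ip_def power2_eq_square)
  moreover have "2 * sqrt (real d) = sqrt (4 * real d)"
    by (simp add: real_sqrt_mult)
  ultimately show ?thesis by (simp add: tr_ball_def ip_nonneg)
qed

lemma tr_ball_component:
  assumes "b \<in> tr_ball d" "r \<in> {1..d}"
  shows "\<bar>b r\<bar> \<le> 2 * sqrt (real d)"
proof -
  have "(b r)\<^sup>2 \<le> ip d b b"
    unfolding ip_def using assms(2) member_le_sum[of r "{1..d}" "\<lambda>j. b j * b j"] by (simp add: power2_eq_square)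
  also have "\<dots> \<le> 4 * real d" using assms(1) by (simp add: tr_ball_iff)
  finally have "\<bar>b r\<bar> \<le> sqrt (4 * real d)" by (metis real_sqrt_abs real_sqrt_le_mono)
  then show ?thesis by (simp add: real_sqrt_mult)
qed

lemma tr_ball_sets [measurable]: "tr_ball d \<in> sets (Rn d)"
proof -
  have "tr_ball d = {b \<in> space (Rn d). ip d b b \<le> 4 * real d}" by (auto simp: tr_ball_iff)
  then show ?thesis by simp
qed

text \<open>Markov's inequality for |g|^2, whose mean is d, leaves at most 1/4 outside the ball. The
  bound 1/2 is enough to make the density at most 2.\<close>

lemma emeasure_tr_ball:
  assumes "d \<ge> 1"
  shows "emeasure (std_gaussian d) (tr_ball d) \<ge> ennreal (1 / 2)"
proof -
  let ?M = "std_gaussian d"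
  let ?C = "{b \<in> space ?M. 1 \<le> ennreal (1 / (4 * real d)) * ennreal (ip d b b)}"
  have "emeasure ?M ?C \<le> ennreal (1 / (4 * real d)) * (\<integral>\<^sup>+ b. ennreal (ip d b b) * indicator (space ?M) b \<partial>?M)"
    using nn_integral_Markov_inequality[of "\<lambda>b. ennreal (ip d b b)" "space ?M" "?M" "ennreal (1 / (4 * real d))"] by simp
  also have "(\<integral>\<^sup>+ b. ennreal (ip d b b) * indicator (space ?M) b \<partial>?M) = of_nat d"
    unfolding nn_integral_std_gaussian_norm[symmetric] by (intro nn_integral_cong) auto
  also have "ennreal (1 / (4 * real d)) * of_nat d = ennreal (1 / 4)"
    using assms by (simp add: ennreal_of_nat_eq_real_of_nat ennreal_mult[symmetric])
  finally have "measure ?M ?C \<le> 1 / 4" by (simp add: std_gaussian.emeasure_eq_measure)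
  moreover have "space ?M - tr_ball d \<subseteq> ?C"
    using assms by (auto simp: tr_ball_iff ennreal_mult[symmetric] ip_nonneg)
  then have "measure ?M (space ?M - tr_ball d) \<le> measure ?M ?C"
    by (intro std_gaussian.finite_measure_mono) auto
  moreover have "measure ?M (space ?M - tr_ball d) = 1 - measure ?M (tr_ball d)"
    by (rule std_gaussian.prob_compl) simp
  ultimately have "measure ?M (tr_ball d) \<ge> 1 / 2" by simp
  then show ?thesis unfolding std_gaussian.emeasure_eq_measure by (rule ennreal_leI)
qed

lemma gamma_tr_density: "gamma_tr d = density (std_gaussian d) (tr_density d)"
  unfolding gamma_tr_def uniform_measure_def tr_density_def tr_ball_def by simp

lemma tr_density_measurable [measurable]: "tr_density d \<in> borel_measurable (Rn d)"
  unfolding tr_density_def by measurable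

lemma tr_density_le:
  assumes "d \<ge> 1"
  shows "tr_density d b \<le> 2"
proof -
  define p where "p = measure (std_gaussian d) (tr_ball d)"
  have p: "emeasure (std_gaussian d) (tr_ball d) = ennreal p"
    by (simp add: p_def std_gaussian.emeasure_eq_measure)
  then have p2: "p \<ge> 1 / 2"
    using emeasure_tr_ball[OF assms] ennreal_le_iff[of p "1 / 2"] by (simp add: p_def)
  have "tr_density d b \<le> ennreal 1 / ennreal p"
    unfolding tr_density_def p by (intro divide_right_mono_ennreal) (auto split: split_indicator)
  also have "\<dots> = ennreal (1 / p)" using p2 by (intro divide_ennreal) auto
  also have "\<dots> \<le> ennreal 2" using p2 by (intro ennreal_leI) (simp add: field_simps)
  finally show ?thesis by simp
qed

lemma sets_gamma_tr [simp, measurable_cong]: "sets (gamma_tr d) = sets (Rn d)"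
  unfolding gamma_tr_density by simp

lemma space_gamma_tr [simp]: "space (gamma_tr d) = space (Rn d)"
  by (rule sets_eq_imp_space_eq) simp

lemma nn_integral_gamma_tr:
  "f \<in> borel_measurable (Rn d) \<Longrightarrow> (\<integral>\<^sup>+ b. f b \<partial>gamma_tr d) = (\<integral>\<^sup>+ b. tr_density d b * f b \<partial>std_gaussian d)"
  unfolding gamma_tr_density by (rule nn_integral_density) auto

lemma prob_space_gamma_tr:
  assumes "d \<ge> 1"
  shows "prob_space (gamma_tr d)"
  unfolding gamma_tr_def tr_ball_def[symmetric]
  using emeasure_tr_ball[OF assms]
  by (intro prob_space_uniform_measure) auto

lemma AE_gamma_tr:
  assumes "d \<ge> 1"
  shows "AE b in gamma_tr d. b \<in> tr_ball d"
  unfolding gamma_tr_def tr_ball_def[symmetric]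
  using emeasure_tr_ball[OF assms]
  by (intro AE_uniform_measureI) auto

lemma nn_integral_gamma_tr_uminus:
  assumes [measurable]: "f \<in> borel_measurable (Rn d)"
  shows "(\<integral>\<^sup>+ b. f (\<lambda>r\<in>{1..d}. - b r) \<partial>gamma_tr d) = (\<integral>\<^sup>+ b. f b \<partial>gamma_tr d)"
proof -
  have [measurable]: "(\<lambda>b. \<lambda>r\<in>{1..d}. - b r) \<in> Rn d \<rightarrow>\<^sub>M Rn d"
    by (intro measurable_restrict_Rn) measurable
  have "tr_density d (\<lambda>r\<in>{1..d}. - b r) = tr_density d b" if "b \<in> space (Rn d)" for b
  proof -
    have "(\<lambda>r\<in>{1..d}. - b r) \<in> space (Rn d)" by (simp add: Rn_def space_PiM)
    then show ?thesis using that unfolding tr_density_def by (simp add: indicator_def tr_ball_iff)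
  qed
  then have "(\<integral>\<^sup>+ b. f (\<lambda>r\<in>{1..d}. - b r) \<partial>gamma_tr d) =
      (\<integral>\<^sup>+ b. tr_density d (\<lambda>r\<in>{1..d}. - b r) * f (\<lambda>r\<in>{1..d}. - b r) \<partial>std_gaussian d)"
    by (subst nn_integral_gamma_tr) (auto intro!: nn_integral_cong simp del: One_nat_def)
  also have "\<dots> = (\<integral>\<^sup>+ b. f b \<partial>gamma_tr d)"
    by (subst nn_integral_std_gaussian_uminus) (auto simp: nn_integral_gamma_tr)
  finally show ?thesis .
qed

text \<open>The coordinate has mean zero, stated for its nonnegative shift. By symmetry the shifts
  of b r and - b r have the same integral, and on the ball their sum is constant.\<close>

lemma nn_integral_gamma_tr_component:
  assumes "d \<ge> 1" "r \<in> {1..d}"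
  shows "(\<integral>\<^sup>+ b. ennreal (b r + 2 * sqrt (real d)) \<partial>gamma_tr d) = ennreal (2 * sqrt (real d))"
proof -
  interpret prob_space "gamma_tr d" by (rule prob_space_gamma_tr) fact
  let ?L = "2 * sqrt (real d)"
  have [measurable]: "(\<lambda>b. b r) \<in> borel_measurable (Rn d)" using assms(2) by measurable
  let ?x = "\<integral>\<^sup>+ b. ennreal (b r + ?L) \<partial>gamma_tr d"
  have "?x + ?x = ?x + (\<integral>\<^sup>+ b. ennreal ((\<lambda>r\<in>{1..d}. - b r) r + ?L) \<partial>gamma_tr d)"
    by (subst nn_integral_gamma_tr_uminus) auto
  also have "\<dots> = (\<integral>\<^sup>+ b. ennreal (b r + ?L) + ennreal ((\<lambda>r\<in>{1..d}. - b r) r + ?L) \<partial>gamma_tr d)"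
    using assms(2) by (intro nn_integral_add[symmetric]) auto
  also have "\<dots> = (\<integral>\<^sup>+ b. ennreal (2 * ?L) \<partial>gamma_tr d)"
    using AE_gamma_tr[OF assms(1)]
  proof (intro nn_integral_cong_AE, eventually_elim)
    case (elim b)
    have "\<bar>b r\<bar> \<le> ?L" by (rule tr_ball_component) fact+
    then show ?case using assms(2) by (simp flip: ennreal_plus)
  qed
  also have "\<dots> = ennreal ?L + ennreal ?L"
    using emeasure_space_1 by (simp flip: ennreal_plus)
  finally have eq: "?x + ?x = ennreal ?L + ennreal ?L" .
  then have "2 * ?x = 2 * ennreal ?L" by (simp only: mult_2)
  then show ?thesis by (subst (asm) ennreal_mult_cancel_left) auto
qed

text \<open>By symmetry the exponential may be replaced by \<open>cosh\<close>, and \<open>cosh - 1\<close> is nonnegative, so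
  that the bound on the density can be applied to it.\<close>

lemma nn_integral_gamma_tr_exp:
  assumes "d \<ge> 1"
  shows "(\<integral>\<^sup>+ b. ennreal (exp (ip d b h)) \<partial>gamma_tr d) \<le> ennreal (exp (ip d h h))"
proof -
  interpret prob_space "gamma_tr d" by (rule prob_space_gamma_tr) fact
  let ?a = "exp (ip d h h / 2)"
  let ?x = "\<integral>\<^sup>+ b. ennreal (exp (ip d b h)) \<partial>gamma_tr d"
  let ?f = "\<lambda>b. exp (ip d b h) + exp (- ip d b h) - 2"
  have f: "?f b \<ge> 0" for b
  proof -
    have "1 \<le> (exp (ip d b h) + exp (- ip d b h)) / 2"
      using cosh_real_ge_1[of "ip d b h"] by (simp add: cosh_def)
    then show ?thesis by simp
  qed
  have "?x + ?x = ?x + (\<integral>\<^sup>+ b. ennreal (exp (ip d (\<lambda>r\<in>{1..d}. - b r) h)) \<partial>gamma_tr d)"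
    by (subst nn_integral_gamma_tr_uminus) auto
  also have "\<dots> = (\<integral>\<^sup>+ b. ennreal (exp (ip d b h)) + ennreal (exp (- ip d b h)) \<partial>gamma_tr d)"
    by (subst nn_integral_add) auto
  also have "\<dots> = (\<integral>\<^sup>+ b. 2 + ennreal (?f b) \<partial>gamma_tr d)"
    using f by (intro nn_integral_cong) (simp flip: ennreal_plus ennreal_numeral)
  also have "\<dots> = 2 + (\<integral>\<^sup>+ b. ennreal (?f b) \<partial>gamma_tr d)"
    using emeasure_space_1 by (subst nn_integral_add) auto
  also have "(\<integral>\<^sup>+ b. ennreal (?f b) \<partial>gamma_tr d) \<le> (\<integral>\<^sup>+ b. 2 * ennreal (?f b) \<partial>std_gaussian d)"
    using tr_density_le[OF assms] by (subst nn_integral_gamma_tr) (auto intro!: nn_integral_mono mult_right_mono)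
  also have "\<dots> = 2 * (\<integral>\<^sup>+ b. ennreal (?f b) \<partial>std_gaussian d)"
    by (rule nn_integral_cmult) measurable
  also have "(\<integral>\<^sup>+ b. ennreal (?f b) \<partial>std_gaussian d) = ennreal (2 * ?a - 2)"
  proof -
    have "2 + (\<integral>\<^sup>+ b. ennreal (?f b) \<partial>std_gaussian d) = (\<integral>\<^sup>+ b. 2 + ennreal (?f b) \<partial>std_gaussian d)"
      using std_gaussian.emeasure_space_1 by (subst nn_integral_add) auto
    also have "\<dots> = (\<integral>\<^sup>+ b. ennreal (exp (ip d b h)) + ennreal (exp (ip d b (\<lambda>r. - h r))) \<partial>std_gaussian d)"
      using f by (intro nn_integral_cong) (simp flip: ennreal_plus ennreal_numeral)
    also have "\<dots> = ennreal ?a + ennreal ?a"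
      using nn_integral_std_gaussian_exp[of d "\<lambda>r. - h r"]
      by (subst nn_integral_add) (auto simp: nn_integral_std_gaussian_exp)
    also have "\<dots> = 2 + ennreal (2 * ?a - 2)"
      using ip_nonneg[of d h] by (simp flip: ennreal_plus ennreal_numeral)
    finally show ?thesis by (simp add: ennreal_add_left_cancel)
  qed
  also have "2 + 2 * ennreal (2 * ?a - 2) = ennreal (4 * ?a - 2)"
    using ip_nonneg[of d h] by (simp flip: ennreal_plus ennreal_numeral ennreal_mult)
  \<comment> \<open>The gap is 2 (a - 1)^2. Passing from a to a^2 doubles the Gaussian exponent
    |h|^2 / 2: this is the price of truncation without a multiplicative constant.\<close>
  also have "\<dots> \<le> ennreal (2 * ?a\<^sup>2)"
    using zero_le_power2[of "?a - 1"] by (intro ennreal_leI) (simp add: power2_eq_square algebra_simps)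
  also have "?a\<^sup>2 = exp (ip d h h)" by (simp add: power2_eq_square flip: exp_add)
  also have "ennreal (2 * exp (ip d h h)) = 2 * ennreal (exp (ip d h h))" by (simp add: ennreal_mult)
  finally have "2 * ?x \<le> 2 * ennreal (exp (ip d h h))" by (simp only: mult_2 add_left_mono)
  then show ?thesis by (subst (asm) ennreal_mult_le_mult_iff) auto
qed

lemma ip_eq_0_right: "ip d u u = 0 \<Longrightarrow> ip d x u = 0"
  unfolding ip_def[of d x] by (intro sum.neutral ballI) (simp add: ip_eq_0D[of d u])

section \<open>Adaptive linear measurements of Gaussian vectors\<close>

text \<open>Observations are total sequences, so that appending one is a function update and all
  times share one space.\<close>

abbreviation seqs :: "vec measure" where
  "seqs \<equiv> Pi\<^sub>M UNIV (\<lambda>_. borel)"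

abbreviation families :: "nat \<Rightarrow> nat \<Rightarrow> (nat \<Rightarrow> vec) measure" where
  "families d k \<equiv> Pi\<^sub>M {1..k} (\<lambda>_. Rn d)"

definition gauss_fam :: "nat \<Rightarrow> nat \<Rightarrow> (nat \<Rightarrow> vec) measure" where
  "gauss_fam d k = Pi\<^sub>M {1..k} (\<lambda>_. std_gaussian d)"

interpretation std_gaussian_PiM: product_sigma_finite "\<lambda>_ :: nat. std_gaussian d" for d
  by unfold_locales

lemma sets_gauss_fam [simp, measurable_cong]: "sets (gauss_fam d k) = sets (families d k)"
  unfolding gauss_fam_def by (rule sets_PiM_cong) auto

lemma space_gauss_fam [simp]: "space (gauss_fam d k) = space (families d k)"
  by (rule sets_eq_imp_space_eq) simp

interpretation gauss_fam: prob_space "gauss_fam d k" for d k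
  unfolding gauss_fam_def by (rule prob_space_PiM) (rule prob_space_std_gaussian)

interpretation gauss_fam_pair: pair_sigma_finite "gauss_fam d k" "std_gaussian d'" for d k d'
  by unfold_locales

section \<open>Observation sequences and families of vectors\<close>

lemma measurable_seqsI:
  assumes "\<And>n. (\<lambda>x. f x n) \<in> borel_measurable M"
  shows "f \<in> M \<rightarrow>\<^sub>M seqs"
  using assms by (intro measurable_PiM_single') auto

lemma measurable_seqs_component [measurable]: "(\<lambda>y. y n) \<in> borel_measurable seqs"
  by (rule measurable_component_singleton) auto

lemma measurable_seqs_upd [measurable (raw)]:
  assumes [measurable]: "f \<in> M \<rightarrow>\<^sub>M seqs" "g \<in> borel_measurable M"
  shows "(\<lambda>x. (f x)(n := g x)) \<in> M \<rightarrow>\<^sub>M seqs"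
  by (intro measurable_seqsI) (simp add: fun_upd_def)

lemma measurable_families_component:
  assumes "f \<in> M \<rightarrow>\<^sub>M families d k" "j \<in> {1..k}"
  shows "(\<lambda>x. f x j) \<in> M \<rightarrow>\<^sub>M Rn d"
  using measurable_compose[OF assms(1) measurable_component_singleton[OF assms(2)]] by simp

lemma measurable_families_upd [measurable (raw)]:
  assumes "f \<in> M \<rightarrow>\<^sub>M families d k" "g \<in> M \<rightarrow>\<^sub>M Rn d" "q \<in> {1..k}"
  shows "(\<lambda>x. (f x)(q := g x)) \<in> M \<rightarrow>\<^sub>M families d k"
  using assms by (intro measurable_fun_upd[where J = "{1..k}" and i = q]) auto

text \<open>Redrawing one independent factor keeps the product law: once the factor q is split off
  on both sides, its old value is overwritten and integrates to 1.\<close>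

lemma nn_integral_gauss_fam_upd:
  assumes q: "q \<in> {1..k}" and F [measurable]: "F \<in> borel_measurable (families d k)"
  shows "(\<integral>\<^sup>+ b. F b \<partial>gauss_fam d k) = (\<integral>\<^sup>+ b. \<integral>\<^sup>+ w. F (b(q := w)) \<partial>std_gaussian d \<partial>gauss_fam d k)"
proof -
  let ?K = "{1..k} - {q}"
  have K: "{1..k} = insert q ?K" using q by auto
  have ins: "(\<integral>\<^sup>+ b. G b \<partial>gauss_fam d k) =
      (\<integral>\<^sup>+ b. \<integral>\<^sup>+ w. G (b(q := w)) \<partial>std_gaussian d \<partial>Pi\<^sub>M ?K (\<lambda>_. std_gaussian d))"
    if [measurable]: "G \<in> borel_measurable (families d k)" for G
  proof -
    have "G \<in> borel_measurable (gauss_fam d k)" by measurable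
    then show ?thesis
      using std_gaussian_PiM.product_nn_integral_insert[of ?K q G d] unfolding gauss_fam_def K[symmetric] by blast
  qed
  have "(\<lambda>(b, w). F (b(q := w))) \<in> borel_measurable (families d k \<Otimes>\<^sub>M std_gaussian d)"
    unfolding split_beta' by (intro measurable_compose[OF _ F] measurable_families_upd q) auto
  then have m: "(\<lambda>b. \<integral>\<^sup>+ w. F (b(q := w)) \<partial>std_gaussian d) \<in> borel_measurable (families d k)"
    by (rule std_gaussian.borel_measurable_nn_integral)
  show ?thesis
    unfolding ins[OF m] ins[OF F] by (simp add: std_gaussian.emeasure_space_1[unfolded space_std_gaussian])
qed

text \<open>This moves all computations to the untruncated Gaussian family, where rotation
  invariance is available; the truncation becomes a weight that factorises over the vectors.\<close>

lemma Xi_law_density: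
  assumes "d \<ge> 1"
  shows "Xi_law d k = density (gauss_fam d k) (\<lambda>b. \<Prod>j\<in>{1..k}. tr_density d (b j))"
proof -
  interpret g: prob_space "gamma_tr d" by (rule prob_space_gamma_tr) fact
  interpret product_sigma_finite "\<lambda>_ :: nat. gamma_tr d" by unfold_locales
  have [measurable]: "(\<lambda>b. tr_density d (b j)) \<in> borel_measurable (families d k)" if "j \<in> {1..k}" for j
    using that by measurable
  show ?thesis unfolding Xi_law_def
  proof (rule PiM_eqI[symmetric])
    show "sets (density (gauss_fam d k) (\<lambda>b. \<Prod>j\<in>{1..k}. tr_density d (b j))) = sets (Pi\<^sub>M {1..k} (\<lambda>_. gamma_tr d))"
      unfolding sets_density sets_gauss_fam by (rule sets_PiM_cong) auto
    fix A assume A: "\<And>j. j \<in> {1..k} \<Longrightarrow> A j \<in> sets (gamma_tr d)"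
    then have [measurable]: "Pi\<^sub>E {1..k} A \<in> sets (families d k)"
      by (intro sets_PiM_I_finite) (simp_all only: sets_gamma_tr finite_atLeastAtMost)
    have "emeasure (density (gauss_fam d k) (\<lambda>b. \<Prod>j\<in>{1..k}. tr_density d (b j))) (Pi\<^sub>E {1..k} A)
      = (\<integral>\<^sup>+ b. (\<Prod>j\<in>{1..k}. tr_density d (b j)) * indicator (Pi\<^sub>E {1..k} A) b \<partial>gauss_fam d k)"
      by (rule emeasure_density) measurable
    also have "\<dots> = (\<integral>\<^sup>+ b. (\<Prod>j\<in>{1..k}. tr_density d (b j) * indicator (A j) (b j)) \<partial>gauss_fam d k)"
    proof (rule nn_integral_cong)
      fix b assume "b \<in> space (gauss_fam d k)"
      then have "b \<in> extensional {1..k}" by (simp add: space_PiM PiE_def)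
      then have "indicator (Pi\<^sub>E {1..k} A) b = (\<Prod>j\<in>{1..k}. indicator (A j) (b j) :: ennreal)"
        by (auto simp: indicator_def PiE_def Pi_def prod_eq_1_iff)
      then show "(\<Prod>j\<in>{1..k}. tr_density d (b j)) * indicator (Pi\<^sub>E {1..k} A) b =
          (\<Prod>j\<in>{1..k}. tr_density d (b j) * indicator (A j) (b j))"
        by (simp add: prod.distrib)
    qed
    also have "\<dots> = (\<Prod>j\<in>{1..k}. \<integral>\<^sup>+ w. tr_density d w * indicator (A j) w \<partial>std_gaussian d)"
      unfolding gauss_fam_def using A by (intro std_gaussian_PiM.product_nn_integral_prod) auto
    also have "\<dots> = (\<Prod>j\<in>{1..k}. emeasure (gamma_tr d) (A j))"
      using A by (intro prod.cong refl) (simp add: gamma_tr_density emeasure_density)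
    finally show "emeasure (density (gauss_fam d k) (\<lambda>b. \<Prod>j\<in>{1..k}. tr_density d (b j))) (Pi\<^sub>E {1..k} A) =
        (\<Prod>j\<in>{1..k}. emeasure (gamma_tr d) (A j))" .
  qed auto
qed

lemma measurable_tr_density_prod [measurable]:
  "(\<lambda>b. \<Prod>j\<in>{1..k}. tr_density d (b j)) \<in> borel_measurable (families d k)"
  by (intro borel_measurable_prod_ennreal) measurable

lemma sets_Xi_law [simp, measurable_cong]: "sets (Xi_law d k) = sets (families d k)"
  unfolding Xi_law_def by (rule sets_PiM_cong) auto

lemma space_Xi_law [simp]: "space (Xi_law d k) = space (families d k)"
  by (rule sets_eq_imp_space_eq) simp

lemma nn_integral_Xi_law:
  assumes "d \<ge> 1" and [measurable]: "F \<in> borel_measurable (families d k)"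
  shows "(\<integral>\<^sup>+ b. F b \<partial>Xi_law d k) = (\<integral>\<^sup>+ b. (\<Prod>j\<in>{1..k}. tr_density d (b j)) * F b \<partial>gauss_fam d k)"
  unfolding Xi_law_density[OF assms(1)] by (intro nn_integral_density) measurable

lemma prob_space_Xi_law: "d \<ge> 1 \<Longrightarrow> prob_space (Xi_law d k)"
  unfolding Xi_law_def by (intro prob_space_PiM prob_space_gamma_tr)

lemma AE_Xi_law:
  assumes "d \<ge> 1"
  shows "AE b in Xi_law d k. \<forall>j\<in>{1..k}. b j \<in> tr_ball d"
proof (rule AE_finite_allI)
  fix j assume j: "j \<in> {1..k}"
  show "AE b in Xi_law d k. b j \<in> tr_ball d"
    unfolding Xi_law_def
    using prob_space_gamma_tr[OF assms] j AE_gamma_tr[OF assms]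
    by (intro AE_PiM_component) auto
qed simp

text \<open>Prescribing the index \<open>i t\<close> that answers at time \<open>t\<close> removes the maximum and leaves linear
  observations. On the event that \<open>i\<close> is the sequence of maximizers this is the original process.\<close>

locale protocol =
  fixes d k :: nat and X :: "nat \<Rightarrow> vec \<Rightarrow> vec" and i :: "nat \<Rightarrow> nat"
  assumes X_measurable [measurable]: "X t \<in> seqs \<rightarrow>\<^sub>M Rn d"
    and X_causal: "(\<And>s. s < t \<Longrightarrow> y s = y' s) \<Longrightarrow> X t y = X t y'"
    and i_range: "i t \<in> {1..k}"
begin

text \<open>When query n + 1 is evaluated, the entries after n still hold 0; by causality they are
  not read.\<close>

primrec Y :: "nat \<Rightarrow> (nat \<Rightarrow> vec) \<Rightarrow> vec" where
  "Y 0 b = (\<lambda>_. 0)"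
| "Y (Suc n) b = (Y n b)(Suc n := ip d (b (i (Suc n))) (X (Suc n) (Y n b)))"

text \<open>Given the observations \<open>y 1, \<dots>, y n\<close>, the vector with index \<open>j\<close> is distributed as
  \<open>cen n j y + lin n j y w\<close> for a standard Gaussian \<open>w\<close>, where \<open>lin n j y\<close> is the orthogonal projection
  onto the complement of the queries answered by \<open>j\<close>.\<close>

primrec lin :: "nat \<Rightarrow> nat \<Rightarrow> vec \<Rightarrow> vec \<Rightarrow> vec" where
  "lin 0 j y v = v"
| "lin (Suc n) j y v = (if i (Suc n) = j
     then (let u = lin n j y (X (Suc n) y) in (\<lambda>r. lin n j y v r - ip d v u / ip d u u * u r))
     else lin n j y v)"

text \<open>A Gram-Schmidt step: \<open>u\<close> is the part of the new query orthogonal to the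
  earlier queries answered by j, and the centre moves along it until it reproduces the answer. For a
  redundant query \<open>u\<close> vanishes, and division by zero leaves everything
  unchanged.\<close>

primrec cen :: "nat \<Rightarrow> nat \<Rightarrow> vec \<Rightarrow> vec" where
  "cen 0 j y = (\<lambda>_. 0)"
| "cen (Suc n) j y = (if i (Suc n) = j
     then (let u = lin n j y (X (Suc n) y) in
       (\<lambda>r. cen n j y r + (y (Suc n) - ip d (cen n j y) (X (Suc n) y)) / ip d u u * u r))
     else cen n j y)"

definition theta1 :: "nat \<Rightarrow> nat \<Rightarrow> vec \<Rightarrow> vec \<Rightarrow> vec" where
  "theta1 n j y w = (\<lambda>r\<in>{1..d}. cen n j y r + lin n j y w r)"

definition theta :: "nat \<Rightarrow> vec \<Rightarrow> (nat \<Rightarrow> vec) \<Rightarrow> nat \<Rightarrow> vec" where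
  "theta n y b = (\<lambda>j\<in>{1..k}. theta1 n j y (b j))"

section \<open>Orthogonality of the centre and the projected noise\<close>

lemma lin_combination: "lin n j y (\<lambda>r. v r + a * w r) = (\<lambda>r. lin n j y v r + a * lin n j y w r)"
  by (induction n arbitrary: v a w) (auto simp: Let_def fun_eq_iff algebra_simps add_divide_distrib)

lemma lin_diff: "lin n j y (\<lambda>r. v r - a * w r) = (\<lambda>r. lin n j y v r - a * lin n j y w r)"
  using lin_combination[of n j y v "- a" w] by simp

text \<open>With idempotence this makes \<open>lin n j y\<close> an orthogonal projection.\<close>

lemma lin_symmetric: "ip d (lin n j y v) w = ip d v (lin n j y w)"
  by (induction n arbitrary: v w) (auto simp: Let_def ip_commute)

lemma lin_idem: "lin n j y (lin n j y v) = lin n j y v"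
proof (induction n arbitrary: v)
  case (Suc n)
  show ?case
  proof (cases "i (Suc n) = j")
    case True
    define P where "P = lin n j y"
    define u where "u = P (X (Suc n) y)"
    have PP: "P (P v) = P v" for v unfolding P_def by (rule Suc.IH)
    have Pu: "P u = u" unfolding u_def by (rule PP)
    have L: "lin (Suc n) j y v = (\<lambda>r. P v r - ip d v u / ip d u u * u r)" for v
      using True by (simp add: P_def u_def Let_def)
    have "ip d (P v) u = ip d v u"
      using lin_symmetric[of n j y v u] Pu by (simp add: P_def)
    \<comment> \<open>If \<open>u\<close> has norm 0, then every inner product with it is 0, so the
      undefined quotient does no harm.\<close>
    then have e1: "ip d (\<lambda>r. P v r - ip d v u / ip d u u * u r) u = 0"
      using ip_eq_0_right[of d u v] ip_eq_0_right[of d u "P v"] by (cases "ip d u u = 0") simp_all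
    have e2: "P (\<lambda>r. P v r - ip d v u / ip d u u * u r) = (\<lambda>r. P v r - ip d v u / ip d u u * u r)"
      using lin_diff[of n j y "P v" "ip d v u / ip d u u" u] by (simp add: PP Pu flip: P_def)
    show ?thesis unfolding L e1 e2 by simp
  qed (simp add: Suc.IH)
qed simp

text \<open>A step moves the centre only along \<open>u\<close> and removes exactly this direction
  from the range of the projection.\<close>

lemma ip_cen_lin: "ip d (cen n j y) (lin n j y v) = 0"
proof (induction n arbitrary: v)
  case (Suc n)
  show ?case
  proof (cases "i (Suc n) = j")
    case True
    define P where "P = lin n j y"
    define u where "u = P (X (Suc n) y)"
    define z where "z = (y (Suc n) - ip d (cen n j y) (X (Suc n) y)) / ip d u u"
    have Pu: "P u = u" unfolding u_def P_def by (rule lin_idem)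
    have cP: "ip d (cen n j y) (P v) = 0" for v unfolding P_def by (rule Suc.IH)
    have cu: "ip d (cen n j y) u = 0" unfolding u_def by (rule cP)
    have uP: "ip d u (P v) = ip d v u"
      using lin_symmetric[of n j y u v] Pu by (simp add: P_def ip_commute)
    have "cen (Suc n) j y = (\<lambda>r. cen n j y r + z * u r)"
      "lin (Suc n) j y v = (\<lambda>r. P v r - ip d v u / ip d u u * u r)"
      using True by (simp_all add: P_def u_def z_def Let_def)
    then show ?thesis
      by (cases "ip d u u = 0") (simp_all add: cP cu uP z_def)
  qed (simp add: Suc.IH)
qed simp

text \<open>Pythagoras. The increment is the squared prediction error divided by |u|^2: given the
  past and a nonzero \<open>u\<close>, this is the square of a standard Gaussian.\<close>

lemma ip_cen_Suc:
  "ip d (cen (Suc n) j y) (cen (Suc n) j y) = ip d (cen n j y) (cen n j y) +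
    (if i (Suc n) = j then (y (Suc n) - ip d (cen n j y) (X (Suc n) y))\<^sup>2 /
      ip d (lin n j y (X (Suc n) y)) (lin n j y (X (Suc n) y)) else 0)"
proof (cases "i (Suc n) = j")
  case True
  define u where "u = lin n j y (X (Suc n) y)"
  define z where "z = (y (Suc n) - ip d (cen n j y) (X (Suc n) y))"
  have "ip d (cen n j y) u = 0" unfolding u_def by (rule ip_cen_lin)
  moreover have "cen (Suc n) j y = (\<lambda>r. cen n j y r + z / ip d u u * u r)"
    using True by (simp add: u_def z_def Let_def)
  ultimately show ?thesis
    using True ip_commute[of d u "cen n j y"] unfolding z_def[symmetric] u_def[symmetric]
    by (cases "ip d u u = 0") (simp_all add: power2_eq_square)
qed simp

text \<open>Completing the square: \<open>cen\<close> is orthogonal to the range of \<open>lin\<close>.\<close>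

lemma cen_lin_bound:
  "ip d (cen n j y) h + ip d (lin n j y h) (lin n j y h) / 2 - ip d h h \<le> ip d (cen n j y) (cen n j y) / 4"
proof -
  define c where "c = cen n j y"
  define p where "p = lin n j y h"
  define w where "w = (\<lambda>r. h r - p r)"
  have cp: "ip d c p = 0" unfolding c_def p_def by (rule ip_cen_lin)
  have pp: "ip d p p = ip d h p"
    unfolding p_def using lin_symmetric[of n j y h "lin n j y h"] by (simp add: lin_idem)
  have "ip d c h = ip d c w" by (simp add: w_def cp)
  moreover have "ip d h h = ip d w w + ip d p p"
    using pp ip_commute[of d h p] by (simp add: w_def)
  moreover have "0 \<le> ip d (\<lambda>r. c r / 2 - w r) (\<lambda>r. c r / 2 - w r)" by (rule ip_nonneg)
  then have "ip d c w - ip d w w \<le> ip d c c / 4"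
    using ip_commute[of d c w] by simp
  ultimately show ?thesis using ip_nonneg[of d p] unfolding c_def[symmetric] p_def[symmetric] by simp
qed

lemma if_distribR: "(if c then f else g) x = (if c then f x else g x)"
  by simp

lemma lin_restrict: "r \<in> {1..d} \<Longrightarrow> lin n j y (restrict v {1..d}) r = lin n j y v r"
  by (induction n) (auto simp: Let_def)

lemma lin_cen_cong:
  assumes "\<And>s. s \<le> n \<Longrightarrow> y s = y' s"
  shows "lin n j y v = lin n j y' v \<and> cen n j y = cen n j y'"
  using assms
proof (induction n arbitrary: v)
  case (Suc n)
  have "X (Suc n) y = X (Suc n) y'" using Suc.prems by (intro X_causal) auto
  moreover have "lin n j y v = lin n j y' v" "cen n j y = cen n j y'" for v
    using Suc.IH[of v] Suc.prems by auto
  ultimately show ?case using Suc.prems[of "Suc n"] by (simp add: Let_def)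
qed simp

section \<open>Measurability of queries, projections and centres\<close>

lemma measurable_X_component:
  assumes "f \<in> M \<rightarrow>\<^sub>M seqs" "r \<in> {1..d}"
  shows "(\<lambda>x. X t (f x) r) \<in> borel_measurable M"
  by (rule measurable_Rn_component[OF measurable_compose[OF assms(1) X_measurable] assms(2)])

lemma measurable_lin:
  assumes "f \<in> M \<rightarrow>\<^sub>M seqs" "\<And>r. r \<in> {1..d} \<Longrightarrow> (\<lambda>x. g x r) \<in> borel_measurable M" "r \<in> {1..d}"
  shows "(\<lambda>x. lin n j (f x) (g x) r) \<in> borel_measurable M"
  using assms(2,3)
proof (induction n arbitrary: g r)
  case 0
  show ?case unfolding lin.simps by (rule 0(1)[OF 0(2)])
next
  case (Suc n)
  define U where "U x = lin n j (f x) (X (Suc n) (f x))" for x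
  have U: "(\<lambda>x. U x r) \<in> borel_measurable M" if "r \<in> {1..d}" for r
    unfolding U_def using that by (intro Suc.IH measurable_X_component assms(1))
  have "(\<lambda>x. lin n j (f x) (g x) r - ip d (g x) (U x) / ip d (U x) (U x) * U x r) \<in> borel_measurable M"
    by (intro borel_measurable_diff borel_measurable_times borel_measurable_divide borel_measurable_ip
        Suc.IH Suc.prems U)
  moreover have "(\<lambda>x. lin n j (f x) (g x) r) \<in> borel_measurable M"
    by (intro Suc.IH Suc.prems)
  ultimately show ?case
    unfolding lin.simps Let_def U_def if_distribR by (rule measurable_if_const)
qed

lemma measurable_cen:
  assumes f [measurable]: "f \<in> M \<rightarrow>\<^sub>M seqs" and "r \<in> {1..d}"
  shows "(\<lambda>x. cen n j (f x) r) \<in> borel_measurable M"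
  using assms(2)
proof (induction n arbitrary: r)
  case (Suc n)
  define U where "U x = lin n j (f x) (X (Suc n) (f x))" for x
  have U: "(\<lambda>x. U x r) \<in> borel_measurable M" if "r \<in> {1..d}" for r
    unfolding U_def using that by (intro measurable_lin measurable_X_component f)
  have y: "(\<lambda>x. f x (Suc n)) \<in> borel_measurable M" by measurable
  have "(\<lambda>x. cen n j (f x) r + (f x (Suc n) - ip d (cen n j (f x)) (X (Suc n) (f x))) / ip d (U x) (U x) * U x r)
      \<in> borel_measurable M"
    by (intro borel_measurable_add borel_measurable_diff borel_measurable_times borel_measurable_divide
        borel_measurable_ip y U Suc.IH Suc.prems measurable_X_component f)
  then show ?case
    using Suc.IH[OF Suc.prems] unfolding cen.simps Let_def U_def if_distribR by (rule measurable_if_const)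
qed (simp only: cen.simps borel_measurable_const)

lemma measurable_theta1 [measurable (raw)]:
  assumes "f \<in> M \<rightarrow>\<^sub>M seqs" "g \<in> M \<rightarrow>\<^sub>M Rn d"
  shows "(\<lambda>x. theta1 n j (f x) (g x)) \<in> M \<rightarrow>\<^sub>M Rn d"
  unfolding theta1_def using assms
  by (intro measurable_restrict_Rn borel_measurable_add measurable_lin measurable_cen measurable_Rn_component[of g M d]) auto

lemma measurable_theta [measurable (raw)]:
  assumes "f \<in> M \<rightarrow>\<^sub>M seqs" "g \<in> M \<rightarrow>\<^sub>M families d k"
  shows "(\<lambda>x. theta n (f x) (g x)) \<in> M \<rightarrow>\<^sub>M families d k"
  unfolding theta_def using assms
  by (intro measurable_restrict measurable_theta1 measurable_families_component[of g M d k]) auto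

lemma measurable_X [measurable (raw)]:
  assumes "f \<in> M \<rightarrow>\<^sub>M seqs"
  shows "(\<lambda>x. X t (f x)) \<in> M \<rightarrow>\<^sub>M Rn d"
  by (rule measurable_compose[OF assms X_measurable])

lemma measurable_ip_families:
  assumes "f \<in> M \<rightarrow>\<^sub>M families d k" "g \<in> M \<rightarrow>\<^sub>M Rn d" "q \<in> {1..k}"
  shows "(\<lambda>x. ip d (f x q) (g x)) \<in> borel_measurable M"
  using assms
  by (intro borel_measurable_ip measurable_Rn_component[of g M d]
      measurable_Rn_component[of "\<lambda>x. f x q" M d] measurable_families_component[of f M d k]) auto

lemma measurable_Y [measurable]: "Y n \<in> families d k \<rightarrow>\<^sub>M seqs"
proof (induction n)
  case (Suc n)
  note [measurable] = Suc
  show ?case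
    by (simp only: Y.simps) (intro measurable_seqs_upd Suc measurable_ip_families i_range measurable_X; measurable)
qed (auto intro!: measurable_seqsI)

end

lemma measurable_compose2:
  assumes "case_prod F \<in> borel_measurable (A \<Otimes>\<^sub>M B)" "f \<in> M \<rightarrow>\<^sub>M A" "g \<in> M \<rightarrow>\<^sub>M B"
  shows "(\<lambda>x. F (f x) (g x)) \<in> borel_measurable M"
  using measurable_compose[OF measurable_Pair[OF assms(2,3)] assms(1)] by simp

lemma measurable_nn_integral_gauss_fam:
  assumes "case_prod G \<in> borel_measurable (M \<Otimes>\<^sub>M families d k)"
  shows "(\<lambda>x. \<integral>\<^sup>+ b. G x b \<partial>gauss_fam d k) \<in> borel_measurable M"
  using assms by (intro gauss_fam.borel_measurable_nn_integral) simp

section \<open>The conditional law of the vectors given the observations\<close>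

context protocol
begin

text \<open>The only new direction that answer n + 1 reveals about the answering vector.\<close>

abbreviation query_dir :: "nat \<Rightarrow> vec \<Rightarrow> vec" where
  "query_dir n y \<equiv> lin n (i (Suc n)) y (X (Suc n) y)"

text \<open>Symmetry moves the projection onto x: an answer is its predicted value plus a Gaussian
  in the unrevealed direction.\<close>

lemma ip_theta1: "ip d (theta1 n j y w) x = ip d (cen n j y) x + ip d w (lin n j y x)"
  unfolding theta1_def ip_restrict by (simp add: lin_symmetric)

lemma X_upd: "X (Suc n) (y(Suc n := v)) = X (Suc n) y"
  by (rule X_causal) auto

lemma lin_upd: "lin n j (y(Suc n := v)) = lin n j y" and cen_upd: "cen n j (y(Suc n := v)) = cen n j y"
  using lin_cen_cong[of n "y(Suc n := v)" y] by auto

text \<open>The identity behind the resampling induction: exchanging the component of w along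
  \<open>u\<close> for that of an independent w' amounts to performing step n + 1 with the answer
  caused by w', while w remains as fresh noise.\<close>

lemma theta_upd:
  fixes y b w w' n
  defines "u \<equiv> query_dir n y" and "q \<equiv> i (Suc n)"
  shows "theta n y (b(q := \<lambda>r\<in>{1..d}. w r + (ip d w' u - ip d w u) / ip d u u * u r)) =
    theta (Suc n) (y(Suc n := ip d (cen n q y) (X (Suc n) y) + ip d w' u)) (b(q := w))"
proof -
  define y' where "y' = y(Suc n := ip d (cen n q y) (X (Suc n) y) + ip d w' u)"
  define a where "a = (ip d w' u - ip d w u) / ip d u u"
  have lu: "lin n q y u = u" unfolding u_def q_def by (rule lin_idem)
  have u': "query_dir n y' = u" unfolding y'_def lin_upd X_upd u_def by simp
  have "cen n q y r + lin n q y (\<lambda>r\<in>{1..d}. w r + a * u r) r = cen (Suc n) q y' r + lin (Suc n) q y' w r"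
    if r: "r \<in> {1..d}" for r
  proof -
    have "lin n q y (\<lambda>r\<in>{1..d}. w r + a * u r) r = lin n q y w r + a * u r"
      unfolding lin_restrict[OF r] lin_combination lu by simp
    moreover have "cen (Suc n) q y' r = cen n q y r + ip d w' u / ip d u u * u r"
      using u' by (simp add: Let_def q_def) (simp add: y'_def cen_upd X_upd q_def)
    moreover have "lin (Suc n) q y' w r = lin n q y w r - ip d w u / ip d u u * u r"
      using u' by (simp add: Let_def q_def) (simp add: y'_def lin_upd)
    ultimately show ?thesis by (simp add: a_def diff_divide_distrib algebra_simps)
  qed
  then have q: "theta1 n q y (\<lambda>r\<in>{1..d}. w r + a * u r) = theta1 (Suc n) q y' w"
    unfolding theta1_def by (intro restrict_ext) auto
  have "theta1 n j y v = theta1 (Suc n) j y' v" if "j \<noteq> q" for j v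
    using that unfolding theta1_def by (simp add: q_def y'_def cen_upd lin_upd)
  with q show ?thesis
    unfolding theta_def y'_def[symmetric] a_def[symmetric] by (intro restrict_ext) auto
qed

text \<open>Given the observations, the vectors are independent with the explicit laws of \<open>theta1\<close>.\<close>

theorem nn_integral_resample_theta:
  assumes "case_prod F \<in> borel_measurable (seqs \<Otimes>\<^sub>M families d k)"
  shows "(\<integral>\<^sup>+ b. F (Y n b) b \<partial>gauss_fam d k) =
    (\<integral>\<^sup>+ b'. \<integral>\<^sup>+ b. F (Y n b') (theta n (Y n b') b) \<partial>gauss_fam d k \<partial>gauss_fam d k)"
  using assms
proof (induction n arbitrary: F)
  case 0
  have "theta 0 y b = b" if "b \<in> space (families d k)" for y b
  proof -
    have "b \<in> extensional {1..k}" "\<And>j. j \<in> {1..k} \<Longrightarrow> b j \<in> extensional {1..d}"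
      using that by (auto simp: space_PiM Rn_def PiE_iff)
    then show ?thesis
      by (auto simp: theta_def theta1_def fun_eq_iff extensional_def)
  qed
  then have "(\<integral>\<^sup>+ b. F (Y 0 b') (theta 0 (Y 0 b') b) \<partial>gauss_fam d k) = (\<integral>\<^sup>+ b. F (Y 0 b) b \<partial>gauss_fam d k)" for b'
    by (intro nn_integral_cong) (simp only: space_gauss_fam Y.simps)
  then show ?case by (simp add: gauss_fam.emeasure_space_1[unfolded space_gauss_fam] del: Y.simps)
next
  case (Suc n)
  note F = measurable_compose2[OF Suc.prems]
  define q where "q = i (Suc n)"
  have q: "q \<in> {1..k}" unfolding q_def by (rule i_range)
  define m where "m y b = ip d (b q) (X (Suc n) y)" for y and b :: "nat \<Rightarrow> vec"
  have m: "(\<lambda>x. m (f x) (g x)) \<in> borel_measurable M"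
    if "f \<in> M \<rightarrow>\<^sub>M seqs" "g \<in> M \<rightarrow>\<^sub>M families d k" for f g and M :: "'z measure"
    unfolding m_def by (intro measurable_ip_families that q measurable_X)
  define G where "G y s b = F (y(Suc n := s)) (theta (Suc n) (y(Suc n := s)) b)" for y s and b :: "nat \<Rightarrow> vec"
  have G: "(\<lambda>x. G (f x) (h x) (g x)) \<in> borel_measurable M"
    if "f \<in> M \<rightarrow>\<^sub>M seqs" "h \<in> borel_measurable M" "g \<in> M \<rightarrow>\<^sub>M families d k" for f g h and M :: "'z measure"
    unfolding G_def by (intro F measurable_seqs_upd measurable_theta that)
  \<comment> \<open>\<open>F1\<close> appends the answer given by b itself; \<open>F2\<close>
    appends the same answer and then redraws everything else from the conditional law after step n +
    1.\<close>
  define F1 where "F1 y b = F (y(Suc n := m y b)) b" for y b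
  define F2 where "F2 y b = (\<integral>\<^sup>+ b''. G y (m y b) b'' \<partial>gauss_fam d k)" for y b
  have F1: "case_prod F1 \<in> borel_measurable (seqs \<Otimes>\<^sub>M families d k)"
    unfolding F1_def split_beta' by (intro F measurable_seqs_upd m measurable_fst measurable_snd)
  have F2: "case_prod F2 \<in> borel_measurable (seqs \<Otimes>\<^sub>M families d k)"
    unfolding F2_def split_beta'
    by (intro measurable_nn_integral_gauss_fam, unfold split_beta')
       (intro G m measurable_compose[OF measurable_fst] measurable_fst measurable_snd)
  \<comment> \<open>For a fixed past, resampling along \<open>u\<close> separates the noise w' that
    determines the new answer from the noise w that remains.\<close>
  have step: "(\<integral>\<^sup>+ b. F1 y (theta n y b) \<partial>gauss_fam d k) = (\<integral>\<^sup>+ b. F2 y (theta n y b) \<partial>gauss_fam d k)" for y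
  proof -
    define u where "u = query_dir n y"
    define c where "c = ip d (cen n q y) (X (Suc n) y)"
    have y: "(\<lambda>_. y) \<in> M \<rightarrow>\<^sub>M seqs" for M :: "'z measure" by (rule measurable_const) (simp add: space_PiM)
    have msg: "m y (theta n y b) = c + ip d (b q) u" for b
      using q by (simp add: m_def theta_def ip_theta1 c_def u_def q_def)
    have mu: "(\<lambda>x. c + ip d (f x) u) \<in> borel_measurable M" if "f \<in> M \<rightarrow>\<^sub>M Rn d" for f and M :: "'z measure"
      by (intro borel_measurable_add borel_measurable_const measurable_compose[OF that measurable_ip_const(1)])
    have id: "(\<lambda>b. b) \<in> M \<rightarrow>\<^sub>M M" for M :: "'z measure" by simp
    have "(\<integral>\<^sup>+ b. F1 y (theta n y b) \<partial>gauss_fam d k) =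
        (\<integral>\<^sup>+ b. \<integral>\<^sup>+ w. F1 y (theta n y (b(q := w))) \<partial>std_gaussian d \<partial>gauss_fam d k)"
      by (intro nn_integral_gauss_fam_upd[OF q] measurable_compose2[OF F1] y measurable_theta id)
    also have "\<dots> = (\<integral>\<^sup>+ b. \<integral>\<^sup>+ w'. \<integral>\<^sup>+ w. G y (c + ip d w' u) (b(q := w)) \<partial>std_gaussian d \<partial>std_gaussian d \<partial>gauss_fam d k)"
    proof (rule nn_integral_cong)
      fix b assume "b \<in> space (gauss_fam d k)"
      then have b: "(\<lambda>_. b) \<in> M \<rightarrow>\<^sub>M families d k" for M :: "'z measure" by (intro measurable_const) simp
      have "(\<integral>\<^sup>+ w. F1 y (theta n y (b(q := w))) \<partial>std_gaussian d) =
          (\<integral>\<^sup>+ w. (\<lambda>s w. F (y(Suc n := c + s)) (theta n y (b(q := w)))) (ip d w u) w \<partial>std_gaussian d)"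
        by (simp add: F1_def msg)
      also have "\<dots> = (\<integral>\<^sup>+ w'. \<integral>\<^sup>+ w. F (y(Suc n := c + ip d w' u))
          (theta n y (b(q := \<lambda>r\<in>{1..d}. w r + (ip d w' u - ip d w u) / ip d u u * u r))) \<partial>std_gaussian d \<partial>std_gaussian d)"
        by (subst nn_integral_std_gaussian_resample, unfold split_beta')
           (intro F measurable_seqs_upd y measurable_theta measurable_families_upd b q borel_measurable_add
              borel_measurable_const measurable_fst measurable_snd, rule refl)
      also have "\<dots> = (\<integral>\<^sup>+ w'. \<integral>\<^sup>+ w. G y (c + ip d w' u) (b(q := w)) \<partial>std_gaussian d \<partial>std_gaussian d)"
        unfolding G_def c_def u_def q_def theta_upd ..
      finally show "(\<integral>\<^sup>+ w. F1 y (theta n y (b(q := w))) \<partial>std_gaussian d) =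
          (\<integral>\<^sup>+ w'. \<integral>\<^sup>+ w. G y (c + ip d w' u) (b(q := w)) \<partial>std_gaussian d \<partial>std_gaussian d)" .
    qed
    \<comment> \<open>With w' outermost, the redrawn vector w can be folded back into an independent
      family b.\<close>
    also have "\<dots> = (\<integral>\<^sup>+ w'. \<integral>\<^sup>+ b. \<integral>\<^sup>+ w. G y (c + ip d w' u) (b(q := w)) \<partial>std_gaussian d \<partial>gauss_fam d k \<partial>std_gaussian d)"
    proof (rule gauss_fam_pair.Fubini'[symmetric])
      show "(\<lambda>(b, w'). \<integral>\<^sup>+ w. G y (c + ip d w' u) (b(q := w)) \<partial>std_gaussian d)
          \<in> borel_measurable (gauss_fam d k \<Otimes>\<^sub>M std_gaussian d)"
        unfolding split_beta'
        by (intro std_gaussian.borel_measurable_nn_integral, unfold split_beta')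
           (intro G y mu measurable_families_upd measurable_compose[OF measurable_fst] q; simp)
    qed
    also have "\<dots> = (\<integral>\<^sup>+ w'. \<integral>\<^sup>+ b. G y (c + ip d w' u) b \<partial>gauss_fam d k \<partial>std_gaussian d)"
      by (intro nn_integral_cong nn_integral_gauss_fam_upd[OF q, symmetric] G y borel_measurable_const id)
    also have "\<dots> = (\<integral>\<^sup>+ b. \<integral>\<^sup>+ w'. F2 y (theta n y (b(q := w'))) \<partial>std_gaussian d \<partial>gauss_fam d k)"
      by (simp add: F2_def msg gauss_fam.emeasure_space_1[unfolded space_gauss_fam])
    also have "\<dots> = (\<integral>\<^sup>+ b. F2 y (theta n y b) \<partial>gauss_fam d k)"
      by (intro nn_integral_gauss_fam_upd[OF q, symmetric] measurable_compose2[OF F2] y measurable_theta id)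
    finally show ?thesis .
  qed
  have "(\<integral>\<^sup>+ b. F (Y (Suc n) b) b \<partial>gauss_fam d k) = (\<integral>\<^sup>+ b. F1 (Y n b) b \<partial>gauss_fam d k)"
    by (simp add: F1_def m_def q_def)
  also have "\<dots> = (\<integral>\<^sup>+ b'. \<integral>\<^sup>+ b. F1 (Y n b') (theta n (Y n b') b) \<partial>gauss_fam d k \<partial>gauss_fam d k)"
    by (rule Suc.IH[OF F1])
  also have "\<dots> = (\<integral>\<^sup>+ b'. \<integral>\<^sup>+ b. F2 (Y n b') (theta n (Y n b') b) \<partial>gauss_fam d k \<partial>gauss_fam d k)"
    by (simp only: step)
  \<comment> \<open>The induction hypothesis is read backwards, so that the outer family is again
    the one that generated the observations.\<close>
  also have "\<dots> = (\<integral>\<^sup>+ b. F2 (Y n b) b \<partial>gauss_fam d k)"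
    by (rule Suc.IH[OF F2, symmetric])
  also have "\<dots> = (\<integral>\<^sup>+ b'. \<integral>\<^sup>+ b. F (Y (Suc n) b') (theta (Suc n) (Y (Suc n) b') b) \<partial>gauss_fam d k \<partial>gauss_fam d k)"
    by (simp add: F2_def G_def m_def q_def)
  finally show ?case .
qed

text \<open>Conditional independence in usable form: given the observations, a product over the
  vectors integrates factor by factor.\<close>

lemma nn_integral_resample_prod:
  assumes G: "G \<in> borel_measurable seqs"
    and \<omega>: "\<And>j. j \<in> {1..k} \<Longrightarrow> case_prod (\<omega> j) \<in> borel_measurable (seqs \<Otimes>\<^sub>M Rn d)"
  shows "(\<integral>\<^sup>+ b. G (Y n b) * (\<Prod>j\<in>{1..k}. \<omega> j (Y n b) (b j)) \<partial>gauss_fam d k) =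
    (\<integral>\<^sup>+ b. G (Y n b) * (\<Prod>j\<in>{1..k}. \<integral>\<^sup>+ w. \<omega> j (Y n b) (theta1 n j (Y n b) w) \<partial>std_gaussian d) \<partial>gauss_fam d k)"
proof -
  define F where "F y b = G y * (\<Prod>j\<in>{1..k}. \<omega> j y (b j))" for y and b :: "nat \<Rightarrow> vec"
  have F: "case_prod F \<in> borel_measurable (seqs \<Otimes>\<^sub>M families d k)"
    unfolding F_def split_beta'
  proof (intro borel_measurable_times_ennreal borel_measurable_prod_ennreal)
    show "(\<lambda>x. G (fst x)) \<in> borel_measurable (seqs \<Otimes>\<^sub>M families d k)"
      by (rule measurable_compose[OF measurable_fst G])
    fix j assume j: "j \<in> {1..k}"
    show "(\<lambda>x. \<omega> j (fst x) (snd x j)) \<in> borel_measurable (seqs \<Otimes>\<^sub>M families d k)"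
      by (intro measurable_compose2[OF \<omega>[OF j]] measurable_fst measurable_families_component[OF _ j] measurable_snd)
  qed
  have "(\<integral>\<^sup>+ b. G (Y n b) * (\<Prod>j\<in>{1..k}. \<omega> j (Y n b) (b j)) \<partial>gauss_fam d k) =
    (\<integral>\<^sup>+ b'. \<integral>\<^sup>+ b. F (Y n b') (theta n (Y n b') b) \<partial>gauss_fam d k \<partial>gauss_fam d k)"
    unfolding F_def[symmetric] by (rule nn_integral_resample_theta[OF F])
  also have "\<dots> = (\<integral>\<^sup>+ b. G (Y n b) * (\<Prod>j\<in>{1..k}. \<integral>\<^sup>+ w. \<omega> j (Y n b) (theta1 n j (Y n b) w) \<partial>std_gaussian d) \<partial>gauss_fam d k)"
  proof (rule nn_integral_cong)
    fix b'
    define y where "y = Y n b'"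
    have y: "(\<lambda>_. y) \<in> M \<rightarrow>\<^sub>M seqs" for M :: "'z measure" by (rule measurable_const) (simp add: space_PiM)
    have m: "(\<lambda>w. \<omega> j y (theta1 n j y w)) \<in> borel_measurable (std_gaussian d)" if "j \<in> {1..k}" for j
      by (intro measurable_compose2[OF \<omega>[OF that]] y measurable_theta1) simp
    have "(\<integral>\<^sup>+ b. F y (theta n y b) \<partial>gauss_fam d k) =
        (\<integral>\<^sup>+ b. G y * (\<Prod>j\<in>{1..k}. \<omega> j y (theta1 n j y (b j))) \<partial>gauss_fam d k)"
      by (simp add: F_def theta_def)
    also have "\<dots> = G y * (\<integral>\<^sup>+ b. (\<Prod>j\<in>{1..k}. \<omega> j y (theta1 n j y (b j))) \<partial>gauss_fam d k)"
    proof (rule nn_integral_cmult, intro borel_measurable_prod_ennreal)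
      fix j assume j: "j \<in> {1..k}"
      have "(\<lambda>b. b j) \<in> gauss_fam d k \<rightarrow>\<^sub>M std_gaussian d"
        unfolding gauss_fam_def by (rule measurable_component_singleton[OF j])
      then show "(\<lambda>b. \<omega> j y (theta1 n j y (b j))) \<in> borel_measurable (gauss_fam d k)"
        by (rule measurable_compose[OF _ m[OF j]])
    qed
    also have "\<dots> = G y * (\<Prod>j\<in>{1..k}. \<integral>\<^sup>+ w. \<omega> j y (theta1 n j y w) \<partial>std_gaussian d)"
      unfolding gauss_fam_def by (subst std_gaussian_PiM.product_nn_integral_prod) (auto intro: m)
    finally show "(\<integral>\<^sup>+ b. F (Y n b') (theta n (Y n b') b) \<partial>gauss_fam d k) =
      G (Y n b') * (\<Prod>j\<in>{1..k}. \<integral>\<^sup>+ w. \<omega> j (Y n b') (theta1 n j (Y n b') w) \<partial>std_gaussian d)"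
      unfolding y_def .
  qed
  finally show ?thesis .
qed

text \<open>By \<open>ip_cen_Suc\<close> each step adds at most one conditionally Gaussian square,
  divided by 4, to the exponent, at a cost of at most 2.\<close>

lemma nn_integral_exp_cen:
  "(\<integral>\<^sup>+ b. ennreal (exp (\<Sum>j\<in>{1..k}. ip d (cen n j (Y n b)) (cen n j (Y n b)) / 4)) \<partial>gauss_fam d k) \<le> 2 ^ n"
proof (induction n)
  case 0
  then show ?case by (simp add: gauss_fam.emeasure_space_1[unfolded space_gauss_fam])
next
  case (Suc n)
  define q where "q = i (Suc n)"
  have q: "q \<in> {1..k}" unfolding q_def by (rule i_range)
  define A where "A y = (\<Sum>j\<in>{1..k}. ip d (cen n j y) (cen n j y) / 4)" for y
  define u where "u = query_dir n"
  define E where "E y s = exp ((s - ip d (cen n q y) (X (Suc n) y))\<^sup>2 / ip d (u y) (u y) / 4)" for y s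
  define \<omega> where "\<omega> j y w = (if j = q then ennreal (E y (ip d w (X (Suc n) y))) else 1)" for j y w
  have split: "(\<Sum>j\<in>{1..k}. ip d (cen (Suc n) j y) (cen (Suc n) j y) / 4) =
      A y + (y (Suc n) - ip d (cen n q y) (X (Suc n) y))\<^sup>2 / ip d (u y) (u y) / 4" for y
  proof -
    have "(\<Sum>j\<in>{1..k}. ip d (cen (Suc n) j y) (cen (Suc n) j y) / 4) =
       (\<Sum>j\<in>{1..k}. ip d (cen n j y) (cen n j y) / 4 +
         (if j = q then (y (Suc n) - ip d (cen n q y) (X (Suc n) y))\<^sup>2 / ip d (u y) (u y) / 4 else 0))"
      unfolding ip_cen_Suc q_def u_def by (intro sum.cong) auto
    then show ?thesis using q by (simp add: sum.distrib A_def)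
  qed
  have mA: "(\<lambda>y. ennreal (exp (A y))) \<in> borel_measurable seqs"
    unfolding A_def
    by (intro measurable_compose[OF _ measurable_ennreal] measurable_compose[OF _ borel_measurable_exp]
        borel_measurable_sum borel_measurable_divide borel_measurable_const borel_measurable_ip measurable_cen) simp_all
  have mu: "(\<lambda>x. u (f x) r) \<in> borel_measurable M" if "f \<in> M \<rightarrow>\<^sub>M seqs" "r \<in> {1..d}" for f r and M :: "'z measure"
    unfolding u_def using that by (intro measurable_lin measurable_X_component)
  have m\<omega>: "case_prod (\<omega> j) \<in> borel_measurable (seqs \<Otimes>\<^sub>M Rn d)" for j
    unfolding \<omega>_def E_def split_beta'
    by (intro measurable_if_const measurable_compose[OF _ measurable_ennreal] measurable_compose[OF _ borel_measurable_exp]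
        borel_measurable_divide borel_measurable_power borel_measurable_diff borel_measurable_const borel_measurable_ip
        measurable_cen measurable_X_component mu measurable_fst measurable_Rn_component[OF measurable_snd])
  have "(\<integral>\<^sup>+ b. ennreal (exp (\<Sum>j\<in>{1..k}. ip d (cen (Suc n) j (Y (Suc n) b)) (cen (Suc n) j (Y (Suc n) b)) / 4)) \<partial>gauss_fam d k)
     = (\<integral>\<^sup>+ b. ennreal (exp (A (Y n b))) * (\<Prod>j\<in>{1..k}. \<omega> j (Y n b) (b j)) \<partial>gauss_fam d k)"
  proof (rule nn_integral_cong)
    fix b
    have "A (Y (Suc n) b) = A (Y n b)" "u (Y (Suc n) b) = u (Y n b)"
      by (simp_all add: A_def u_def cen_upd lin_upd X_upd)
    then have "exp (\<Sum>j\<in>{1..k}. ip d (cen (Suc n) j (Y (Suc n) b)) (cen (Suc n) j (Y (Suc n) b)) / 4) =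
        exp (A (Y n b)) * E (Y n b) (ip d (b q) (X (Suc n) (Y n b)))"
      unfolding split E_def exp_add by (simp add: cen_upd X_upd q_def)
    moreover have "(\<Prod>j\<in>{1..k}. \<omega> j (Y n b) (b j)) = ennreal (E (Y n b) (ip d (b q) (X (Suc n) (Y n b))))"
      using q by (simp add: \<omega>_def)
    ultimately show "ennreal (exp (\<Sum>j\<in>{1..k}. ip d (cen (Suc n) j (Y (Suc n) b)) (cen (Suc n) j (Y (Suc n) b)) / 4)) =
        ennreal (exp (A (Y n b))) * (\<Prod>j\<in>{1..k}. \<omega> j (Y n b) (b j))"
      by (simp only:) (simp add: ennreal_mult' E_def)
  qed
  also have "\<dots> = (\<integral>\<^sup>+ b. ennreal (exp (A (Y n b))) * (\<Prod>j\<in>{1..k}. \<integral>\<^sup>+ w. \<omega> j (Y n b) (theta1 n j (Y n b) w) \<partial>std_gaussian d) \<partial>gauss_fam d k)"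
    by (rule nn_integral_resample_prod[OF mA m\<omega>])
  also have "\<dots> \<le> (\<integral>\<^sup>+ b. ennreal (exp (A (Y n b))) * 2 \<partial>gauss_fam d k)"
  proof (intro nn_integral_mono mult_left_mono)
    fix b
    define y where "y = Y n b"
    \<comment> \<open>By \<open>ip_theta1\<close> the prediction error is
      \<open>ip d w (u y)\<close>: the centre cancels and only fresh noise is left.\<close>
    have "(\<Prod>j\<in>{1..k}. \<integral>\<^sup>+ w. \<omega> j y (theta1 n j y w) \<partial>std_gaussian d) =
        (\<Prod>j\<in>{1..k}. if j = q then \<integral>\<^sup>+ w. ennreal (exp ((ip d w (u y))\<^sup>2 / ip d (u y) (u y) / 4)) \<partial>std_gaussian d else 1)"
      by (intro prod.cong refl)
         (simp add: \<omega>_def E_def ip_theta1 u_def q_def std_gaussian.emeasure_space_1[unfolded space_std_gaussian])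
    also have "\<dots> = (\<integral>\<^sup>+ w. ennreal (exp ((ip d w (u y))\<^sup>2 / ip d (u y) (u y) / 4)) \<partial>std_gaussian d)"
      using q by simp
    also have "\<dots> \<le> 2" by (rule nn_integral_std_gaussian_exp_square)
    finally show "(\<Prod>j\<in>{1..k}. \<integral>\<^sup>+ w. \<omega> j (Y n b) (theta1 n j (Y n b) w) \<partial>std_gaussian d) \<le> 2"
      unfolding y_def .
  qed simp
  also have "\<dots> = (\<integral>\<^sup>+ b. ennreal (exp (A (Y n b))) \<partial>gauss_fam d k) * 2"
    by (rule nn_integral_multc, subst measurable_cong_sets[OF sets_gauss_fam refl])
       (rule measurable_compose[OF measurable_Y mA])
  also have "\<dots> \<le> 2 ^ n * 2" unfolding A_def by (intro mult_right_mono Suc.IH) simp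
  finally show ?case by (simp only: power_Suc2)
qed


section \<open>Runs as fixed points, and exponential moments of predictable vectors\<close>

lemma Y_component: "Y n b s = (if s \<in> {1..n} then ip d (b (i s)) (X s (Y n b)) else 0)"
proof (induction n arbitrary: s)
  case (Suc n)
  have X: "X s (Y (Suc n) b) = X s (Y n b)" if "s \<le> Suc n" for s
    using that by (intro X_causal) auto
  show ?case
  proof (cases "s \<in> {1..Suc n}")
    case True
    then show ?thesis using Suc.IH[of s] X[of s] by (cases "s = Suc n") auto
  next
    case False
    then show ?thesis using Suc.IH[of s] by auto
  qed
qed auto

text \<open>Causality makes the fixed-point equations recursive in time. This serves to recognise
  the answers of the actual algorithm as a linear run.\<close>

lemma Y_unique:
  assumes y: "\<And>s. y s = (if s \<in> {1..n} then ip d (b (i s)) (X s y) else 0)"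
  shows "Y n b = y"
proof
  fix s
  show "Y n b s = y s"
  proof (induction s rule: less_induct)
    case (less s)
    then have "X s (Y n b) = X s y" by (intro X_causal) auto
    then show ?case using Y_component[of n b s] y[of s] by auto
  qed
qed

lemma lin_cen_unused:
  assumes "\<And>s. s \<in> {1..n} \<Longrightarrow> i s \<noteq> j"
  shows "lin n j y v = v \<and> cen n j y = (\<lambda>_. 0)"
  using assms by (induction n arbitrary: v) auto

text \<open>For a measured vector the density is bounded by 2, and the Gaussian exponential moment
  is absorbed by \<open>cen_lin_bound\<close>. A vector never measured still has the truncated law,
  and \<open>nn_integral_gamma_tr_exp\<close> is cancelled exactly by the penalty, with no factor
  2.\<close>

lemma nn_integral_theta1_exp:
  assumes "d \<ge> 1"
  shows "(\<integral>\<^sup>+ w. tr_density d (theta1 n j y w) * ennreal (exp (ip d (theta1 n j y w) h - ip d h h)) \<partial>std_gaussian d)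
    \<le> (if j \<in> i ` {1..n} then 2 else 1) * ennreal (exp (ip d (cen n j y) (cen n j y) / 4))"
proof (cases "j \<in> i ` {1..n}")
  case True
  define c p where "c = cen n j y" and "p = lin n j y h"
  have "(\<integral>\<^sup>+ w. tr_density d (theta1 n j y w) * ennreal (exp (ip d (theta1 n j y w) h - ip d h h)) \<partial>std_gaussian d)
    \<le> (\<integral>\<^sup>+ w. (2 * ennreal (exp (ip d c h - ip d h h))) * ennreal (exp (ip d w p)) \<partial>std_gaussian d)"
  proof (rule nn_integral_mono)
    fix w
    have "ip d (theta1 n j y w) h - ip d h h = ip d c h - ip d h h + ip d w p"
      by (simp add: ip_theta1 c_def p_def)
    then have "ennreal (exp (ip d (theta1 n j y w) h - ip d h h)) =
        ennreal (exp (ip d c h - ip d h h)) * ennreal (exp (ip d w p))"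
      by (simp only: exp_add) (simp add: ennreal_mult')
    then show "tr_density d (theta1 n j y w) * ennreal (exp (ip d (theta1 n j y w) h - ip d h h)) \<le>
        2 * ennreal (exp (ip d c h - ip d h h)) * ennreal (exp (ip d w p))"
      using tr_density_le[OF assms, of "theta1 n j y w"] by (simp add: mult.assoc mult_right_mono)
  qed
  also have "\<dots> = 2 * ennreal (exp (ip d c h - ip d h h)) * (\<integral>\<^sup>+ w. ennreal (exp (ip d w p)) \<partial>std_gaussian d)"
    by (rule nn_integral_cmult) measurable
  also have "\<dots> = 2 * ennreal (exp (ip d c h + ip d p p / 2 - ip d h h))"
    unfolding nn_integral_std_gaussian_exp mult.assoc
    by (simp flip: ennreal_mult' exp_add add: algebra_simps)
  also have "\<dots> \<le> 2 * ennreal (exp (ip d c c / 4))"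
    using cen_lin_bound[of n j y h] unfolding c_def p_def by (intro mult_left_mono ennreal_leI) auto
  finally show ?thesis using True by (simp add: c_def)
next
  case False
  then have "i s \<noteq> j" if "s \<in> {1..n}" for s using that by blast
  from lin_cen_unused[OF this] have lc: "lin n j y v = v" "cen n j y = (\<lambda>_. 0)" for v by auto
  have "(\<integral>\<^sup>+ w. tr_density d (theta1 n j y w) * ennreal (exp (ip d (theta1 n j y w) h - ip d h h)) \<partial>std_gaussian d)
    = (\<integral>\<^sup>+ w. tr_density d w * ennreal (exp (ip d w h - ip d h h)) \<partial>std_gaussian d)"
    unfolding theta1_def lc by (intro nn_integral_cong) simp
  also have "\<dots> = (\<integral>\<^sup>+ w. ennreal (exp (ip d w h - ip d h h)) \<partial>gamma_tr d)"
    by (subst nn_integral_gamma_tr) auto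
  also have "\<dots> = (\<integral>\<^sup>+ w. ennreal (exp (- ip d h h)) * ennreal (exp (ip d w h)) \<partial>gamma_tr d)"
    by (simp flip: ennreal_mult' exp_add)
  also have "\<dots> = ennreal (exp (- ip d h h)) * (\<integral>\<^sup>+ w. ennreal (exp (ip d w h)) \<partial>gamma_tr d)"
    by (rule nn_integral_cmult) measurable
  also have "\<dots> \<le> ennreal (exp (- ip d h h)) * ennreal (exp (ip d h h))"
    by (intro mult_left_mono nn_integral_gamma_tr_exp[OF assms]) simp
  also have "\<dots> = 1" by (simp flip: ennreal_mult' exp_add)
  finally show ?thesis using False by (simp add: lc)
qed

text \<open>The vectors \<open>h j\<close> may depend on the observations in any measurable way:
  resampling keeps the observations fixed, so each \<open>h j\<close> is constant in the inner
  integrals.\<close>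

lemma nn_integral_exp_predictable:
  assumes "d \<ge> 1" and h: "\<And>j r. j \<in> {1..k} \<Longrightarrow> r \<in> {1..d} \<Longrightarrow> (\<lambda>y. h j y r) \<in> borel_measurable seqs"
  shows "(\<integral>\<^sup>+ b. (\<Prod>j\<in>{1..k}. tr_density d (b j) *
      ennreal (exp (ip d (b j) (h j (Y n b)) - ip d (h j (Y n b)) (h j (Y n b))))) \<partial>gauss_fam d k) \<le> 4 ^ n"
proof -
  define \<omega> where "\<omega> j y w = tr_density d w * ennreal (exp (ip d w (h j y) - ip d (h j y) (h j y)))" for j y w
  have m\<omega>: "case_prod (\<omega> j) \<in> borel_measurable (seqs \<Otimes>\<^sub>M Rn d)" if "j \<in> {1..k}" for j
    unfolding \<omega>_def split_beta'
    by (intro borel_measurable_times_ennreal measurable_compose[OF measurable_snd tr_density_measurable]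
        measurable_compose[OF _ measurable_ennreal] measurable_compose[OF _ borel_measurable_exp]
        borel_measurable_diff borel_measurable_ip measurable_Rn_component[OF measurable_snd]
        measurable_compose[OF measurable_fst h] that)
  define C where "C y = (\<Sum>j\<in>{1..k}. ip d (cen n j y) (cen n j y) / 4)" for y
  have mC: "(\<lambda>b. ennreal (exp (C (Y n b)))) \<in> borel_measurable (gauss_fam d k)"
    unfolding C_def measurable_cong_sets[OF sets_gauss_fam refl]
    by (intro measurable_compose[OF _ measurable_ennreal] measurable_compose[OF _ borel_measurable_exp]
        borel_measurable_sum borel_measurable_divide borel_measurable_const borel_measurable_ip measurable_cen measurable_Y)
  have "(\<integral>\<^sup>+ b. 1 * (\<Prod>j\<in>{1..k}. \<omega> j (Y n b) (b j)) \<partial>gauss_fam d k) =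
      (\<integral>\<^sup>+ b. 1 * (\<Prod>j\<in>{1..k}. \<integral>\<^sup>+ w. \<omega> j (Y n b) (theta1 n j (Y n b) w) \<partial>std_gaussian d) \<partial>gauss_fam d k)"
    by (rule nn_integral_resample_prod[where G = "\<lambda>_. 1"]) (auto intro: m\<omega>)
  also have "\<dots> \<le> (\<integral>\<^sup>+ b. 2 ^ n * ennreal (exp (C (Y n b))) \<partial>gauss_fam d k)"
  proof (rule nn_integral_mono)
    fix b
    define y where "y = Y n b"
    have "(\<Prod>j\<in>{1..k}. \<integral>\<^sup>+ w. \<omega> j y (theta1 n j y w) \<partial>std_gaussian d) \<le>
        (\<Prod>j\<in>{1..k}. (if j \<in> i ` {1..n} then 2 else 1) * ennreal (exp (ip d (cen n j y) (cen n j y) / 4)))"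
      unfolding \<omega>_def by (intro prod_mono_ennreal nn_integral_theta1_exp assms(1))
    also have "\<dots> = (\<Prod>j\<in>{1..k}. (if j \<in> i ` {1..n} then 2 else 1)) * ennreal (exp (C y))"
      by (simp add: prod.distrib C_def exp_sum prod_ennreal)
    \<comment> \<open>Only indices that answered some query pay the truncation factor, and there are
      at most n of them, independently of k.\<close>
    also have "(\<Prod>j\<in>{1..k}. (if j \<in> i ` {1..n} then 2 else 1)) = (\<Prod>j\<in>i ` {1..n}. 2 :: ennreal)"
    proof -
      have "{1..k} \<inter> i ` {1..n} = i ` {1..n}" using i_range by auto
      then show ?thesis by (simp flip: prod.inter_restrict)
    qed
    also have "\<dots> = 2 ^ card (i ` {1..n})" by simp
    also have "\<dots> \<le> 2 ^ n"
      using card_image_le[of "{1..n}" i] by (intro power_increasing) auto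
    finally show "1 * (\<Prod>j\<in>{1..k}. \<integral>\<^sup>+ w. \<omega> j (Y n b) (theta1 n j (Y n b) w) \<partial>std_gaussian d) \<le>
        2 ^ n * ennreal (exp (C (Y n b)))"
      by (simp add: y_def mult_right_mono)
  qed
  also have "\<dots> = 2 ^ n * (\<integral>\<^sup>+ b. ennreal (exp (C (Y n b))) \<partial>gauss_fam d k)"
    by (rule nn_integral_cmult[OF mC])
  \<comment> \<open>One power of 2 is for truncation, the other for the revealed directions.\<close>
  also have "\<dots> \<le> 2 ^ n * 2 ^ n"
    unfolding C_def by (intro mult_left_mono nn_integral_exp_cen) simp
  also have "\<dots> = 4 ^ n" by (simp flip: power_mult_distrib)
  finally show ?thesis by (simp add: \<omega>_def)
qed

end

section \<open>The transcript and the posterior means\<close>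

locale algorithm =
  fixes d k T :: nat and A :: det_alg
  assumes d: "d \<ge> 1" and k: "k \<ge> 1" and A: "A \<in> A_det d T"
begin

text \<open>The policy reads values of \<open>f_Xi\<close>, whereas y holds the unscaled values,
  hence the division. The constant outside {2..T} keeps every query measurable.\<close>

definition next_query :: "nat \<Rightarrow> vec \<Rightarrow> vec" where
  "next_query t y = (if t \<in> {2..T} then policy A t (\<lambda>s\<in>{1..t - 1}. y s / sqrt (real d)) else init A)"

text \<open>The default 1 gives total sequences with all values in {1..k} and keeps their number at
  k^T.\<close>

definition index_seqs :: "(nat \<Rightarrow> nat) set" where
  "index_seqs = PiE_dflt {1..T} 1 (\<lambda>_. {1..k})"

definition answers :: "(nat \<Rightarrow> nat) \<Rightarrow> (nat \<Rightarrow> vec) \<Rightarrow> vec" where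
  "answers i = protocol.Y d next_query i T"

text \<open>Strictness for indices smaller than the winner encodes the tie-breaking rule. Given y,
  the condition concerns one vector only.\<close>

definition below :: "(nat \<Rightarrow> nat) \<Rightarrow> vec \<Rightarrow> nat \<Rightarrow> vec set" where
  "below i y j = {w. \<forall>s\<in>{1..T}. ip d w (next_query s y) \<le> y s \<and> (j < i s \<longrightarrow> ip d w (next_query s y) < y s)}"

text \<open>The default 1 here, and 0 in \<open>observed\<close>, match those of
  \<open>index_seqs\<close> and of the linear process, so that equalities hold as functions.\<close>

definition winners :: "(nat \<Rightarrow> vec) \<Rightarrow> nat \<Rightarrow> nat" where
  "winners b = (\<lambda>t. if t \<in> {1..T} then I_idx d k A b t else 1)"

definition observed :: "(nat \<Rightarrow> vec) \<Rightarrow> nat \<Rightarrow> real" where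
  "observed b = (\<lambda>t. if t \<in> {1..T} then Y_val d k A b t else 0)"

section \<open>The algorithm as a finite union of linear protocols\<close>

lemma next_query_measurable: "next_query t \<in> seqs \<rightarrow>\<^sub>M Rn d"
proof (cases "t \<in> {2..T}")
  case True
  then have "policy A t \<in> Rn (t - 1) \<rightarrow>\<^sub>M restrict_space (Rn d) (B2 d)"
    using A by (auto simp: A_det_def)
  then have p: "policy A t \<in> Rn (t - 1) \<rightarrow>\<^sub>M Rn d"
    by (rule measurable_restrict_space2_iff[THEN iffD1, THEN conjunct1])
  have "(\<lambda>y. \<lambda>s\<in>{1..t - 1}. y s / sqrt (real d)) \<in> seqs \<rightarrow>\<^sub>M Rn (t - 1)"
    by (intro measurable_restrict_Rn borel_measurable_divide borel_measurable_const measurable_seqs_component)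
  from measurable_compose[OF this p] show ?thesis
    unfolding next_query_def if_P[OF True] .
next
  case False
  have "init A \<in> space (Rn d)" using A by (auto simp: A_det_def B2_def)
  then show ?thesis unfolding next_query_def if_not_P[OF False] by (rule measurable_const)
qed

lemma next_query_causal:
  assumes "\<And>s. s < t \<Longrightarrow> y s = y' s"
  shows "next_query t y = next_query t y'"
proof -
  have "(\<lambda>s\<in>{1..t - 1}. y s / sqrt (real d)) = (\<lambda>s\<in>{1..t - 1}. y' s / sqrt (real d))"
    using assms by (intro restrict_ext) auto
  then show ?thesis unfolding next_query_def by simp
qed

lemma protocol: "i \<in> index_seqs \<Longrightarrow> protocol d k next_query i"
proof unfold_locales
  assume "i \<in> index_seqs"
  then have "t \<in> {1..T} \<Longrightarrow> i t \<in> {1..k}" "t \<notin> {1..T} \<Longrightarrow> i t = 1" for t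
    unfolding index_seqs_def PiE_dflt_def by blast+
  then show "i t \<in> {1..k}" for t using k by (cases "t \<in> {1..T}") auto
qed (rule next_query_measurable, rule next_query_causal)

lemma finite_index_seqs: "finite index_seqs"
  unfolding index_seqs_def by (rule finite_PiE_dflt) auto

lemma card_index_seqs: "card index_seqs = k ^ T"
  unfolding index_seqs_def by (subst card_PiE_dflt) auto

lemma f_Xi_eq: "f_Xi d k b x = Max ((\<lambda>i. ip d (b i) x) ` {1..k}) / sqrt (real d)"
proof -
  have "f_Xi d k b x = Max ((\<lambda>y. y / sqrt (real d)) ` (\<lambda>i. ip d (b i) x) ` {1..k})"
    unfolding f_Xi_def a_vec_def image_image ip_lin ..
  also have "\<dots> = Max ((\<lambda>i. ip d (b i) x) ` {1..k}) / sqrt (real d)"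
    using k by (intro mono_Max_commute[symmetric] monoI divide_right_mono) auto
  finally show ?thesis .
qed

lemma X_query_eq:
  assumes t: "t \<in> {1..T}" and y: "\<And>s. s \<in> {1..<t} \<Longrightarrow> y s = Y_val d k A b s"
  shows "X_query d k A b t = next_query t y"
proof (cases "t = 1")
  case True
  then show ?thesis by (simp add: X_query_def next_query_def query.simps)
next
  case False
  have "(\<lambda>s\<in>{1..t - 1}. f_Xi d k b (query A (f_Xi d k b) s)) = (\<lambda>s\<in>{1..t - 1}. y s / sqrt (real d))"
  proof (rule restrict_ext)
    fix s assume "s \<in> {1..t - 1}"
    then have "y s = Y_val d k A b s" using t by (intro y) auto
    then show "f_Xi d k b (query A (f_Xi d k b) s) = y s / sqrt (real d)"
      by (simp add: f_Xi_eq Y_val_def X_query_def)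
  qed
  then show ?thesis
    using False t unfolding X_query_def next_query_def by (subst query.simps) auto
qed

lemma I_idx_props:
  shows "I_idx d k A b t \<in> {1..k}" "ip d (b (I_idx d k A b t)) (X_query d k A b t) = Y_val d k A b t"
    "j < I_idx d k A b t \<Longrightarrow> j \<in> {1..k} \<Longrightarrow> ip d (b j) (X_query d k A b t) < Y_val d k A b t"
    "j \<in> {1..k} \<Longrightarrow> ip d (b j) (X_query d k A b t) \<le> Y_val d k A b t"
proof -
  show le: "j \<in> {1..k} \<Longrightarrow> ip d (b j) (X_query d k A b t) \<le> Y_val d k A b t" for j
    unfolding Y_val_def by (intro Max_ge) auto
  have "Y_val d k A b t \<in> (\<lambda>i. ip d (b i) (X_query d k A b t)) ` {1..k}"
    unfolding Y_val_def using k by (intro Max_in) auto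
  then obtain i where i: "i \<in> {1..k} \<and> ip d (b i) (X_query d k A b t) = Y_val d k A b t" by auto
  from LeastI[where P = "\<lambda>i. i \<in> {1..k} \<and> ip d (b i) (X_query d k A b t) = Y_val d k A b t", OF i]
  show "I_idx d k A b t \<in> {1..k}" "ip d (b (I_idx d k A b t)) (X_query d k A b t) = Y_val d k A b t"
    unfolding I_idx_def by auto
  assume j: "j < I_idx d k A b t" "j \<in> {1..k}"
  from not_less_Least[OF j(1)[unfolded I_idx_def]] le[OF j(2)] j(2)
  show "ip d (b j) (X_query d k A b t) < Y_val d k A b t" by auto
qed

lemma winners_in: "winners b \<in> index_seqs"
  using I_idx_props(1) by (auto simp: winners_def index_seqs_def PiE_dflt_def)

lemma X_query_observed: "t \<in> {1..T} \<Longrightarrow> X_query d k A b t = next_query t (observed b)"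
  by (rule X_query_eq) (auto simp: observed_def)

lemma answers_winners: "answers (winners b) b = observed b"
proof -
  interpret protocol d k next_query "winners b" by (rule protocol[OF winners_in])
  show ?thesis unfolding answers_def
  proof (rule Y_unique)
    fix s
    have "observed b s = ip d (b (winners b s)) (next_query s (observed b))" if s: "s \<in> {1..T}"
      using s unfolding X_query_observed[OF s, of b, symmetric] by (simp add: observed_def winners_def I_idx_props(2))
    then show "observed b s = (if s \<in> {1..T} then ip d (b (winners b s)) (next_query s (observed b)) else 0)"
      by (auto simp: observed_def)
  qed
qed

text \<open>The event that i occurs becomes a conjunction over the vectors, expressed through the
  linear process for i. Conversely, by strong induction on time, equal pasts give equal queries, and
  then \<open>below\<close> forces \<open>i s\<close> to be the smallest maximizer.\<close>

lemma winners_iff: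
  assumes i: "i \<in> index_seqs"
  shows "(\<forall>j\<in>{1..k}. b j \<in> below i (answers i b) j) \<longleftrightarrow> i = winners b"
proof
  assume i: "i = winners b"
  have "ip d (b j) (next_query s (observed b)) \<le> observed b s \<and>
      (j < winners b s \<longrightarrow> ip d (b j) (next_query s (observed b)) < observed b s)"
    if j: "j \<in> {1..k}" and s: "s \<in> {1..T}" for j s
    using s I_idx_props(3)[of j b s] I_idx_props(4)[of j b s] j
    unfolding X_query_observed[OF s, of b, symmetric] by (simp add: observed_def winners_def)
  then show "\<forall>j\<in>{1..k}. b j \<in> below i (answers i b) j"
    by (simp add: i answers_winners below_def)
next
  interpret protocol d k next_query i by (rule protocol[OF i])
  define y where "y = answers i b"
  have y: "y s = ip d (b (i s)) (next_query s y)" if "s \<in> {1..T}" for s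
    using Y_component[of T b s] that unfolding y_def answers_def by simp
  assume hit: "\<forall>j\<in>{1..k}. b j \<in> below i (answers i b) j"
  have main: "s \<in> {1..T} \<longrightarrow> y s = Y_val d k A b s \<and> i s = I_idx d k A b s" for s
  proof (induction s rule: less_induct)
    case (less s)
    show ?case
    proof
      assume s: "s \<in> {1..T}"
      have X: "X_query d k A b s = next_query s y"
        by (rule X_query_eq[OF s]) (use less s in auto)
      have le: "ip d (b j) (X_query d k A b s) \<le> y s" "j < i s \<Longrightarrow> ip d (b j) (X_query d k A b s) < y s"
        if "j \<in> {1..k}" for j
        using hit that s unfolding X y_def[symmetric] below_def by auto
      have "y s \<in> (\<lambda>i. ip d (b i) (X_query d k A b s)) ` {1..k}"
        using y[OF s] i_range[of s] X by auto
      then have Ys: "Y_val d k A b s = y s"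
        unfolding Y_val_def using le by (intro Max_eqI) auto
      have "I_idx d k A b s = i s" unfolding I_idx_def Ys
      proof (rule Least_equality)
        show "i s \<in> {1..k} \<and> ip d (b (i s)) (X_query d k A b s) = y s"
          using i_range y[OF s] X by auto
        show "i s \<le> j" if "j \<in> {1..k} \<and> ip d (b j) (X_query d k A b s) = y s" for j
          using le(2)[of j] that by (cases "j < i s") auto
      qed
      with Ys show "y s = Y_val d k A b s \<and> i s = I_idx d k A b s" by simp
    qed
  qed
  show "i = winners b"
  proof
    fix t show "i t = winners b t"
      using main[of t] i by (cases "t \<in> {1..T}") (auto simp: winners_def index_seqs_def PiE_dflt_def)
  qed
qed

lemma prod_indicator_below:
  assumes i: "i \<in> index_seqs"
  shows "(\<Prod>j\<in>{1..k}. indicator (below i (answers i b) j) (b j)) = (if i = winners b then 1 else 0 :: ennreal)"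
proof (cases "i = winners b")
  case True
  then have "\<forall>j\<in>{1..k}. b j \<in> below i (answers i b) j" using winners_iff[OF i] by blast
  then show ?thesis using True by simp
next
  case False
  then obtain j where "j \<in> {1..k}" "b j \<notin> below i (answers i b) j" using winners_iff[OF i] by blast
  then have "(\<Prod>j\<in>{1..k}. indicator (below i (answers i b) j) (b j) :: ennreal) = 0"
    by (intro prod_zero bexI[of _ j]) auto
  then show ?thesis using False by simp
qed

text \<open>Exactly one summand survives. This trades the maximum for a finite sum of linear
  processes.\<close>

lemma sum_index_seqs:
  fixes \<Phi> :: "(nat \<Rightarrow> nat) \<Rightarrow> vec \<Rightarrow> ennreal"
  shows "\<Phi> (winners b) (observed b) =
    (\<Sum>i\<in>index_seqs. (\<Prod>j\<in>{1..k}. indicator (below i (answers i b) j) (b j)) * \<Phi> i (answers i b))"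
proof -
  have "(\<Prod>j\<in>{1..k}. indicator (below i (answers i b) j) (b j)) * \<Phi> i (answers i b) =
      (if i = winners b then \<Phi> (winners b) (observed b) else 0)" if i: "i \<in> index_seqs" for i
    unfolding prod_indicator_below[OF i] using answers_winners by auto
  then show ?thesis using finite_index_seqs winners_in[of b] by simp
qed

lemma measurable_answers: "i \<in> index_seqs \<Longrightarrow> answers i \<in> families d k \<rightarrow>\<^sub>M seqs"
  unfolding answers_def by (rule protocol.measurable_Y[OF protocol])

lemma measurable_indicator_below:
  assumes "f \<in> M \<rightarrow>\<^sub>M seqs" "g \<in> M \<rightarrow>\<^sub>M Rn d"
  shows "(\<lambda>x. indicator (below i (f x) j) (g x) :: ennreal) \<in> borel_measurable M"
proof -
  have ip: "(\<lambda>x. ip d (g x) (next_query s (f x))) \<in> borel_measurable M" for s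
    by (intro borel_measurable_ip measurable_Rn_component[OF assms(2)]
        measurable_Rn_component[OF measurable_compose[OF assms(1) next_query_measurable]])
  have y: "(\<lambda>x. f x s) \<in> borel_measurable M" for s
    by (rule measurable_compose[OF assms(1) measurable_seqs_component])
  have "{x \<in> space M. g x \<in> below i (f x) j} =
      (\<Inter>s\<in>{1..T}. {x \<in> space M. ip d (g x) (next_query s (f x)) \<le> f x s}) \<inter>
      (\<Inter>s\<in>{1..T}. {x \<in> space M. j < i s \<longrightarrow> ip d (g x) (next_query s (f x)) < f x s}) \<inter> space M"
    by (auto simp: below_def)
  also have "\<dots> \<in> sets M"
  proof (cases "T = 0")
    \<comment> \<open>For T = 0 both intersections are over the empty set and the set is the whole
      space.\<close>
    case False
    then show ?thesis
      by (intro sets.Int sets.finite_INT sets.top borel_measurable_le borel_measurable_less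
          sets.sets_Collect_imp sets.sets_Collect_const ip y) auto
  qed simp
  finally have "{x \<in> space M. g x \<in> below i (f x) j} \<in> sets M" .
  then have "indicator {x \<in> space M. g x \<in> below i (f x) j} \<in> borel_measurable M"
    by (rule borel_measurable_indicator)
  then show ?thesis
    by (rule measurable_cong[THEN iffD1, rotated]) (auto simp: indicator_def)
qed


section \<open>The sigma-algebra generated by the transcript\<close>

definition record_of :: "(nat \<Rightarrow> nat) \<Rightarrow> vec \<Rightarrow> nat \<Rightarrow> nat \<times> real \<times> vec" where
  "record_of i y = (\<lambda>s\<in>{1..T}. (i s, y s, next_query s y))"

lemma transcript_eq: "transcript d k T A b = record_of (winners b) (observed b)"
  unfolding transcript_def record_of_def
  by (rule restrict_ext) (simp add: X_query_observed winners_def observed_def)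

lemma measurable_record_of:
  assumes "f \<in> M \<rightarrow>\<^sub>M seqs"
  shows "(\<lambda>x. record_of i (f x)) \<in> M \<rightarrow>\<^sub>M transcript_space d T"
  unfolding record_of_def transcript_space_def
  by (intro measurable_restrict measurable_Pair measurable_const measurable_compose[OF assms next_query_measurable]
      measurable_compose[OF assms measurable_seqs_component]) simp

lemma winners_sets:
  assumes i: "i \<in> index_seqs"
  shows "{b \<in> space (families d k). winners b = i} \<in> sets (families d k)"
proof -
  define p :: "(nat \<Rightarrow> vec) \<Rightarrow> ennreal" where "p b = (\<Prod>j\<in>{1..k}. indicator (below i (answers i b) j) (b j))" for b
  have [measurable]: "p \<in> borel_measurable (families d k)"
    unfolding p_def
    by (intro borel_measurable_prod_ennreal measurable_indicator_below measurable_answers i measurable_component_singleton)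
  have "{b \<in> space (families d k). winners b = i} = {b \<in> space (families d k). p b = 1}"
    unfolding p_def prod_indicator_below[OF i] by auto
  then show ?thesis by simp
qed

text \<open>On each of the finitely many pieces with constant winners, the transcript is a
  measurable function of the linear answers.\<close>

lemma measurable_transcript: "transcript d k T A \<in> families d k \<rightarrow>\<^sub>M transcript_space d T"
proof (rule measurableI)
  fix b :: "nat \<Rightarrow> vec" assume b: "b \<in> space (families d k)"
  have "answers (winners b) \<in> families d k \<rightarrow>\<^sub>M seqs" by (rule measurable_answers[OF winners_in])
  from measurable_space[OF measurable_record_of[OF this] b]
  show "transcript d k T A b \<in> space (transcript_space d T)"
    by (simp add: transcript_eq answers_winners)
next
  fix B assume B: "B \<in> sets (transcript_space d T)"
  have "transcript d k T A -` B \<inter> space (families d k) =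
    (\<Union>i\<in>index_seqs. {b \<in> space (families d k). winners b = i} \<inter>
      ((\<lambda>b. record_of i (answers i b)) -` B \<inter> space (families d k)))"
    using winners_in by (auto simp: transcript_eq answers_winners)
  also have "\<dots> \<in> sets (families d k)"
    using B by (intro sets.finite_UN finite_index_seqs sets.Int winners_sets
        measurable_sets[OF measurable_record_of[OF measurable_answers]])
  finally show "transcript d k T A -` B \<inter> space (families d k) \<in> sets (families d k)" .
qed

lemma transcript_space_range: "transcript d k T A \<in> space (Xi_law d k) \<rightarrow> space (transcript_space d T)"
  using measurable_space[OF measurable_transcript] by auto

lemma subalgebra_G_sigma: "subalgebra (Xi_law d k) (G_sigma d k T A)"
  unfolding subalgebra_def G_sigma_def sets_vimage_algebra2[OF transcript_space_range]
  using measurable_sets[OF measurable_transcript] by auto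

lemma G_sigma_sets:
  assumes "S \<in> sets (G_sigma d k T A)"
  obtains B where "B \<in> sets (transcript_space d T)"
    "\<And>b. b \<in> space (Xi_law d k) \<Longrightarrow> b \<in> S \<longleftrightarrow> record_of (winners b) (observed b) \<in> B"
  using assms unfolding G_sigma_def sets_vimage_algebra2[OF transcript_space_range] transcript_eq[symmetric] by auto

text \<open>Values and indices are decoded from the transcript; as \<open>index_seqs\<close> is
  finite, the dependence on the indices is a finite case distinction.\<close>

lemma measurable_G_sigma:
  fixes \<Psi> :: "(nat \<Rightarrow> nat) \<Rightarrow> vec \<Rightarrow> real"
  assumes \<Psi>: "\<And>i. i \<in> index_seqs \<Longrightarrow> \<Psi> i \<in> borel_measurable seqs"
  shows "(\<lambda>b. \<Psi> (winners b) (observed b)) \<in> borel_measurable (G_sigma d k T A)"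
proof -
  define dec :: "(nat \<Rightarrow> nat \<times> real \<times> vec) \<Rightarrow> vec" where
    "dec \<tau> = (\<lambda>s. if s \<in> {1..T} then fst (snd (\<tau> s)) else 0)" for \<tau>
  define P where "P \<tau> i \<longleftrightarrow> (\<forall>s\<in>{1..T}. fst (\<tau> s) = i s)" for \<tau> :: "nat \<Rightarrow> nat \<times> real \<times> vec" and i :: "nat \<Rightarrow> nat"
  define h where "h \<tau> = (\<Sum>i\<in>index_seqs. if P \<tau> i then \<Psi> i (dec \<tau>) else 0)" for \<tau>
  have comp: "(\<lambda>\<tau>. \<tau> s) \<in> transcript_space d T \<rightarrow>\<^sub>M count_space UNIV \<Otimes>\<^sub>M (borel \<Otimes>\<^sub>M Rn d)" if "s \<in> {1..T}" for s
    unfolding transcript_space_def by (rule measurable_component_singleton[OF that])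
  have dec: "dec \<in> transcript_space d T \<rightarrow>\<^sub>M seqs"
    unfolding dec_def
    by (intro measurable_seqsI measurable_if_const borel_measurable_const
        measurable_compose[OF measurable_compose[OF measurable_compose[OF comp measurable_snd] measurable_fst]]) auto
  have P: "Measurable.pred (transcript_space d T) (\<lambda>\<tau>. P \<tau> i)" for i
    unfolding P_def
  proof (intro pred_intros_finite ballI)
    fix s assume "s \<in> {1..T}"
    from measurable_compose[OF comp[OF this] measurable_fst]
    have "(\<lambda>\<tau>. fst (\<tau> s)) \<in> transcript_space d T \<rightarrow>\<^sub>M count_space UNIV" .
    then show "Measurable.pred (transcript_space d T) (\<lambda>\<tau>. fst (\<tau> s) = i s)"
      by (rule measurable_compose) simp
  qed simp
  have h: "h \<in> borel_measurable (transcript_space d T)"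
    unfolding h_def by (intro borel_measurable_sum measurable_If_set[unfolded Measurable.pred_def] measurable_If P[unfolded Measurable.pred_def]
        measurable_compose[OF dec \<Psi>] borel_measurable_const) (use P in \<open>auto simp: Measurable.pred_def\<close>)
  have hT: "h (transcript d k T A b) = \<Psi> (winners b) (observed b)" for b
  proof -
    have "P (transcript d k T A b) i \<longleftrightarrow> i = winners b" if "i \<in> index_seqs" for i
    proof
      assume "P (transcript d k T A b) i"
      then have "i s = winners b s" if "s \<in> {1..T}" for s
        using that by (auto simp: P_def transcript_eq record_of_def)
      moreover have "i s = winners b s" if "s \<notin> {1..T}" for s
        using that \<open>i \<in> index_seqs\<close> unfolding winners_def index_seqs_def PiE_dflt_def by auto
      ultimately show "i = winners b" by blast
    qed (simp add: P_def transcript_eq record_of_def)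
    then have "h (transcript d k T A b) =
        (\<Sum>i\<in>index_seqs. if i = winners b then \<Psi> (winners b) (dec (transcript d k T A b)) else 0)"
      unfolding h_def by (intro sum.cong) auto
    moreover have "dec (transcript d k T A b) = observed b"
      by (auto simp: dec_def transcript_eq record_of_def observed_def fun_eq_iff)
    ultimately show ?thesis using finite_index_seqs winners_in by simp
  qed
  have "transcript d k T A \<in> G_sigma d k T A \<rightarrow>\<^sub>M transcript_space d T"
    unfolding G_sigma_def by (rule measurable_vimage_algebra1[OF transcript_space_range])
  from measurable_compose[OF this h] show ?thesis unfolding hT .
qed

lemma borel_measurable_winners_observed:
  fixes \<Phi> :: "(nat \<Rightarrow> nat) \<Rightarrow> vec \<Rightarrow> ennreal"
  assumes \<Phi>: "\<And>i. i \<in> index_seqs \<Longrightarrow> \<Phi> i \<in> borel_measurable seqs"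
  shows "(\<lambda>b. \<Phi> (winners b) (observed b)) \<in> borel_measurable (families d k)"
  unfolding sum_index_seqs
  by (intro borel_measurable_sum borel_measurable_times_ennreal borel_measurable_prod_ennreal
      measurable_indicator_below measurable_answers measurable_component_singleton
      measurable_compose[OF measurable_answers \<Phi>])

section \<open>Bayes' formula for the posterior means\<close>

abbreviation posterior_vec :: "(nat \<Rightarrow> nat) \<Rightarrow> nat \<Rightarrow> vec \<Rightarrow> vec \<Rightarrow> vec" where
  "posterior_vec i \<equiv> protocol.theta1 d next_query i T"

text \<open>The unnormalised posterior integral of f for one vector: its Gaussian law given the
  linear answers, reweighted by the truncation and by its own part of the event that i
  occurs.\<close>

definition post_weight :: "(nat \<Rightarrow> nat) \<Rightarrow> nat \<Rightarrow> vec \<Rightarrow> (vec \<Rightarrow> ennreal) \<Rightarrow> ennreal" where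
  "post_weight i j y f = (\<integral>\<^sup>+ w. tr_density d (posterior_vec i j y w) *
      indicator (below i y j) (posterior_vec i j y w) * f (posterior_vec i j y w) \<partial>std_gaussian d)"

lemma measurable_posterior_vec:
  assumes "i \<in> index_seqs" "f \<in> M \<rightarrow>\<^sub>M seqs" "g \<in> M \<rightarrow>\<^sub>M Rn d"
  shows "(\<lambda>x. posterior_vec i j (f x) (g x)) \<in> M \<rightarrow>\<^sub>M Rn d"
  by (rule protocol.measurable_theta1[OF protocol[OF assms(1)] assms(2,3)])

lemma measurable_post_weight:
  assumes i: "i \<in> index_seqs" and f: "f \<in> borel_measurable (Rn d)"
  shows "(\<lambda>y. post_weight i j y f) \<in> borel_measurable seqs"
proof -
  have th: "(\<lambda>x. posterior_vec i j (fst x) (snd x)) \<in> seqs \<Otimes>\<^sub>M std_gaussian d \<rightarrow>\<^sub>M Rn d"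
    by (intro measurable_posterior_vec i measurable_fst) simp
  show ?thesis
    unfolding post_weight_def
    by (intro std_gaussian.borel_measurable_nn_integral, unfold split_beta')
       (intro borel_measurable_times_ennreal measurable_compose[OF th f] measurable_compose[OF th tr_density_measurable]
         measurable_indicator_below measurable_fst th)
qed

text \<open>Truncation density and event indicator both factor over the vectors, so after splitting
  by index sequence each factor integrates to its own \<open>post_weight\<close>.\<close>

lemma nn_integral_Xi_law_decompose:
  fixes G :: "(nat \<Rightarrow> nat) \<Rightarrow> vec \<Rightarrow> ennreal"
  assumes G: "\<And>i. i \<in> index_seqs \<Longrightarrow> G i \<in> borel_measurable seqs"
    and v: "\<And>j. j \<in> {1..k} \<Longrightarrow> v j \<in> borel_measurable (Rn d)"
  shows "(\<integral>\<^sup>+ b. G (winners b) (observed b) * (\<Prod>j\<in>{1..k}. v j (b j)) \<partial>Xi_law d k) =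
    (\<Sum>i\<in>index_seqs. \<integral>\<^sup>+ b. G i (answers i b) * (\<Prod>j\<in>{1..k}. post_weight i j (answers i b) (v j)) \<partial>gauss_fam d k)"
proof -
  define \<omega> where "\<omega> i j y w = tr_density d w * indicator (below i y j) w * v j w" for i j y w
  have m\<omega>: "case_prod (\<omega> i j) \<in> borel_measurable (seqs \<Otimes>\<^sub>M Rn d)" if "j \<in> {1..k}" for i j
    unfolding \<omega>_def split_beta'
    by (intro borel_measurable_times_ennreal measurable_compose[OF measurable_snd tr_density_measurable]
        measurable_compose[OF measurable_snd v[OF that]] measurable_indicator_below measurable_fst measurable_snd)
  have m: "(\<lambda>b. G i (answers i b) * (\<Prod>j\<in>{1..k}. \<omega> i j (answers i b) (b j))) \<in> borel_measurable (families d k)"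
    if i: "i \<in> index_seqs" for i
    by (intro borel_measurable_times_ennreal borel_measurable_prod_ennreal measurable_compose[OF measurable_answers[OF i] G[OF i]]
        measurable_compose2[OF m\<omega>] measurable_answers[OF i] measurable_component_singleton)
  have "(\<integral>\<^sup>+ b. G (winners b) (observed b) * (\<Prod>j\<in>{1..k}. v j (b j)) \<partial>Xi_law d k) =
      (\<integral>\<^sup>+ b. (\<Prod>j\<in>{1..k}. tr_density d (b j)) * (G (winners b) (observed b) * (\<Prod>j\<in>{1..k}. v j (b j))) \<partial>gauss_fam d k)"
    by (intro nn_integral_Xi_law d borel_measurable_times_ennreal borel_measurable_prod_ennreal
        borel_measurable_winners_observed G measurable_compose[OF _ v] measurable_component_singleton)
  also have "\<dots> = (\<integral>\<^sup>+ b. (\<Sum>i\<in>index_seqs. G i (answers i b) * (\<Prod>j\<in>{1..k}. \<omega> i j (answers i b) (b j))) \<partial>gauss_fam d k)"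
  proof (rule nn_integral_cong)
    fix b
    show "(\<Prod>j\<in>{1..k}. tr_density d (b j)) * (G (winners b) (observed b) * (\<Prod>j\<in>{1..k}. v j (b j))) =
      (\<Sum>i\<in>index_seqs. G i (answers i b) * (\<Prod>j\<in>{1..k}. \<omega> i j (answers i b) (b j)))"
      unfolding sum_index_seqs[of "\<lambda>i y. (\<Prod>j\<in>{1..k}. tr_density d (b j)) * (G i y * (\<Prod>j\<in>{1..k}. v j (b j)))" b]
      by (intro sum.cong refl) (simp add: \<omega>_def prod.distrib ac_simps)
  qed
  also have "\<dots> = (\<Sum>i\<in>index_seqs. \<integral>\<^sup>+ b. G i (answers i b) * (\<Prod>j\<in>{1..k}. \<omega> i j (answers i b) (b j)) \<partial>gauss_fam d k)"
    by (rule nn_integral_sum) (simp only: measurable_cong_sets[OF sets_gauss_fam refl] m)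
  also have "\<dots> = (\<Sum>i\<in>index_seqs. \<integral>\<^sup>+ b. G i (answers i b) * (\<Prod>j\<in>{1..k}. post_weight i j (answers i b) (v j)) \<partial>gauss_fam d k)"
    unfolding answers_def post_weight_def \<omega>_def[symmetric]
    by (intro sum.cong refl protocol.nn_integral_resample_prod[OF protocol] G m\<omega>)
  finally show ?thesis .
qed

text \<open>Adding \<open>L\<close> makes the coordinates nonnegative on \<open>tr_ball d\<close>, so that nonnegative integrals suffice.\<close>

abbreviation L :: real where
  "L \<equiv> 2 * sqrt (real d)"

text \<open>Where the total weight is 0, the quotient is 0 by convention.\<close>

definition post :: "nat \<Rightarrow> nat \<Rightarrow> (nat \<Rightarrow> nat) \<Rightarrow> vec \<Rightarrow> real" where
  "post q r i y = enn2real (post_weight i q y (\<lambda>w. ennreal (w r + L)) / post_weight i q y (\<lambda>_. 1))"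

lemma measurable_post:
  assumes "r \<in> {1..d}" "i \<in> index_seqs"
  shows "post q r i \<in> borel_measurable seqs"
proof -
  have "(\<lambda>w. ennreal (w r + L)) \<in> borel_measurable (Rn d)"
    by (intro measurable_compose[OF _ measurable_ennreal] borel_measurable_add measurable_component_Rn assms(1) borel_measurable_const)
  then show ?thesis
    unfolding post_def
    by (intro borel_measurable_enn2real borel_measurable_divide_ennreal measurable_post_weight assms(2)) simp_all
qed

lemma post_weight_le:
  assumes "i \<in> index_seqs" "r \<in> {1..d}"
  shows "post_weight i q y (\<lambda>_. 1) \<le> 2"
    "post_weight i q y (\<lambda>w. ennreal (w r + L)) \<le> ennreal (2 * L) * post_weight i q y (\<lambda>_. 1)"
proof -
  have th: "posterior_vec i q y \<in> std_gaussian d \<rightarrow>\<^sub>M Rn d"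
    by (intro measurable_posterior_vec assms(1) measurable_const) (simp_all add: space_PiM)
  have "post_weight i q y (\<lambda>_. 1) \<le> (\<integral>\<^sup>+ w. 2 \<partial>std_gaussian d)"
    unfolding post_weight_def using tr_density_le[OF d]
    by (intro nn_integral_mono) (auto simp: indicator_def)
  then show "post_weight i q y (\<lambda>_. 1) \<le> 2"
    by (simp add: std_gaussian.emeasure_space_1[unfolded space_std_gaussian])
  have "tr_density d x * c * ennreal (x r + L) \<le> ennreal (2 * L) * (tr_density d x * c * 1)" for x c
  proof (cases "x \<in> tr_ball d")
    case True
    then have "ennreal (x r + L) \<le> ennreal (2 * L)"
      using tr_ball_component[OF True assms(2)] by (intro ennreal_leI) simp
    then show ?thesis by (simp add: mult.commute mult_left_mono)
  qed (simp add: tr_density_def)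
  then have "post_weight i q y (\<lambda>w. ennreal (w r + L)) \<le>
      (\<integral>\<^sup>+ w. ennreal (2 * L) * (tr_density d (posterior_vec i q y w) *
      indicator (below i y q) (posterior_vec i q y w) * 1) \<partial>std_gaussian d)"
    unfolding post_weight_def by (intro nn_integral_mono)
  also have "\<dots> = ennreal (2 * L) * post_weight i q y (\<lambda>_. 1)"
    unfolding post_weight_def
    by (intro nn_integral_cmult borel_measurable_times_ennreal measurable_compose[OF th tr_density_measurable]
         measurable_indicator_below th borel_measurable_const measurable_const) (simp_all add: space_PiM)
  finally show "post_weight i q y (\<lambda>w. ennreal (w r + L)) \<le> ennreal (2 * L) * post_weight i q y (\<lambda>_. 1)" .
qed

text \<open>The bounds in \<open>post_weight_le\<close> keep the quotient finite and make the
  numerator vanish with the denominator, so it can be multiplied back even at weight 0.\<close>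

lemma post_props:
  assumes "i \<in> index_seqs" "r \<in> {1..d}"
  shows "ennreal (post q r i y) * post_weight i q y (\<lambda>_. 1) = post_weight i q y (\<lambda>w. ennreal (w r + L))"
    "0 \<le> post q r i y" "post q r i y \<le> 2 * L"
proof -
  define D where "D = post_weight i q y (\<lambda>_. 1)"
  define N where "N = post_weight i q y (\<lambda>w. ennreal (w r + L))"
  have D2: "D \<le> 2" and ND: "N \<le> ennreal (2 * L) * D"
    unfolding D_def N_def using post_weight_le[OF assms] by auto
  have Dtop: "D < \<top>" using D2 by (rule le_less_trans) simp
  have le: "N / D \<le> ennreal (2 * L)"
  proof (cases "D = 0")
    case True
    then show ?thesis using ND by simp
  next
    case False
    have "N / D \<le> ennreal (2 * L) * D / D" by (rule divide_right_mono_ennreal[OF ND])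
    also have "\<dots> = ennreal (2 * L)" using False Dtop by (simp add: ennreal_mult_divide_eq)
    finally show ?thesis .
  qed
  have fin: "N / D < \<top>" using le by (rule le_less_trans) simp
  have "ennreal (enn2real (N / D)) * D = N"
  proof (cases "D = 0")
    case True
    then show ?thesis using ND by simp
  next
    case False
    then show ?thesis using fin Dtop by (simp add: ennreal_divide_times ennreal_mult_divide_eq)
  qed
  then show "ennreal (post q r i y) * post_weight i q y (\<lambda>_. 1) = post_weight i q y (\<lambda>w. ennreal (w r + L))"
    unfolding post_def N_def[symmetric] D_def[symmetric] .
  show "0 \<le> post q r i y" by (simp add: post_def)
  show "post q r i y \<le> 2 * L"
    unfolding post_def N_def[symmetric] D_def[symmetric] using le by (intro enn2real_leI) auto
qed

text \<open>This says that \<open>post q\<close> is the posterior mean (shifted by \<open>L\<close>) and also that, given the transcript,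
  the vector with index \<open>q\<close> is independent of the others.\<close>

lemma nn_integral_post:
  fixes G :: "(nat \<Rightarrow> nat) \<Rightarrow> vec \<Rightarrow> ennreal"
  assumes q: "q \<in> {1..k}" and r: "r \<in> {1..d}"
    and G: "\<And>i. i \<in> index_seqs \<Longrightarrow> G i \<in> borel_measurable seqs"
    and v: "\<And>j. j \<in> {1..k} \<Longrightarrow> v j \<in> borel_measurable (Rn d)"
  shows "(\<integral>\<^sup>+ b. G (winners b) (observed b) * (ennreal (b q r + L) * (\<Prod>j\<in>{1..k} - {q}. v j (b j))) \<partial>Xi_law d k) =
    (\<integral>\<^sup>+ b. G (winners b) (observed b) * (ennreal (post q r (winners b) (observed b)) * (\<Prod>j\<in>{1..k} - {q}. v j (b j))) \<partial>Xi_law d k)"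
proof -
  have f: "(\<lambda>w. ennreal (w r + L)) \<in> borel_measurable (Rn d)"
    by (intro measurable_compose[OF _ measurable_ennreal] borel_measurable_add measurable_component_Rn r borel_measurable_const)
  have split: "(\<Prod>j\<in>{1..k}. F (if j = q then a else v j) j) = F a q * (\<Prod>j\<in>{1..k} - {q}. F (v j) j)"
    for F :: "(vec \<Rightarrow> ennreal) \<Rightarrow> nat \<Rightarrow> ennreal" and a
    using q by (subst prod.remove[of _ q]) (auto intro!: prod.cong arg_cong2[where f = "(*)"])
  have vm: "(if j = q then a else v j) \<in> borel_measurable (Rn d)" if "a \<in> borel_measurable (Rn d)" "j \<in> {1..k}" for a j
    using that v by auto
  have "(\<integral>\<^sup>+ b. G (winners b) (observed b) * (ennreal (b q r + L) * (\<Prod>j\<in>{1..k} - {q}. v j (b j))) \<partial>Xi_law d k) =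
    (\<integral>\<^sup>+ b. G (winners b) (observed b) * (\<Prod>j\<in>{1..k}. (if j = q then \<lambda>w. ennreal (w r + L) else v j) (b j)) \<partial>Xi_law d k)"
    by (simp only: split[of "\<lambda>f j. f (b j)" for b])
  also have "\<dots> = (\<Sum>i\<in>index_seqs. \<integral>\<^sup>+ b. G i (answers i b) *
      (\<Prod>j\<in>{1..k}. post_weight i j (answers i b) (if j = q then \<lambda>w. ennreal (w r + L) else v j)) \<partial>gauss_fam d k)"
    by (intro nn_integral_Xi_law_decompose G vm f)
  \<comment> \<open>The numerator for q is \<open>post\<close> times the weight of the constant 1.
    Since \<open>post\<close> depends on the observations only, it joins \<open>G\<close>, and the
    decomposition is then read backwards.\<close>
  also have "\<dots> = (\<Sum>i\<in>index_seqs. \<integral>\<^sup>+ b. (G i (answers i b) * ennreal (post q r i (answers i b))) *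
      (\<Prod>j\<in>{1..k}. post_weight i j (answers i b) (if j = q then \<lambda>w. 1 else v j)) \<partial>gauss_fam d k)"
    by (intro sum.cong refl nn_integral_cong)
       (simp add: split[of "\<lambda>f j. post_weight i j (answers i b) f" for i b] post_props(1)[OF _ r, symmetric] mult.assoc)
  also have "\<dots> = (\<integral>\<^sup>+ b. (G (winners b) (observed b) * ennreal (post q r (winners b) (observed b))) *
      (\<Prod>j\<in>{1..k}. (if j = q then \<lambda>w. 1 else v j) (b j)) \<partial>Xi_law d k)"
    by (intro nn_integral_Xi_law_decompose[where G = "\<lambda>i y. G i y * ennreal (post q r i y)", symmetric] vm
        borel_measurable_times_ennreal G measurable_compose[OF measurable_post measurable_ennreal] r) simp_all
  also have "\<dots> = (\<integral>\<^sup>+ b. G (winners b) (observed b) * (ennreal (post q r (winners b) (observed b)) * (\<Prod>j\<in>{1..k} - {q}. v j (b j))) \<partial>Xi_law d k)"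
    by (simp only: split[of "\<lambda>f j. f (b j)" for b] mult_1 mult.assoc)
  finally show ?thesis .
qed

end

section \<open>The energy bound\<close>

lemma integral_eqI_nn_integral:
  fixes f g :: "'a \<Rightarrow> real"
  assumes "f \<in> borel_measurable M" "g \<in> borel_measurable M" "AE x in M. 0 \<le> f x" "AE x in M. 0 \<le> g x"
    "(\<integral>\<^sup>+ x. ennreal (f x) \<partial>M) = (\<integral>\<^sup>+ x. ennreal (g x) \<partial>M)"
  shows "(\<integral>x. f x \<partial>M) = (\<integral>x. g x \<partial>M)"
  using assms by (simp add: integral_eq_nn_integral)

text \<open>Jensen's inequality for the exponential, by its tangent at \<open>ln a\<close>.\<close>

lemma (in prob_space) integral_le_ln:
  fixes Z :: "'a \<Rightarrow> real"
  assumes "integrable M Z" "a > 0" "(\<integral>\<^sup>+ x. ennreal (exp (Z x)) \<partial>M) \<le> ennreal a"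
  shows "(\<integral>x. Z x \<partial>M) \<le> ln a"
proof -
  have [measurable]: "Z \<in> borel_measurable M" using assms(1) by simp
  have int: "integrable M (\<lambda>x. exp (Z x))"
    using assms(3) by (intro integrableI_bounded) (auto intro: le_less_trans)
  then have "ennreal (\<integral>x. exp (Z x) \<partial>M) \<le> ennreal a"
    using assms(3) by (subst (asm) nn_integral_eq_integral) auto
  then have le: "(\<integral>x. exp (Z x) \<partial>M) \<le> a" using assms(2) by (subst (asm) ennreal_le_iff) auto
  have "(\<integral>x. Z x \<partial>M) \<le> (\<integral>x. (ln a - 1) + exp (Z x) / a \<partial>M)"
  proof (intro integral_mono assms(1))
    show "integrable M (\<lambda>x. (ln a - 1) + exp (Z x) / a)" using int by auto
    show "Z x \<le> (ln a - 1) + exp (Z x) / a" for x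
      using exp_ge_add_one_self[of "Z x - ln a"] assms(2) by (simp add: exp_diff)
  qed
  also have "\<dots> = (ln a - 1) + (\<integral>x. exp (Z x) \<partial>M) / a"
    using int by (simp add: prob_space)
  also have "\<dots> \<le> ln a" using le assms(2) by simp
  finally show ?thesis .
qed

section \<open>Posterior means as conditional expectations\<close>

context algorithm
begin

interpretation Xi: prob_space "Xi_law d k"
  by (rule prob_space_Xi_law[OF d])

interpretation Xi: finite_measure_subalgebra "Xi_law d k" "G_sigma d k T A"
  by unfold_locales (rule subalgebra_G_sigma)

definition mean :: "nat \<Rightarrow> nat \<Rightarrow> (nat \<Rightarrow> vec) \<Rightarrow> real" where
  "mean q r b = post q r (winners b) (observed b) - L"

lemma mean_measurable_G: "r \<in> {1..d} \<Longrightarrow> mean q r \<in> borel_measurable (G_sigma d k T A)"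
  unfolding mean_def
  by (intro measurable_G_sigma[where \<Psi> = "\<lambda>i y. post q r i y - L"] borel_measurable_diff measurable_post borel_measurable_const)

lemma mean_measurable: "r \<in> {1..d} \<Longrightarrow> mean q r \<in> borel_measurable (Xi_law d k)"
  by (rule measurable_from_subalg[OF subalgebra_G_sigma mean_measurable_G])

lemma mean_bound: "r \<in> {1..d} \<Longrightarrow> \<bar>mean q r b\<bar> \<le> L"
  unfolding mean_def using post_props(2,3)[OF winners_in, of r q b "observed b"] by (simp add: abs_le_iff)

lemma component_measurable:
  assumes "q \<in> {1..k}" "r \<in> {1..d}"
  shows "(\<lambda>b. b q r) \<in> borel_measurable (Xi_law d k)"
  unfolding measurable_cong_sets[OF sets_Xi_law refl]
  by (intro measurable_Rn_component[of _ _ d] measurable_component_singleton assms)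

lemma component_bound:
  assumes "q \<in> {1..k}" "r \<in> {1..d}"
  shows "AE b in Xi_law d k. \<bar>b q r\<bar> \<le> L"
  using AE_Xi_law[OF d] by eventually_elim (use assms tr_ball_component in auto)

lemma integrable_mult_bounded:
  fixes f g :: "(nat \<Rightarrow> vec) \<Rightarrow> real"
  assumes "f \<in> borel_measurable (Xi_law d k)" "g \<in> borel_measurable (Xi_law d k)"
    and "AE b in Xi_law d k. \<bar>f b\<bar> \<le> B" "AE b in Xi_law d k. \<bar>g b\<bar> \<le> C"
  shows "integrable (Xi_law d k) (\<lambda>b. f b * g b)"
proof (rule Xi.integrable_const_bound)
  show "AE b in Xi_law d k. norm (f b * g b) \<le> B * C"
    using assms(3,4) by eventually_elim (auto simp: abs_mult intro!: mult_mono order_trans[OF abs_ge_zero])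
qed (use assms in measurable)

lemma integrable_component: "q \<in> {1..k} \<Longrightarrow> r \<in> {1..d} \<Longrightarrow> integrable (Xi_law d k) (\<lambda>b. b q r)"
  using component_bound by (intro Xi.integrable_const_bound[of _ L] component_measurable) auto

lemma integrable_mean: "r \<in> {1..d} \<Longrightarrow> integrable (Xi_law d k) (mean q r)"
  using mean_bound by (intro Xi.integrable_const_bound[of _ L] mean_measurable) auto

lemma integrable_component_mean:
  "p \<in> {1..k} \<Longrightarrow> r \<in> {1..d} \<Longrightarrow> r' \<in> {1..d} \<Longrightarrow> integrable (Xi_law d k) (\<lambda>b. b p r * mean q r' b)"
  using mean_bound by (intro integrable_mult_bounded[OF component_measurable mean_measurable component_bound]) auto

lemma integrable_mean_mean:
  "r \<in> {1..d} \<Longrightarrow> integrable (Xi_law d k) (\<lambda>b. mean p r b * mean q r b)"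
  using mean_bound by (intro integrable_mult_bounded[OF mean_measurable mean_measurable]) auto

lemma integral_component:
  assumes "q \<in> {1..k}" "r \<in> {1..d}"
  shows "(\<integral>b. b q r \<partial>Xi_law d k) = 0"
proof -
  have f: "(\<lambda>w. ennreal (w r + L)) \<in> borel_measurable (gamma_tr d)"
    unfolding measurable_cong_sets[OF sets_gamma_tr refl]
    by (intro measurable_compose[OF _ measurable_ennreal] borel_measurable_add measurable_component_Rn assms borel_measurable_const)
  have "(\<integral>\<^sup>+ b. ennreal (b q r + L) \<partial>Xi_law d k) = (\<integral>\<^sup>+ w. ennreal (w r + L) \<partial>distr (Xi_law d k) (gamma_tr d) (\<lambda>b. b q))"
    using f assms(1) by (intro nn_integral_distr[symmetric]) (auto simp: Xi_law_def)
  also have "distr (Xi_law d k) (gamma_tr d) (\<lambda>b. b q) = gamma_tr d"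
    unfolding Xi_law_def by (intro distr_PiM_component prob_space_gamma_tr d assms)
  also have "(\<integral>\<^sup>+ w. ennreal (w r + L) \<partial>gamma_tr d) = (\<integral>\<^sup>+ b. ennreal L \<partial>Xi_law d k)"
    using Xi.emeasure_space_1 by (simp add: nn_integral_gamma_tr_component[OF d assms(2)])
  finally have "(\<integral>b. b q r + L \<partial>Xi_law d k) = (\<integral>b. L \<partial>Xi_law d k)"
    using component_bound[OF assms] by (intro integral_eqI_nn_integral borel_measurable_add component_measurable assms) auto
  then show ?thesis
    using integrable_component[OF assms] by (simp add: Xi.prob_space)
qed

text \<open>A set of the sigma-algebra is a preimage under the transcript, so its indicator is an
  admissible \<open>G\<close> in \<open>nn_integral_post\<close>; with all other factors 1 this is
  the defining identity, and the shift by \<open>L\<close> cancels.\<close>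

lemma cond_exp_component:
  assumes q: "q \<in> {1..k}" and r: "r \<in> {1..d}"
  shows "AE b in Xi_law d k. real_cond_exp (Xi_law d k) (G_sigma d k T A) (\<lambda>b. b q r) b = mean q r b"
proof (rule Xi.real_cond_exp_charact)
  show "integrable (Xi_law d k) (\<lambda>b. b q r)" "integrable (Xi_law d k) (mean q r)"
    by (intro integrable_component integrable_mean assms)+
  show "mean q r \<in> borel_measurable (G_sigma d k T A)" by (rule mean_measurable_G[OF r])
  fix S assume S: "S \<in> sets (G_sigma d k T A)"
  then have SM: "S \<in> sets (Xi_law d k)" using subalgebra_G_sigma by (auto simp: subalgebra_def)
  obtain B where B: "B \<in> sets (transcript_space d T)"
    and SB: "\<And>b. b \<in> space (Xi_law d k) \<Longrightarrow> b \<in> S \<longleftrightarrow> record_of (winners b) (observed b) \<in> B"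
    using G_sigma_sets[OF S] by blast
  define G :: "(nat \<Rightarrow> nat) \<Rightarrow> vec \<Rightarrow> ennreal" where "G i y = indicator B (record_of i y)" for i y
  have G: "G i \<in> borel_measurable seqs" for i
    unfolding G_def by (intro measurable_compose[OF measurable_record_of borel_measurable_indicator[OF B]]) simp
  have ind: "ennreal (indicator S b * x) = G (winners b) (observed b) * (ennreal x * 1)" if "b \<in> space (Xi_law d k)" for b x
    using SB[OF that] by (simp add: G_def indicator_def)
  have [measurable]: "(\<lambda>b. b q r) \<in> borel_measurable (Xi_law d k)" "mean q r \<in> borel_measurable (Xi_law d k)"
    by (intro component_measurable mean_measurable assms)+
  have "(\<integral>b. indicator S b * (b q r + L) \<partial>Xi_law d k) = (\<integral>b. indicator S b * (mean q r b + L) \<partial>Xi_law d k)"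
  proof (rule integral_eqI_nn_integral)
    show "AE b in Xi_law d k. 0 \<le> indicator S b * (b q r + L)"
      using component_bound[OF assms] by eventually_elim auto
    show "AE b in Xi_law d k. 0 \<le> indicator S b * (mean q r b + L)"
      using post_props(2)[OF winners_in r] by (simp add: mean_def)
    have "(\<integral>\<^sup>+ b. ennreal (indicator S b * (b q r + L)) \<partial>Xi_law d k) =
        (\<integral>\<^sup>+ b. G (winners b) (observed b) * (ennreal (b q r + L) * (\<Prod>j\<in>{1..k} - {q}. 1)) \<partial>Xi_law d k)"
      by (intro nn_integral_cong) (simp only: ind prod.neutral_const)
    also have "\<dots> = (\<integral>\<^sup>+ b. G (winners b) (observed b) * (ennreal (post q r (winners b) (observed b)) * (\<Prod>j\<in>{1..k} - {q}. 1)) \<partial>Xi_law d k)"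
      by (rule nn_integral_post[where v = "\<lambda>_ _. 1", OF q r G]) simp_all
    also have "\<dots> = (\<integral>\<^sup>+ b. ennreal (indicator S b * (mean q r b + L)) \<partial>Xi_law d k)"
      by (intro nn_integral_cong) (simp add: ind mean_def)
    finally show "(\<integral>\<^sup>+ b. ennreal (indicator S b * (b q r + L)) \<partial>Xi_law d k) =
        (\<integral>\<^sup>+ b. ennreal (indicator S b * (mean q r b + L)) \<partial>Xi_law d k)" .
  qed (use SM in measurable)
  moreover have "integrable (Xi_law d k) (\<lambda>b. indicator S b * f b)" if "integrable (Xi_law d k) f" for f :: "_ \<Rightarrow> real"
    using integrable_mult_indicator[OF SM that] by simp
  note this[OF integrable_component[OF assms]] this[OF integrable_mean[OF r, of q]] this[of "\<lambda>_. L", simplified]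
  ultimately show "(\<integral>b\<in>S. b q r \<partial>Xi_law d k) = (\<integral>b\<in>S. mean q r b \<partial>Xi_law d k)"
    unfolding set_lebesgue_integral_def by (simp add: distrib_left)
qed

lemma integral_mean:
  assumes "q \<in> {1..k}" "r \<in> {1..d}"
  shows "(\<integral>b. mean q r b \<partial>Xi_law d k) = 0"
proof -
  have "(\<integral>b. real_cond_exp (Xi_law d k) (G_sigma d k T A) (\<lambda>b. b q r) b \<partial>Xi_law d k) = (\<integral>b. mean q r b \<partial>Xi_law d k)"
    by (rule integral_cong_AE[OF borel_measurable_cond_exp2 mean_measurable[OF assms(2)] cond_exp_component[OF assms]])
  then show ?thesis
    using Xi.real_cond_exp_int(2)[OF integrable_component[OF assms]] integral_component[OF assms] by simp
qed

text \<open>The mean for q is measurable for the transcript, so conditioning replaces b p by its own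
  mean. The case p = q gives the energy, the case of distinct indices the cross terms.\<close>

lemma integral_component_mean_eq:
  assumes p: "p \<in> {1..k}" and r: "r \<in> {1..d}"
  shows "(\<integral>b. b p r * mean q r b \<partial>Xi_law d k) = (\<integral>b. mean p r b * mean q r b \<partial>Xi_law d k)"
proof -
  have "(\<integral>b. b p r * mean q r b \<partial>Xi_law d k) =
      (\<integral>b. mean q r b * real_cond_exp (Xi_law d k) (G_sigma d k T A) (\<lambda>b. b p r) b \<partial>Xi_law d k)"
    using Xi.real_cond_exp_intg(2)[of "mean q r" "\<lambda>b. b p r"] integrable_component_mean[OF p r r, of q]
      mean_measurable_G[OF r, of q] component_measurable[OF p r] by (simp add: mult.commute)
  also have "\<dots> = (\<integral>b. mean p r b * mean q r b \<partial>Xi_law d k)"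
  proof (intro integral_cong_AE borel_measurable_times mean_measurable r borel_measurable_cond_exp2)
    show "AE b in Xi_law d k. mean q r b * real_cond_exp (Xi_law d k) (G_sigma d k T A) (\<lambda>b. b p r) b =
        mean p r b * mean q r b"
      using cond_exp_component[OF p r] by eventually_elim simp
  qed
  finally show ?thesis .
qed

text \<open>Conditional independence given the transcript makes the posterior means uncorrelated.\<close>

lemma integral_mean_mean:
  assumes p: "p \<in> {1..k}" and q: "q \<in> {1..k}" and r: "r \<in> {1..d}" and pq: "p \<noteq> q"
  shows "(\<integral>b. mean p r b * mean q r b \<partial>Xi_law d k) = 0"
proof -
  interpret g: prob_space "gamma_tr d" by (rule prob_space_gamma_tr[OF d])
  interpret PiM: product_sigma_finite "\<lambda>_ :: nat. gamma_tr d" by unfold_locales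
  have [measurable]: "(\<lambda>b. b q r) \<in> borel_measurable (Xi_law d k)" "(\<lambda>b. b p r) \<in> borel_measurable (Xi_law d k)"
    "mean q r \<in> borel_measurable (Xi_law d k)"
    by (intro component_measurable mean_measurable assms)+
  define f where "f w = ennreal (w r + L)" for w :: vec
  have f: "f \<in> borel_measurable (Rn d)"
    unfolding f_def
    by (intro measurable_compose[OF _ measurable_ennreal] borel_measurable_add measurable_component_Rn r borel_measurable_const)
  define v where "v j = (if j = p then f else (\<lambda>_. 1))" for j
  have v: "v j \<in> borel_measurable (Rn d)" for j unfolding v_def using f by simp
  have vp: "(\<Prod>j\<in>{1..k} - {q}. v j (b j)) = f (b p)" for b
  proof -
    have "(\<Prod>j\<in>{1..k} - {q}. v j (b j)) = (\<Prod>j\<in>{1..k} - {q}. if j = p then f (b p) else 1)"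
      by (intro prod.cong) (auto simp: v_def)
    then show ?thesis using p pq by simp
  qed
  have nn: "(\<integral>\<^sup>+ b. 1 * (ennreal (b q r + L) * f (b p)) \<partial>Xi_law d k) =
      (\<integral>\<^sup>+ b. 1 * (ennreal (post q r (winners b) (observed b)) * f (b p)) \<partial>Xi_law d k)"
    using nn_integral_post[where G = "\<lambda>_ _. 1" and v = v, OF q r _ v] unfolding vp by simp
  have "(\<integral>\<^sup>+ b. 1 * (ennreal (b q r + L) * f (b p)) \<partial>Xi_law d k) =
      (\<integral>\<^sup>+ b. (\<Prod>j\<in>{1..k}. (if j = q then f else v j) (b j)) \<partial>Xi_law d k)"
    using q by (intro nn_integral_cong) (simp add: prod.remove[of "{1..k}" q] f_def[of "_ q"] vp[symmetric])
  also have "\<dots> = (\<Prod>j\<in>{1..k}. \<integral>\<^sup>+ w. (if j = q then f else v j) w \<partial>gamma_tr d)"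
    unfolding Xi_law_def using f v
    by (intro PiM.product_nn_integral_prod) (auto simp: measurable_cong_sets[OF sets_gamma_tr refl])
  also have "\<dots> = (\<Prod>j\<in>{1..k}. if j \<in> {p, q} then ennreal L else 1)"
    using nn_integral_gamma_tr_component[OF d r] g.emeasure_space_1
    by (intro prod.cong refl) (auto simp: v_def f_def[abs_def])
  also have "\<dots> = (\<Prod>j\<in>{p, q}. ennreal L)"
  proof -
    have "{1..k} \<inter> {p, q} = {p, q}" using p q by auto
    then show ?thesis using prod.inter_restrict[of "{1..k}" "\<lambda>_. ennreal L" "{p, q}"] by simp
  qed
  also have "\<dots> = ennreal L * ennreal L" using pq by (simp add: power2_eq_square)
  also have "\<dots> = ennreal (L * L)" by (rule ennreal_mult[symmetric]) simp_all
  finally have nn2: "(\<integral>\<^sup>+ b. 1 * (ennreal (b q r + L) * f (b p)) \<partial>Xi_law d k) = (\<integral>\<^sup>+ b. ennreal (L * L) \<partial>Xi_law d k)"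
    using Xi.emeasure_space_1 by simp
  \<comment> \<open>Conditional independence replaces b q by its posterior mean in the presence of b
    p, and unconditional independence evaluates the original integral. After expansion the linear
    terms vanish and only the mixed product is left.\<close>
  have "(\<integral>b. (mean q r b + L) * (b p r + L) \<partial>Xi_law d k) = (\<integral>b. L * L \<partial>Xi_law d k)"
  proof (rule integral_eqI_nn_integral)
    show "AE b in Xi_law d k. 0 \<le> (mean q r b + L) * (b p r + L)"
      using component_bound[OF p r] post_props(2)[OF winners_in r]
      by (auto elim!: eventually_mono simp: mean_def)
    have "(\<integral>\<^sup>+ b. ennreal ((mean q r b + L) * (b p r + L)) \<partial>Xi_law d k) =
        (\<integral>\<^sup>+ b. 1 * (ennreal (post q r (winners b) (observed b)) * f (b p)) \<partial>Xi_law d k)"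
      using post_props(2)[OF winners_in r] by (intro nn_integral_cong) (simp add: mean_def f_def ennreal_mult')
    then show "(\<integral>\<^sup>+ b. ennreal ((mean q r b + L) * (b p r + L)) \<partial>Xi_law d k) = (\<integral>\<^sup>+ b. ennreal (L * L) \<partial>Xi_law d k)"
      using nn nn2 by simp
  qed (simp_all, measurable)
  moreover have "(mean q r b + L) * (b p r + L) = b p r * mean q r b + L * mean q r b + L * b p r + L * L" for b
    by (simp add: algebra_simps)
  ultimately have "(\<integral>b. b p r * mean q r b + L * mean q r b + L * b p r + L * L \<partial>Xi_law d k) = (\<integral>b. L * L \<partial>Xi_law d k)"
    by simp
  then have "(\<integral>b. b p r * mean q r b \<partial>Xi_law d k) = 0"
    using integrable_component_mean[OF p r r, of q] integrable_mean[OF r, of q] integrable_component[OF p r]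
      integral_mean[OF q r] integral_component[OF p r]
    by (simp add: Xi.prob_space)
  then show ?thesis using integral_component_mean_eq[OF p r, of q] by simp
qed

section \<open>The exponential moment and the bound on the energy\<close>

definition energy :: real where
  "energy = (\<Sum>j\<in>{1..k}. \<Sum>r\<in>{1..d}. \<integral>b. mean j r b * mean j r b \<partial>Xi_law d k)"

lemma nn_integral_exp_mean:
  "(\<integral>\<^sup>+ b. ennreal (exp (\<Sum>j\<in>{1..k}. \<Sum>r\<in>{1..d}. b j r * mean j r b / 2 - mean j r b * mean j r b / 4)) \<partial>Xi_law d k)
    \<le> ennreal ((4 * real k) ^ T)"
proof -
  \<comment> \<open>Half the posterior mean as a function of the sequence and its linear answers.
    For a sequence that did not occur it is just some function of these answers, which is all that
    \<open>nn_integral_exp_predictable\<close> requires.\<close>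
  define h where "h i j y = (\<lambda>r. (post j r i y - L) / 2)" for i j y
  define e where "e i y b = (\<Prod>j\<in>{1..k}. ennreal (exp (ip d (b j) (h i j y) - ip d (h i j y) (h i j y))))" for i y and b :: "nat \<Rightarrow> vec"
  have eq: "ennreal (exp (\<Sum>j\<in>{1..k}. \<Sum>r\<in>{1..d}. b j r * mean j r b / 2 - mean j r b * mean j r b / 4)) =
      e (winners b) (observed b) b" for b
  proof -
    have "(\<Sum>r\<in>{1..d}. b j r * mean j r b / 2 - mean j r b * mean j r b / 4) =
        ip d (b j) (h (winners b) j (observed b)) - ip d (h (winners b) j (observed b)) (h (winners b) j (observed b))" for j
      unfolding ip_def sum_subtractf[symmetric] h_def mean_def[symmetric] by simp
    then show ?thesis unfolding e_def prod_ennreal[OF exp_ge_zero] by (simp only: exp_sum finite_atLeastAtMost)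
  qed
  have mh: "(\<lambda>y. h i j y r) \<in> borel_measurable seqs" if "i \<in> index_seqs" "r \<in> {1..d}" for i j r
    unfolding h_def by (intro borel_measurable_divide borel_measurable_diff measurable_post that borel_measurable_const)
  have me: "(\<lambda>b. e i (answers i b) b) \<in> borel_measurable (families d k)" if "i \<in> index_seqs" for i
    unfolding e_def
    by (intro borel_measurable_prod_ennreal measurable_compose[OF _ measurable_ennreal] measurable_compose[OF _ borel_measurable_exp]
        borel_measurable_diff borel_measurable_ip measurable_Rn_component[of _ _ d] measurable_component_singleton
        measurable_compose[OF measurable_answers[OF that] mh[OF that]])
  have le: "e (winners b) (observed b) b \<le> (\<Sum>i\<in>index_seqs. e i (answers i b) b)" for b
    using member_le_sum[OF winners_in[of b] _ finite_index_seqs, where f = "\<lambda>i. e i (answers i b) b"] by (simp add: answers_winners)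
  have "(\<integral>\<^sup>+ b. e (winners b) (observed b) b \<partial>Xi_law d k) \<le> (\<integral>\<^sup>+ b. (\<Sum>i\<in>index_seqs. e i (answers i b) b) \<partial>Xi_law d k)"
    by (intro nn_integral_mono le)
  also have "\<dots> = (\<Sum>i\<in>index_seqs. \<integral>\<^sup>+ b. e i (answers i b) b \<partial>Xi_law d k)"
    by (rule nn_integral_sum) (simp only: measurable_cong_sets[OF sets_Xi_law refl] me)
  also have "\<dots> \<le> (\<Sum>i\<in>index_seqs. 4 ^ T)"
  proof (rule sum_mono)
    fix i assume i: "i \<in> index_seqs"
    show "(\<integral>\<^sup>+ b. e i (answers i b) b \<partial>Xi_law d k) \<le> 4 ^ T"
      using protocol.nn_integral_exp_predictable[OF protocol[OF i] d, of "h i" T] mh[OF i]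
      by (subst nn_integral_Xi_law[OF d me[OF i]]) (simp add: e_def prod.distrib answers_def)
  qed
  also have "\<dots> = ennreal ((4 * real k) ^ T)"
    by (simp add: card_index_seqs power_mult_distrib ennreal_mult mult.commute flip: ennreal_power ennreal_of_nat_eq_real_of_nat)
  finally show ?thesis unfolding eq .
qed

text \<open>The constant 8 is 4 * 2: the 4 inverts E Z = energy / 4, and ln (4 k) is at most 2 ln (e
  k) because ln 4 is at most 2.\<close>

lemma energy_le: "energy \<le> 8 * real T * ln (exp 1 * real k)"
proof -
  define Z where "Z b = (\<Sum>j\<in>{1..k}. \<Sum>r\<in>{1..d}. b j r * mean j r b / 2 - mean j r b * mean j r b / 4)" for b
  have int: "integrable (Xi_law d k) (\<lambda>b. b j r * mean j r b)" "integrable (Xi_law d k) (\<lambda>b. mean j r b * mean j r b)"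
    if "j \<in> {1..k}" "r \<in> {1..d}" for j r
    using that by (intro integrable_component_mean integrable_mean_mean; simp)+
  have Z: "integrable (Xi_law d k) Z"
    unfolding Z_def using int by (intro Bochner_Integration.integrable_sum Bochner_Integration.integrable_diff) auto
  have "(\<integral>b. Z b \<partial>Xi_law d k) = (\<Sum>j\<in>{1..k}. \<Sum>r\<in>{1..d}. \<integral>b. b j r * mean j r b / 2 - mean j r b * mean j r b / 4 \<partial>Xi_law d k)"
    unfolding Z_def using int
    by (subst Bochner_Integration.integral_sum, (intro Bochner_Integration.integrable_sum Bochner_Integration.integrable_diff; simp),
        intro sum.cong refl Bochner_Integration.integral_sum Bochner_Integration.integrable_diff) auto
  also have "\<dots> = (\<Sum>j\<in>{1..k}. \<Sum>r\<in>{1..d}. (\<integral>b. mean j r b * mean j r b \<partial>Xi_law d k) / 4)"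
    using int integral_component_mean_eq by (intro sum.cong refl) simp
  also have "\<dots> = energy / 4"
    by (simp add: energy_def sum_divide_distrib)
  finally have E: "(\<integral>b. Z b \<partial>Xi_law d k) = energy / 4" .
  have "(\<integral>b. Z b \<partial>Xi_law d k) \<le> ln ((4 * real k) ^ T)"
    using nn_integral_exp_mean k unfolding Z_def[symmetric] by (intro Xi.integral_le_ln Z) simp_all
  also have "\<dots> = real T * ln (4 * real k)" by (rule ln_realpow)
  also have "\<dots> \<le> real T * (2 * ln (exp 1 * real k))"
  proof (intro mult_left_mono)
    have "ln 4 = 2 * ln (2 :: real)" using ln_realpow[of 2 2] by simp
    also have "\<dots> \<le> 2" using ln_le_minus_one[of "2 :: real"] by simp
    finally have "ln (4 :: real) \<le> 2" .
    moreover have "0 \<le> ln (real k)" using k by (intro ln_ge_zero) simp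
    moreover have "ln (4 * real k) = ln 4 + ln (real k)" "ln (exp 1 * real k) = 1 + ln (real k)"
      using k by (simp_all add: ln_mult)
    ultimately show "ln (4 * real k) \<le> 2 * ln (exp 1 * real k)" by linarith
  qed simp
  finally show ?thesis unfolding E by simp
qed

section \<open>From the individual means to the posterior mean of the sum\<close>

lemma post_mean_AE:
  "AE b in Xi_law d k. \<forall>r\<in>{1..d}. post_mean d k T A b r = (\<Sum>j\<in>{1..k}. mean j r b) \<and>
    post_mean_sc d k T A b r = (\<Sum>j\<in>{1..k}. mean j r b) / sqrt (real d)"
proof (rule AE_finite_allI)
  fix r assume r: "r \<in> {1..d}"
  let ?c = "\<lambda>f. real_cond_exp (Xi_law d k) (G_sigma d k T A) f"
  \<comment> \<open>Extension by 0 makes \<open>g j\<close> integrable for every natural number j,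
    as \<open>real_cond_exp_sum\<close> asks.\<close>
  define g where "g j b = (if j \<in> {1..k} then b j r else 0)" for j and b :: "nat \<Rightarrow> vec"
  have g: "integrable (Xi_law d k) (g j)" for j
    unfolding g_def using integrable_component[OF _ r] by (cases "1 \<le> j \<and> j \<le> k") auto
  have s: "(\<lambda>b. s_vec k b r) = (\<lambda>b. \<Sum>j\<in>{1..k}. g j b)"
    by (simp add: s_vec_def g_def)
  have ssc: "(\<lambda>b. s_sc_vec d k b r) = (\<lambda>b. s_vec k b r / sqrt (real d))"
    by (simp add: s_sc_vec_def s_vec_def a_vec_def sum_divide_distrib)
  have int: "integrable (Xi_law d k) (\<lambda>b. s_vec k b r)"
    unfolding s using g by (intro Bochner_Integration.integrable_sum)
  have "AE b in Xi_law d k. \<forall>j\<in>{1..k}. ?c (g j) b = mean j r b"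
  proof (rule AE_finite_allI)
    fix j assume "j \<in> {1..k}"
    then show "AE b in Xi_law d k. ?c (g j) b = mean j r b"
      using cond_exp_component[OF _ r] unfolding g_def by simp
  qed simp
  moreover have "AE b in Xi_law d k. ?c (\<lambda>b. \<Sum>j\<in>{1..k}. g j b) b = (\<Sum>j\<in>{1..k}. ?c (g j) b)"
    by (rule Xi.real_cond_exp_sum[OF g])
  moreover have "AE b in Xi_law d k. ?c (\<lambda>b. s_vec k b r / sqrt (real d)) b = ?c (\<lambda>b. s_vec k b r) b / sqrt (real d)"
    by (rule Xi.real_cond_exp_cdiv[OF int])
  ultimately show "AE b in Xi_law d k. post_mean d k T A b r = (\<Sum>j\<in>{1..k}. mean j r b) \<and>
    post_mean_sc d k T A b r = (\<Sum>j\<in>{1..k}. mean j r b) / sqrt (real d)"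
    unfolding post_mean_def post_mean_sc_def vec_cond_exp_def ssc
    by eventually_elim (simp add: s)
qed simp

text \<open>In each coordinate the cross terms vanish by \<open>integral_mean_mean\<close>, so the
  squared norm of the sum integrates to the sum of the individual energies.\<close>

lemma nn_integral_sum_mean:
  "(\<integral>\<^sup>+ b. ennreal (\<Sum>r\<in>{1..d}. (\<Sum>j\<in>{1..k}. mean j r b)\<^sup>2) \<partial>Xi_law d k) = ennreal energy"
proof -
  have sq: "(\<Sum>j\<in>{1..k}. mean j r b)\<^sup>2 = (\<Sum>p\<in>{1..k}. \<Sum>q\<in>{1..k}. mean p r b * mean q r b)" for r b
    by (simp add: power2_eq_square sum_product)
  have int: "integrable (Xi_law d k) (\<lambda>b. (\<Sum>j\<in>{1..k}. mean j r b)\<^sup>2)" if "r \<in> {1..d}" for r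
    unfolding sq using that by (intro Bochner_Integration.integrable_sum integrable_mean_mean)
  have "(\<integral>b. (\<Sum>j\<in>{1..k}. mean j r b)\<^sup>2 \<partial>Xi_law d k) = (\<Sum>p\<in>{1..k}. \<integral>b. mean p r b * mean p r b \<partial>Xi_law d k)"
    if r: "r \<in> {1..d}" for r
  proof -
    have "(\<integral>b. (\<Sum>j\<in>{1..k}. mean j r b)\<^sup>2 \<partial>Xi_law d k) =
        (\<Sum>p\<in>{1..k}. \<Sum>q\<in>{1..k}. \<integral>b. mean p r b * mean q r b \<partial>Xi_law d k)"
      unfolding sq using r by (simp add: integrable_mean_mean)
    also have "\<dots> = (\<Sum>p\<in>{1..k}. \<Sum>q\<in>{1..k}. if p = q then \<integral>b. mean p r b * mean p r b \<partial>Xi_law d k else 0)"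
      using integral_mean_mean[OF _ _ r] by (intro sum.cong refl) auto
    finally show ?thesis by simp
  qed
  then have "(\<integral>b. (\<Sum>r\<in>{1..d}. (\<Sum>j\<in>{1..k}. mean j r b)\<^sup>2) \<partial>Xi_law d k) = energy"
    unfolding energy_def using int by (subst sum.swap) (simp add: Bochner_Integration.integral_sum)
  moreover have "integrable (Xi_law d k) (\<lambda>b. \<Sum>r\<in>{1..d}. (\<Sum>j\<in>{1..k}. mean j r b)\<^sup>2)"
    using int by (intro Bochner_Integration.integrable_sum)
  ultimately show ?thesis
    by (subst nn_integral_eq_integral) (auto intro!: sum_nonneg)
qed

lemma nn_integral_post_mean:
  "(\<integral>\<^sup>+ b. ennreal ((L2_set (post_mean d k T A b) {1..d})\<^sup>2) \<partial>Xi_law d k) = ennreal energy"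
  "(\<integral>\<^sup>+ b. ennreal ((L2_set (post_mean_sc d k T A b) {1..d})\<^sup>2) \<partial>Xi_law d k) = ennreal (energy / real d)"
proof -
  have L2: "(L2_set f {1..d})\<^sup>2 = (\<Sum>r\<in>{1..d}. (f r)\<^sup>2)" for f
    unfolding L2_set_def by (simp add: sum_nonneg)
  show eq: "(\<integral>\<^sup>+ b. ennreal ((L2_set (post_mean d k T A b) {1..d})\<^sup>2) \<partial>Xi_law d k) = ennreal energy"
    unfolding nn_integral_sum_mean[symmetric] L2
    using post_mean_AE by (intro nn_integral_cong_AE) (auto elim!: eventually_mono)
  have m: "(\<lambda>b. ennreal (\<Sum>r\<in>{1..d}. (\<Sum>j\<in>{1..k}. mean j r b)\<^sup>2)) \<in> borel_measurable (Xi_law d k)"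
    by (intro measurable_compose[OF _ measurable_ennreal] borel_measurable_sum borel_measurable_power mean_measurable)
  have "(\<integral>\<^sup>+ b. ennreal ((L2_set (post_mean_sc d k T A b) {1..d})\<^sup>2) \<partial>Xi_law d k) =
      (\<integral>\<^sup>+ b. ennreal (1 / real d) * ennreal (\<Sum>r\<in>{1..d}. (\<Sum>j\<in>{1..k}. mean j r b)\<^sup>2) \<partial>Xi_law d k)"
    unfolding L2 using post_mean_AE
    by (intro nn_integral_cong_AE)
       (auto elim!: eventually_mono simp: power_divide sum_divide_distrib[symmetric] sum_nonneg simp flip: ennreal_mult')
  also have "\<dots> = ennreal (1 / real d) * ennreal energy"
    unfolding nn_integral_sum_mean[symmetric] by (rule nn_integral_cmult[OF m])
  finally show "(\<integral>\<^sup>+ b. ennreal ((L2_set (post_mean_sc d k T A b) {1..d})\<^sup>2) \<partial>Xi_law d k) = ennreal (energy / real d)"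
    by (simp flip: ennreal_mult')
qed

end

theorem proposition15:
  shows "\<exists>C_en::real. C_en > 0 \<and>
    (\<forall>(d::nat) (k::nat) (T::nat) (A::det_alg).
       d \<ge> 1 \<longrightarrow> k \<ge> 1 \<longrightarrow> T \<ge> 1 \<longrightarrow> A \<in> A_det d T \<longrightarrow>
         (\<integral>\<^sup>+ b. ennreal ((L2_set (post_mean d k T A b) {1..d})\<^sup>2) \<partial>(Xi_law d k))
           \<le> ennreal (C_en * real T * ln (exp 1 * real k)) \<and>
         (\<integral>\<^sup>+ b. ennreal ((L2_set (post_mean_sc d k T A b) {1..d})\<^sup>2) \<partial>(Xi_law d k))
           \<le> ennreal (C_en * (real T * ln (exp 1 * real k) / real d)))"
proof (intro exI[of _ 8] conjI allI impI)
  fix d k T :: nat and A :: det_alg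
  assume "d \<ge> 1" "k \<ge> 1" "A \<in> A_det d T"
  then interpret algorithm d k T A by unfold_locales
  show "(\<integral>\<^sup>+ b. ennreal ((L2_set (post_mean d k T A b) {1..d})\<^sup>2) \<partial>(Xi_law d k))
           \<le> ennreal (8 * real T * ln (exp 1 * real k))"
    unfolding nn_integral_post_mean by (intro ennreal_leI energy_le)
  have "energy / real d \<le> 8 * real T * ln (exp 1 * real k) / real d"
    by (intro divide_right_mono energy_le) simp
  then show "(\<integral>\<^sup>+ b. ennreal ((L2_set (post_mean_sc d k T A b) {1..d})\<^sup>2) \<partial>(Xi_law d k))
           \<le> ennreal (8 * (real T * ln (exp 1 * real k) / real d))"
    unfolding nn_integral_post_mean by (intro ennreal_leI) simp
qed simp

end
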